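(* Let $q\ge 2$ be an integer, let $b:\mathbb{N}\to\mathbb{N}$ be a digital function in base $q$, and let $m'\in\mathbb{N}$ satisfy $\gcd(q-1,m')=1$ and $\gcd\bigl(m',\gcd(\{b(n):n\in\mathbb{N}\})\bigr)=1$. Then the sequence $(b(n^2)\bmod m')_{n\in\mathbb{N}}$ is normal.
   Context: For an integer $n\ge 0$, $\varepsilon_j(n)\in\{0,\dots,q-1\}$ denotes the $j$-th digit of the base-$q$ expansion $n=\sum_{j\ge0}\varepsilon_j(n)q^j$, and $\varepsilon_{j}(n)=0$ for $j<0$. A function $b:\mathbb{N}\to\mathbb{N}$ is called a digital function (strongly block-additive $q$-ary function) if there exist an integer $m\ge 1$ and a function $F:\{0,\dots,q-1\}^m\to\mathbb{N}$ with $F(0,\dots,0)=0$ such that $b(n)=\sum_{j\in\mathbb{Z}}F(\varepsilon_{j+m-1}(n),\dots,\varepsilon_j(n))$ for all $n$. A sequence $(u(n))_{n}$ with values in $\{0,\dots,m'-1\}$ is normal if for every $k\in\mathbb{N}$ and every $(c_0,\dots,c_{k-1})\in\{0,\dots,m'-1\}^k$ one has $\lim_{N\to\infty}\frac1N\#\{i<N: u(i)=c_0,\dots,u(i+k-1)=c_{k-1}\}=(m')^{-k}$. *)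

theory Defs
  imports Complex_Main "HOL-Library.Groups_Big_Fun"
begin

definition digit :: "nat \<Rightarrow> int \<Rightarrow> nat \<Rightarrow> nat" where
  "digit q j n = (if j < 0 then 0 else n div q ^ nat j mod q)"

text \<open>
  The digit block \<open>(\<epsilon>\<^sub>j\<^sub>+\<^sub>m\<^sub>-\<^sub>1(n), \<dots>, \<epsilon>\<^sub>j(n))\<close>, most significant digit first.
\<close>
definition digit_block :: "nat \<Rightarrow> nat \<Rightarrow> int \<Rightarrow> nat \<Rightarrow> nat list" where
  "digit_block q m j n = map (\<lambda>i. digit q (j + int i) n) (rev [0..<m])"

text \<open>
  A function on \<open>{0,\<dots>,q-1}\<^sup>m\<close> is represented by a function on all lists; only its values on lists
  of length \<open>m\<close> with entries below \<open>q\<close> are used. The sum ranges over all integers \<open>j\<close>,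
  negative ones included; \<^const>\<open>Sum_any\<close> agrees with the intended sum because the support
  is finite (lemma \<open>finite_support_digit_block\<close> below).
\<close>
definition digital_function :: "nat \<Rightarrow> (nat \<Rightarrow> nat) \<Rightarrow> bool" where
  "digital_function q b \<longleftrightarrow>
     (\<exists>(m::nat) (F :: nat list \<Rightarrow> nat). m \<ge> 1 \<and> F (replicate m 0) = 0 \<and>
        (\<forall>n. b n = Sum_any (\<lambda>j::int. F (digit_block q m j n))))"

definition normal_sequence :: "nat \<Rightarrow> (nat \<Rightarrow> nat) \<Rightarrow> bool" where
  "normal_sequence m u \<longleftrightarrow>
     (\<forall>n. u n < m) \<and>
     (\<forall>(k::nat) (c :: nat \<Rightarrow> nat). (\<forall>l<k. c l < m) \<longrightarrow>
        (\<lambda>N. real (card {i. i < N \<and> (\<forall>l<k. u (i + l) = c l)}) / real N)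
          \<longlonglongrightarrow> 1 / real m ^ k)"

lemma digit_eq_0:
  assumes "q \<ge> 2" "j < 0 \<or> j \<ge> int n"
  shows "digit q j n = 0"
proof (cases "j < 0")
  case True
  then show ?thesis by (simp add: digit_def)
next
  case False
  with assms have "n \<le> nat j" by linarith
  also have "nat j < q ^ nat j"
    using assms(1) by (intro power_gt_expt) auto
  finally show ?thesis by (simp add: digit_def)
qed

lemma finite_support_digit_block:
  assumes "q \<ge> 2" "F (replicate m 0) = (0::nat)"
  shows "finite {j. F (digit_block q m j n) \<noteq> 0}"
proof (rule finite_subset)
  show "{j. F (digit_block q m j n) \<noteq> 0} \<subseteq> {- int m..int n}"
  proof (rule ccontr)
    assume "\<not> {j. F (digit_block q m j n) \<noteq> 0} \<subseteq> {- int m..int n}"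
    then obtain j where "F (digit_block q m j n) \<noteq> 0" "j \<notin> {- int m..int n}"
      by blast
    then have j: "F (digit_block q m j n) \<noteq> 0" "j < - int m \<or> j > int n"
      by auto
    have "digit q (j + int i) n = 0" if "i < m" for i
      using j(2) that by (intro digit_eq_0 assms) auto
    then have "digit_block q m j n = map (\<lambda>_. 0) (rev [0..<m])"
      unfolding digit_block_def by (intro map_cong) auto
    then have "digit_block q m j n = replicate m 0"
      by (simp add: map_replicate_const)
    with j(1) assms(2) show False by simp
  qed
qed simp

end

theory Submission
  imports Defs "HOL-Number_Theory.Cong" "HOL-Analysis.Convex" "HOL-Library.FuncSet"
begin

text \<open>
  By orthogonality of characters it suffices that every exponential sum over \<open>n < N\<close> of
  \<open>u(n) = e(\<Sum>\<^sub>l c\<^sub>l b((n + l)\<^sup>2) / m)\<close>, with some \<open>c\<^sub>l\<close> not divisible by \<open>m\<close>, is \<open>o(N)\<close>. Since no rate is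
  needed, the method of Mauduit and Rivat can be run with windows of bounded length.

  Averaging \<open>u\<close> over the shifts \<open>r + s q\<^sup>\<mu>\<close>, where \<open>r, s < R\<close> and \<open>N \<approx> q\<^sup>\<mu>\<^sup>+\<^sup>D\<close>, and applying
  Cauchy-Schwarz twice leaves averages of a product of four factors, in which the low digits of the
  squares (which do not depend on \<open>s\<close>) and the high digits (which do not depend on \<open>r\<close>) cancel.
  Only a bounded number of digits around position \<open>\<mu>\<close> matters. These digits of \<open>n\<^sup>2\<close>, the leading
  digits of \<open>n\<close> and the last digits of \<open>n\<close> become independent and uniform: shifting \<open>n\<close> by widely
  spaced powers of \<open>q\<close> translates the window by digits of \<open>2n\<close> at disjoint positions, which are
  exactly pairwise independent, so the law of large numbers applies.

  What remains is a correlation of the values of \<open>b\<close> along the progressions \<open>y + 2id\<close> with random digits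
  of \<open>y\<close>, \<open>y'\<close>, \<open>d\<close>. It decays exponentially in the window length as soon as one digit pattern changes
  its value, because such a pattern may or may not occur in each of many disjoint blocks. If no such
  pattern exists, then a nontrivial multiple of \<open>b\<close> is additive modulo \<open>m\<close> and invariant under
  multiplication by \<open>q\<close>, which is excluded by the two coprimality hypotheses.
\<close>

text \<open>Why a bounded window suffices: for \<open>n < q ^ L\<close> and
  \<open>\<mu> = L - D\<close>, changing \<open>r\<close> alters the square of
  \<open>n + r + s * q ^ \<mu>\<close> by about \<open>2 * r * n\<close>, which reaches digits well
  above position \<open>L\<close> only through a carry, while changing \<open>s\<close> alters it by
  a multiple of \<open>q ^ \<mu>\<close>. About \<open>D\<close> digits lie between, however large
  \<open>L\<close> is.

  The digits of \<open>2 * n\<close> come from the cross term \<open>2 * n * q ^ c\<close> of a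
  shift by \<open>q ^ c\<close>; keeping \<open>2 * c\<close> at most \<open>p\<close> puts
  \<open>q ^ (2 * c)\<close> below the resolution \<open>q ^ p\<close> at which squares are read.
  Window, leading digits and last digits take boundedly many values, so a union bound over them is
  affordable when the number of shifts is chosen after the window.

  An arithmetic obstacle remains: the last digits of \<open>n\<close> enter with the step
  \<open>2 * (s' - s)\<close>, which need not be invertible modulo powers of \<open>q\<close>. Its
  multiples still contain one fixed power \<open>q ^ \<kappa>\<close> modulo every
  \<open>q ^ K\<close>, so only \<open>\<kappa>\<close> low digits of the window are sacrificed.

  The parameters are fixed in the order \<open>R\<close>; carry margins and number of decay blocks;
  \<open>D\<close>; number of shifts; \<open>L\<close>.\<close>

subsection \<open>Block-additive functions\<close>

text \<open>
  In \<open>b_glue\<close> the digit strings \<open>u\<close>, \<open>v\<close>, \<open>w\<close> are concatenated; \<open>a\<close> is one less than the length of the blocks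
  that \<open>b\<close> reads, so no block meets both \<open>u\<close> and \<open>w\<close>. The modulus is \<open>m\<close>.
\<close>
locale block_additive =
  fixes q m a :: nat and b :: "nat \<Rightarrow> int"
  assumes q_ge_2: "2 \<le> q"
    and m_ge_1: "1 \<le> m"
    and b_0: "b 0 = 0"
    and b_mult_base: "b (q * n) = b n"
    and b_glue: "\<lbrakk>v < q ^ a; w < q ^ p\<rbrakk> \<Longrightarrow>
      b (u * q ^ (a + p) + v * q ^ p + w) + b v = b (u * q ^ a + v) + b (v * q ^ p + w)"
    and coprime_base: "coprime (int q - 1) (int m)"
    and b_generates: "(\<And>n. int m dvd x * b n) \<Longrightarrow> int m dvd x"
begin

lemma q_pos [simp]: "0 < q" and q_power_pos [simp]: "0 < q ^ n"
  using q_ge_2 by auto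

lemma b_mult_power: "b (n * q ^ p) = b n"
proof (induction p)
  case (Suc p)
  have "b (n * q ^ Suc p) = b (q * (n * q ^ p))" by (simp add: ac_simps)
  then show ?case using Suc b_mult_base by simp
qed simp

text \<open>A gap of \<open>a\<close> zeros separates the blocks that read \<open>u\<close> from
  those that read \<open>w\<close>.\<close>

lemma b_split:
  assumes "w < q ^ p"
  shows "b (u * q ^ (a + p) + w) = b u + b w"
  using b_glue[of 0 w p u] assms by (simp add: b_0 b_mult_power)

lemma b_insert:
  assumes "w < q ^ p" "v < q ^ s"
  shows "b (u * q ^ (a + (s + (a + p))) + v * q ^ (a + p) + w) = b u + b v + b w"
proof -
  have "v * q ^ (a + p) + w < q ^ (s + (a + p))"
  proof -
    have "w < q ^ (a + p)"
      using assms(1) by (rule less_le_trans) (use q_ge_2 in \<open>auto intro: power_increasing\<close>)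
    then have "v * q ^ (a + p) + w < (v + 1) * q ^ (a + p)" by simp
    also have "\<dots> \<le> q ^ s * q ^ (a + p)"
      by (rule mult_right_mono) (use assms in auto)
    finally show ?thesis by (simp add: power_add)
  qed
  then show ?thesis
    using b_split[of "v * q ^ (a + p) + w" "s + (a + p)" u] b_split[OF assms(1), of v]
    by (simp add: add.assoc)
qed

text \<open>
  A window of \<open>K\<close> digits overlaps by \<open>a\<close> digits with what lies below and with what lies above it; the
  blocks inside these overlaps are already counted there.
\<close>
definition window_part :: "nat \<Rightarrow> nat \<Rightarrow> int" where
  "window_part K w = b w - b (w mod q ^ a) - b (w div q ^ (K - a))"

text \<open>Gluing is used at position \<open>\<mu> - a\<close> with overlap \<open>v\<close>, and
  again inside the quotient \<open>z\<close> at position \<open>K - a\<close> with overlap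
  \<open>t\<close>. The corrections \<open>b v\<close> and \<open>b t\<close> are the two terms
  subtracted in \<open>window_part\<close>. Here \<open>K\<close> is
  \<open>\<nu> - \<mu> + 2 * a\<close>, that is, \<open>a\<close> extra digits on either
  side.\<close>

lemma b_decompose:
  assumes "a \<le> \<mu>" "\<mu> \<le> \<nu>" "K = \<nu> + a - (\<mu> - a)"
  shows "b x = b (x mod q ^ \<mu>) + b (x div q ^ \<nu>)
    + window_part K ((x div q ^ (\<mu> - a)) mod q ^ K)"
proof -
  define p where "p = \<mu> - a"
  define v where "v = (x div q ^ p) mod q ^ a"
  have mu: "\<mu> = a + p" and K: "K = \<nu> + a - p" and Ka: "K - a + p = \<nu>" "a + (K - a) = K"
    using assms by (auto simp: p_def)
  have pw: "q ^ \<mu> = q ^ p * q ^ a" by (simp add: mu power_add)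
  have x_low: "x mod q ^ \<mu> = v * q ^ p + x mod q ^ p"
    by (simp add: pw mod_mult2_eq v_def)
  have x_all: "x = (x div q ^ \<mu>) * q ^ (a + p) + v * q ^ p + x mod q ^ p"
    using div_mult_mod_eq[of x "q ^ \<mu>"] x_low by (simp add: mu)
  have z_all: "x div q ^ p = (x div q ^ \<mu>) * q ^ a + v"
    unfolding v_def pw div_mult2_eq by (simp add: div_mult_mod_eq)
  have 1: "b x + b v = b (x div q ^ p) + b (x mod q ^ \<mu>)"
    using b_glue[of v "x mod q ^ p" p "x div q ^ \<mu>"]
    by (subst x_all, subst x_low, subst z_all) (simp add: v_def)
  define z where "z = x div q ^ p"
  define t where "t = (z div q ^ (K - a)) mod q ^ a"
  define w where "w = z mod q ^ K"
  have pK: "q ^ K = q ^ (K - a) * q ^ a" using Ka(2) by (metis add.commute power_add)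
  have w_eq: "w = t * q ^ (K - a) + z mod q ^ (K - a)"
    by (simp add: w_def pK mod_mult2_eq t_def)
  have z_eq: "z = (z div q ^ K) * q ^ (a + (K - a)) + t * q ^ (K - a) + z mod q ^ (K - a)"
    using div_mult_mod_eq[of z "q ^ K"] w_eq by (simp add: Ka w_def)
  have z_high: "z div q ^ (K - a) = (z div q ^ K) * q ^ a + t"
    unfolding t_def pK div_mult2_eq by (simp add: div_mult_mod_eq)
  have "b z + b t = b (z div q ^ (K - a)) + b w"
    using b_glue[of t "z mod q ^ (K - a)" "K - a" "z div q ^ K"]
    by (subst z_eq, subst w_eq, subst z_high) (simp add: t_def)
  moreover have "z div q ^ (K - a) = x div q ^ \<nu>"
    unfolding z_def using Ka(1)
    by (simp add: div_mult2_eq[symmetric] power_add[symmetric] add.commute[of p])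
  moreover have "w div q ^ (K - a) = t"
    by (simp add: w_eq)
  moreover have "w mod q ^ a = v"
  proof -
    have "q ^ a dvd q ^ K" using pK by simp
    then show ?thesis by (simp add: w_def z_def v_def mod_mod_cancel)
  qed
  ultimately show ?thesis
    using 1 unfolding window_part_def p_def[symmetric] z_def[symmetric] w_def[symmetric] by simp
qed

text \<open>
  The hypothesis makes \<open>x (b (Y + 1) - b Y)\<close> periodic modulo \<open>q\<^sup>a\<close>, hence \<open>x b\<close> additive on multiples of
  \<open>q\<^sup>a\<close>, hence linear; then \<open>b q = b 1\<close> gives \<open>(q - 1) x b 1 = 0\<close>.
\<close>
lemma dvd_b_of_step_eq:
  assumes step: "\<And>Y. int m dvd x * ((b (Y + 1) - b 1) - (b (Y * q ^ a + (q ^ a - 1)) - b (q ^ a - 1)))"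
  shows "int m dvd x"
proof (rule b_generates)
  \<comment> \<open>\<open>c Y\<close> is the value of \<open>b\<close> at
    \<open>(Y + 1) * q ^ a - 1\<close>. So the hypothesis says that the jump of \<open>x * b\<close>
    at the multiple \<open>(Y + 1) * q ^ a\<close> is the same for all \<open>Y\<close>.\<close>
  define c where "c = (\<lambda>Y. b (Y * q ^ a + (q ^ a - 1)))"
  define P where "P = q ^ a"
  let ?M = "int m"
  let ?D = "\<lambda>Y. x * (b (Y + 1) - b Y)"
  \<comment> \<open>A block that meets an appended digit reaches at most \<open>a\<close> digits
    back into \<open>Y\<close>.\<close>
  have c_diff: "c Y - b Y = c (Y mod P) - b (Y mod P)" for Y
  proof -
    have "b ((Y div P) * q ^ (a + a) + (Y mod P) * q ^ a + (q ^ a - 1)) + b (Y mod P)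
      = b ((Y div P) * q ^ a + Y mod P) + b ((Y mod P) * q ^ a + (q ^ a - 1))"
      by (rule b_glue) (auto simp: P_def)
    moreover have "(Y div P) * q ^ (a + a) + (Y mod P) * q ^ a = Y * q ^ a"
      by (metis P_def div_mult_mod_eq distrib_right mult.assoc power_add)
    moreover have "(Y div P) * q ^ a + Y mod P = Y"
      by (simp add: P_def div_mult_mod_eq)
    ultimately show ?thesis by (simp add: c_def)
  qed
  have D_per: "[?D (Y + P) = ?D Y] (mod ?M)" for Y
  proof -
    have "?M dvd (x * ((b (Y + P + 1) - b 1) - (c (Y + P) - c 0))) - (x * ((b (Y + 1) - b 1) - (c Y - c 0)))"
      using step[of "Y + P"] step[of Y] by (intro dvd_diff) (simp_all add: c_def)
    moreover have "b (Y + P) = b Y + (c (Y + P) - c Y)"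
      using c_diff[of "Y + P"] c_diff[of Y] by simp
    then have "(x * ((b (Y + P + 1) - b 1) - (c (Y + P) - c 0))) - (x * ((b (Y + 1) - b 1) - (c Y - c 0)))
      = ?D (Y + P) - ?D Y"
      by (simp only: right_diff_distrib distrib_left)
    ultimately show ?thesis by (simp only: cong_iff_dvd_diff)
  qed
  have shift: "[x * (b (Y + P) - b Y) = x * b 1] (mod ?M)" for Y
  proof (induction Y)
    case 0
    have "b P = b 1" using b_mult_power[of 1 a] by (simp add: P_def)
    then show ?case by (simp add: b_0)
  next
    case (Suc Y)
    have "x * (b (Suc Y + P) - b (Suc Y)) = (?D (Y + P) - ?D Y) + x * (b (Y + P) - b Y)"
      by (simp add: algebra_simps)
    also have "[\<dots> = (?D Y - ?D Y) + x * b 1] (mod ?M)"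
      by (intro cong_add cong_diff D_per Suc cong_refl)
    finally show ?case by simp
  qed
  have lin: "[x * b n = int n * (x * b 1)] (mod ?M)" for n
  proof -
    have "[x * b (n * P) = int n * (x * b 1)] (mod ?M)"
    proof (induction n)
      case (Suc n)
      have "x * b (Suc n * P) = x * (b (n * P + P) - b (n * P)) + x * b (n * P)"
        by (simp add: algebra_simps)
      also have "[\<dots> = x * b 1 + int n * (x * b 1)] (mod ?M)"
        by (intro cong_add shift Suc)
      finally show ?case by (simp add: algebra_simps)
    qed (simp add: b_0)
    then show ?thesis by (simp add: P_def b_mult_power)
  qed
  have "b q = b 1" using b_mult_base[of 1] by simp
  then have "[x * b 1 = int q * (x * b 1)] (mod ?M)" using lin[of q] by simp
  then have "?M dvd (int q - 1) * (x * b 1)"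
    by (subst (asm) cong_sym_eq) (simp add: cong_iff_dvd_diff left_diff_distrib)
  then have "?M dvd x * b 1"
    using coprime_base by (simp add: coprime_commute coprime_dvd_mult_right_iff)
  then show "?M dvd x * b n" for n
    using lin[of n] by (meson cong_dvd_iff dvd_mult)
qed

text \<open>Supplies two patterns whose exchange changes the phase; the step 2 of the progressions
  stems from the cross term of a square. Without such patterns, a progression crossing a multiple of
  \<open>q ^ T\<close> at index \<open>j1\<close> isolates the tail of \<open>A\<close> from
  \<open>j1\<close> on: beyond the crossing the values depend on \<open>Y\<close> through
  \<open>b (Y + 1)\<close>, before it through \<open>Y\<close> followed by \<open>a\<close> digits
  \<open>q - 1\<close>, and \<open>sum0\<close> makes the two coefficients opposite. All tails are
  then divisible by \<open>m\<close>, hence so are their successive differences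
  \<open>A j\<close>.\<close>

lemma nondegenerate:
  fixes A :: "nat \<Rightarrow> int"
  assumes sum0: "(\<Sum>i<I. A i) = 0" and j: "j < I" "\<not> int m dvd A j"
  obtains y y' where "\<not> int m dvd (\<Sum>i<I. A i * (b (y + 2 * i) - b (y' + 2 * i)))"
proof (rule ccontr)
  assume "\<not> thesis"
  with that have all: "int m dvd (\<Sum>i<I. A i * (b (y + 2 * i) - b (y' + 2 * i)))" for y y'
    by blast
  define tail where "tail = (\<lambda>j. \<Sum>i\<in>{j..<I}. A i)"
  have "int m dvd tail j1" for j1
  proof (rule dvd_b_of_step_eq)
    fix Y
    define p where "p = 2 * I"
    define T where "T = a + p"
    have p: "2 * I < q ^ p"
      unfolding p_def by (rule power_gt_expt) (use q_ge_2 in auto)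
    \<comment> \<open>the progression starting at \<open>top Y\<close> crosses the multiple \<open>(Y + 1) q\<^sup>T\<close> exactly at index \<open>j1\<close>\<close>
    define top where "top = (\<lambda>Y. (Y + 1) * q ^ T - 2 * j1)"
    show "int m dvd tail j1 * ((b (Y + 1) - b 1) - (b (Y * q ^ a + (q ^ a - 1)) - b (q ^ a - 1)))"
    proof (cases "j1 \<le> I")
      case True
      have qT: "2 * I < q ^ T"
        using p by (rule less_le_trans) (use q_ge_2 in \<open>auto simp: T_def intro: power_increasing\<close>)
      have ge: "2 * j1 \<le> (Y + 1) * q ^ T" for Y
        using qT True by (simp add: trans_le_add1)
      have high: "b (top Y + 2 * i) = b (Y + 1) + b (2 * (i - j1))" if "j1 \<le> i" "i < I" for Y i
      proof -
        have "top Y + 2 * i = (Y + 1) * q ^ (a + p) + 2 * (i - j1)"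
          using ge[of Y] that by (simp add: top_def T_def diff_mult_distrib2)
        moreover have "2 * (i - j1) < q ^ p" using p that by linarith
        ultimately show ?thesis by (simp only: b_split)
      qed
      have low: "b (top Y + 2 * i) = b (Y * q ^ a + (q ^ a - 1))
          + (b ((q ^ a - 1) * q ^ p + (q ^ p - 2 * (j1 - i))) - b (q ^ a - 1))"
        if "i < j1" for Y i
      proof -
        have le: "2 * (j1 - i) \<le> q ^ p" using p True that by linarith
        have e1: "(Y + 1) * q ^ T = Y * q ^ T + (q ^ a - 1) * q ^ p + q ^ p"
        proof -
          have "(q ^ a - 1) * q ^ p + q ^ p = (q ^ a - 1 + 1) * q ^ p" by (simp only: distrib_right mult_1)
          also have "q ^ a - 1 + 1 = q ^ a" using q_power_pos[of a] by linarith
          finally show ?thesis by (simp add: T_def power_add distrib_right)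
        qed
        have "top Y + 2 * i = (Y + 1) * q ^ T - 2 * (j1 - i)"
          using ge[of Y] that by (simp add: top_def)
        also have "\<dots> = Y * q ^ (a + p) + (q ^ a - 1) * q ^ p + (q ^ p - 2 * (j1 - i))"
          unfolding e1 using le by (simp add: T_def)
        finally have e: "top Y + 2 * i = Y * q ^ (a + p) + (q ^ a - 1) * q ^ p + (q ^ p - 2 * (j1 - i))" .
        have "q ^ p - 2 * (j1 - i) < q ^ p" using that by simp
        then show ?thesis using b_glue[of "q ^ a - 1" "q ^ p - 2 * (j1 - i)" p Y] unfolding e by simp
      qed
      let ?h = "b (Y + 1) - b 1" and ?l = "b (Y * q ^ a + (q ^ a - 1)) - b (q ^ a - 1)"
      have "(\<Sum>i<I. A i * (b (top Y + 2 * i) - b (top 0 + 2 * i)))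
          = (\<Sum>i\<in>{..<j1}. A i * ?l) + (\<Sum>i\<in>{j1..<I}. A i * ?h)"
      proof -
        have "(\<Sum>i<I. A i * (b (top Y + 2 * i) - b (top 0 + 2 * i)))
          = (\<Sum>i<I. if i < j1 then A i * ?l else A i * ?h)"
          by (intro sum.cong refl) (auto simp: high low)
        also have "\<dots> = (\<Sum>i\<in>{..<j1} \<union> {j1..<I}. if i < j1 then A i * ?l else A i * ?h)"
          using True by (intro sum.cong) auto
        also have "\<dots> = (\<Sum>i\<in>{..<j1}. A i * ?l) + (\<Sum>i\<in>{j1..<I}. A i * ?h)"
          by (subst sum.union_disjoint) (auto intro!: arg_cong2[where f = "(+)"] sum.cong)
        finally show ?thesis .
      qed
      also have "\<dots> = (\<Sum>i<j1. A i) * ?l + tail j1 * ?h"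
        by (simp add: tail_def sum_distrib_right)
      also have "(\<Sum>i<j1. A i) = - tail j1"
      proof -
        have "(\<Sum>i\<in>{..<j1} \<union> {j1..<I}. A i) = (\<Sum>i<j1. A i) + tail j1"
          unfolding tail_def by (rule sum.union_disjoint) auto
        moreover have "{..<j1} \<union> {j1..<I} = {..<I}" using True by auto
        ultimately show ?thesis using sum0 by simp
      qed
      finally have "(\<Sum>i<I. A i * (b (top Y + 2 * i) - b (top 0 + 2 * i))) = tail j1 * (?h - ?l)"
        by (simp add: algebra_simps)
      then show ?thesis using all[of "top Y" "top 0"] by (simp only:)
    qed (simp add: tail_def)
  qed
  then have "int m dvd tail j - tail (Suc j)" by (intro dvd_diff)
  moreover have "tail j = A j + tail (Suc j)"
    unfolding tail_def using j by (simp add: sum.atLeast_Suc_lessThan)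
  ultimately show False using j by simp
qed

text \<open>Above position \<open>p'\<close> lie \<open>c\<close> digits belonging to
  \<open>B\<close>, \<open>a\<close> zeros, the \<open>s\<close> digits of \<open>v\<close> and
  \<open>a\<close> zeros. Since \<open>v\<close> stays above the lowest \<open>a\<close> digits and
  below position \<open>K - a\<close>, neither border term of \<open>window_part\<close> sees
  it.\<close>

lemma window_part_insert:
  assumes "a \<le> p'" "B < q ^ (p' + c)" "v < q ^ s" "p' + (c + a + s + a) \<le> K - a"
  shows "window_part K ((A * q ^ (p' + (c + a + s + a)) + v * q ^ (p' + (c + a)) + B) mod q ^ K)
    = window_part K ((A * q ^ (p' + (c + a + s + a)) + B) mod q ^ K) + b v"
proof -
  define e where "e = p' + (c + a + s + a)"
  define A' where "A' = A mod q ^ (K - e)"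
  have eK: "e \<le> K - a" "e \<le> K" using assms by (auto simp: e_def)
  have e': "e = a + (s + (a + (p' + c)))" by (simp add: e_def)
  have Bl: "v * q ^ (p' + (c + a)) + B < q ^ e"
  proof -
    have "B < q ^ (p' + (c + a))"
      using assms(2) by (rule less_le_trans) (use q_ge_2 in \<open>auto intro: power_increasing\<close>)
    then have "v * q ^ (p' + (c + a)) + B < (v + 1) * q ^ (p' + (c + a))" by simp
    also have "\<dots> \<le> q ^ s * q ^ (p' + (c + a))"
      by (rule mult_right_mono) (use assms in auto)
    also have "\<dots> = q ^ (s + (p' + (c + a)))" by (simp add: power_add)
    also have "\<dots> \<le> q ^ e" using q_ge_2 by (intro power_increasing) (auto simp: e_def)
    finally show ?thesis .
  qed
  have md: "(A * q ^ e + r) mod q ^ K = A' * q ^ e + r" if "r < q ^ e" for r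
  proof -
    have "q ^ K = q ^ e * q ^ (K - e)" using eK by (simp flip: power_add)
    then show ?thesis using that by (simp add: mod_mult2_eq A'_def)
  qed
  have dv: "(A' * q ^ e + r) div q ^ (K - a) = A' div q ^ (K - a - e)" if "r < q ^ e" for r
  proof -
    have "q ^ (K - a) = q ^ e * q ^ (K - a - e)"
      using eK(1) by (simp only: power_add[symmetric] le_add_diff_inverse)
    then show ?thesis using that by (simp add: div_mult2_eq)
  qed
  have "q ^ a dvd A' * q ^ e" "q ^ a dvd v * q ^ (p' + (c + a))"
    by (intro dvd_mult le_imp_power_dvd; simp add: e_def)+
  then obtain k k' where k: "A' * q ^ e = q ^ a * k" "v * q ^ (p' + (c + a)) = q ^ a * k'"
    by (auto elim!: dvdE)
  have mo: "(A' * q ^ e + v * q ^ (p' + (c + a)) + B) mod q ^ a = (A' * q ^ e + B) mod q ^ a"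
  proof -
    have "A' * q ^ e + v * q ^ (p' + (c + a)) + B = B + q ^ a * (k + k')" "A' * q ^ e + B = B + q ^ a * k"
      unfolding k by (simp_all add: distrib_left)
    then show ?thesis by (simp only: mod_mult_self2)
  qed
  have b1: "b (A' * q ^ e + v * q ^ (p' + (c + a)) + B) = b A' + b v + b B"
    using b_insert[OF assms(2,3), of A'] unfolding e' by (simp only: ac_simps)
  have b2: "b (A' * q ^ e + B) = b A' + b B"
    using b_insert[OF assms(2), of 0 s A'] unfolding e' by (simp add: b_0)
  have "B < q ^ e" using Bl by simp
  then show ?thesis
    unfolding e_def[symmetric] window_part_def
    using md[OF Bl] md[of B] dv[OF Bl] dv[of B] mo b1 b2 by (simp add: add.assoc)
qed

end

section \<open>Digital functions as block-additive functions\<close>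

lemma digital_function_glue:
  assumes q: "q \<ge> 2" and dig: "digital_function q b"
  obtains a where "b 0 = 0" "\<And>n. b (q * n) = b n"
    "\<And>u v w p. \<lbrakk>v < q ^ a; w < q ^ p\<rbrakk> \<Longrightarrow>
      b (u * q ^ (a + p) + v * q ^ p + w) + b v = b (u * q ^ a + v) + b (v * q ^ p + w)"
proof -
  obtain k F where k: "k \<ge> 1" and F: "F (replicate k 0) = (0::nat)"
    and b: "\<And>n. b n = Sum_any (\<lambda>j::int. F (digit_block q k j n))"
    using dig unfolding digital_function_def by auto
  define f where "f = (\<lambda>j n. F (digit_block q k j n))"
  have bf: "b n = Sum_any (\<lambda>j. f j n)" for n by (simp add: b f_def)
  have fin: "finite {j. f j n \<noteq> 0}" for n
    unfolding f_def by (rule finite_support_digit_block) (rule q, rule F)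
  have block_cong: "f j n = f j' n'"
    if "\<And>i. i < k \<Longrightarrow> digit q (j + int i) n = digit q (j' + int i) n'" for j j' n n'
  proof -
    have "digit_block q k j n = digit_block q k j' n'"
      unfolding digit_block_def by (rule map_cong) (auto simp: that)
    then show ?thesis by (simp add: f_def)
  qed
  \<comment> \<open>Since the sum runs over all integer positions, translating the position costs
    nothing. This gives invariance under multiplication by \<open>q\<close> and lets numbers be
    compared with their quotients by \<open>q ^ p\<close>.\<close>
  have shift: "Sum_any (\<lambda>j. f (j - t) n) = b n" for t n
    unfolding bf
    by (rule Sum_any.reindex_cong[of "\<lambda>j. j - t", symmetric])
       (auto simp: bij_def inj_def surj_def fun_eq_iff o_def intro: exI[of _ "_ + t"])
  have finsh: "finite {j. f (j - t) n \<noteq> 0}" for t n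
  proof -
    have "{j. f (j - t) n \<noteq> 0} \<subseteq> (\<lambda>j. j + t) ` {j. f j n \<noteq> 0}"
    proof
      fix j assume "j \<in> {j. f (j - t) n \<noteq> 0}"
      then show "j \<in> (\<lambda>j. j + t) ` {j. f j n \<noteq> 0}" by (intro image_eqI[of _ _ "j - t"]) auto
    qed
    then show ?thesis using fin finite_surj by blast
  qed
  show thesis
  proof (rule that[of "k - 1"])
    have "digit q j 0 = 0" for j by (simp add: digit_def)
    then have "digit_block q k j 0 = replicate k 0" for j
      by (simp add: digit_block_def map_replicate_const)
    then show "b 0 = 0" by (simp add: b F)
  next
    fix n
    have "digit q j (q * n) = digit q (j - 1) n" for j
    proof (cases "j \<le> 0")
      case False
      then have "q ^ nat j = q * q ^ nat (j - 1)"
      proof -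
        have "nat j = Suc (nat (j - 1))" using False by simp
        then show ?thesis by (simp only: power_Suc)
      qed
      then show ?thesis using False q by (simp add: digit_def div_mult2_eq)
    qed (auto simp: digit_def)
    then have "f j (q * n) = f (j - 1) n" for j
      by (intro block_cong) (simp add: algebra_simps)
    then show "b (q * n) = b n" using shift[of 1 n] by (simp add: bf)
  next
    fix u v w p
    assume v: "v < q ^ (k - 1)" and w: "w < q ^ p"
    let ?x = "u * q ^ (k - 1 + p) + v * q ^ p + w"
    let ?y = "u * q ^ (k - 1) + v" and ?z = "v * q ^ p + w"
    have qp [simp]: "q > 0" using q by simp
    have xdiv: "?x div q ^ p = ?y" and zdiv: "?z div q ^ p = v"
    proof -
      have "?x = w + q ^ p * ?y" by (simp add: power_add algebra_simps)
      then show "?x div q ^ p = ?y" using w by simp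
      show "?z div q ^ p = v" using w by simp
    qed
    have high: "digit q (j + int i) n = digit q (j - int p + int i) (n div q ^ p)"
      if jp: "j \<ge> int p" for j n i
    proof -
      define j' where "j' = j + int i"
      have "j' \<ge> int p" using jp by (simp add: j'_def)
      then have "nat j' = p + nat (j' - int p)" by simp
      then have "q ^ nat j' = q ^ p * q ^ nat (j' - int p)" by (metis power_add)
      then have "digit q j' n = digit q (j' - int p) (n div q ^ p)"
        using \<open>j' \<ge> int p\<close> by (simp add: digit_def div_mult2_eq)
      then show ?thesis by (simp add: j'_def algebra_simps)
    qed
    have low: "digit q j (u' * q ^ s + n) = digit q j n" if "j < int s" for j u' s n
    proof (cases "j < 0")
      case False
      then have "nat j < s" using that by linarith
      then obtain r where "s = Suc (nat j + r)" by (auto dest: less_imp_Suc_add)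
      then have e: "u' * q ^ s + n = n + q ^ nat j * (q * (u' * q ^ r))"
        by (simp add: power_add ac_simps)
      show ?thesis unfolding digit_def e using False by simp
    qed (simp add: digit_def)
    \<comment> \<open>The identity holds block by block: a block starting at or above
      \<open>p\<close> sees nothing of \<open>w\<close>, and one starting below \<open>p\<close>
      ends below \<open>k - 1 + p\<close> and sees nothing of \<open>u\<close>.\<close>
    have "f j ?x + f (j - int p) v = f (j - int p) ?y + f j ?z" for j
    proof (cases "j \<ge> int p")
      case True
      have "f j ?x = f (j - int p) ?y"
        by (rule block_cong) (simp only: high[OF True] xdiv)
      moreover have "f j ?z = f (j - int p) v"
        by (rule block_cong) (simp only: high[OF True] zdiv)
      ultimately show ?thesis by simp
    next
      case False
      have "f j ?x = f j ?z"
      proof (rule block_cong)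
        fix i assume "i < k"
        then have "j + int i < int (k - 1 + p)" using False k by linarith
        from low[OF this, of u ?z] show "digit q (j + int i) ?x = digit q (j + int i) ?z"
          by (simp add: add.assoc)
      qed
      moreover have "f (j - int p) ?y = f (j - int p) v"
      proof (rule block_cong)
        fix i assume "i < k"
        then have "j - int p + int i < int (k - 1)" using False k by linarith
        from low[OF this, of u v] show "digit q (j - int p + int i) ?y = digit q (j - int p + int i) v" .
      qed
      ultimately show ?thesis by simp
    qed
    then have "Sum_any (\<lambda>j. f j ?x + f (j - int p) v) = Sum_any (\<lambda>j. f (j - int p) ?y + f j ?z)"
      by simp
    then show "b ?x + b v = b ?y + b ?z"
      by (subst (asm) (1 2) Sum_any.distrib) (simp_all only: fin finsh shift bf[symmetric])
  qed
qed

subsection \<open>Finite sums and characters\<close>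

lemma sum_lessThan_mult:
  fixes f :: "nat \<Rightarrow> 'a::comm_monoid_add"
  shows "(\<Sum>x<A * M. f x) = (\<Sum>i<A. \<Sum>j<M. f (i + A * j))"
proof -
  have "sum f {m * A..<m * A + A} = (\<Sum>i<A. f (i + A * m))" for m
    by (subst sum.atLeastLessThan_shift_0) (simp add: atLeast0LessThan ac_simps)
  then have "(\<Sum>x<M * A. f x) = (\<Sum>j<M. \<Sum>i<A. f (i + A * j))"
    by (subst sum.nat_group[symmetric]) simp
  then show ?thesis by (subst sum.swap) (simp add: mult.commute)
qed

lemma periodic_mult:
  fixes f :: "nat \<Rightarrow> 'a"
  assumes "\<And>x. f (x + W) = f x"
  shows "f (x + W * k) = f x"
proof (induction k)
  case (Suc k)
  have "f (x + W * Suc k) = f ((x + W * k) + W)" by (simp add: ac_simps)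
  with Suc assms show ?case by simp
qed simp

lemma periodic_cong:
  fixes f :: "nat \<Rightarrow> 'a"
  assumes "\<And>x. f (x + W) = f x" "[x = y] (mod W)"
  shows "f x = f y"
proof -
  have "f z = f (z mod W)" for z
    using periodic_mult[of f, OF assms(1), of "z mod W" "z div W"] by simp
  then show ?thesis using assms(2) by (metis cong_def)
qed

lemma sum_periodic_shift:
  fixes f :: "nat \<Rightarrow> 'a::ab_group_add"
  assumes per: "\<And>x. f (x + W) = f x"
  shows "(\<Sum>x<W. f (x + t)) = (\<Sum>x<W. f x)"
proof (induction t)
  case (Suc t)
  have "(\<Sum>x<Suc W. f (x + t)) = f t + (\<Sum>x<W. f (Suc x + t))"
    by (subst sum.lessThan_Suc_shift) simp
  moreover have "f (W + t) = f t" using per[of t] by (simp add: add.commute)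
  ultimately show ?case using Suc by simp
qed simp

lemma sum_squared_le_card:
  fixes f :: "'a \<Rightarrow> real"
  shows "(\<Sum>x\<in>A. f x)\<^sup>2 \<le> real (card A) * (\<Sum>x\<in>A. (f x)\<^sup>2)"
proof (cases "finite A")
  case True
  then show ?thesis using sum_squared_le_sum_of_squares[of f A] by (simp add: mult.commute)
qed simp

lemma norm_sum_squared:
  fixes z :: "'a \<Rightarrow> complex"
  shows "complex_of_real ((cmod (\<Sum>x\<in>A. z x))\<^sup>2) = (\<Sum>x\<in>A. \<Sum>y\<in>A. z x * cnj (z y))"
  by (simp only: complex_norm_square cnj_sum sum_product)

lemma norm_sum_shift_le:
  fixes f :: "nat \<Rightarrow> complex"
  assumes "\<And>n. cmod (f n) \<le> 1"
  shows "cmod ((\<Sum>n<N. f (n + g)) - (\<Sum>n<N. f n)) \<le> 2 * real g"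
proof (induction g)
  case (Suc g)
  have e: "(\<Sum>n<N. f (n + Suc g)) = (\<Sum>n<N. f (n + g)) + (f (N + g) - f g)"
    using sum.lessThan_Suc_shift[of "\<lambda>n. f (n + g)" N] by (simp add: algebra_simps)
  have "cmod ((\<Sum>n<N. f (n + Suc g)) - (\<Sum>n<N. f n))
      = cmod (((\<Sum>n<N. f (n + g)) - (\<Sum>n<N. f n)) + (f (N + g) - f g))"
    unfolding e by (simp add: algebra_simps)
  also have "\<dots> \<le> 2 * real g + (1 + 1)"
    by (intro norm_triangle_le add_mono norm_triangle_le_diff Suc assms)
  finally show ?case by simp
qed simp

section \<open>Additive characters modulo \<open>m\<close>\<close>

definition character :: "nat \<Rightarrow> int \<Rightarrow> complex" where
  "character m x = cis (2 * pi * of_int x / of_nat m)"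

lemma norm_character [simp]: "cmod (character m x) = 1"
  by (simp add: character_def)

lemma character_0 [simp]: "character m 0 = 1"
  by (simp add: character_def)

lemma character_add: "character m (x + y) = character m x * character m y"
  by (simp add: character_def cis_mult add_divide_distrib distrib_left)

lemma cnj_character: "cnj (character m x) = character m (- x)"
  by (simp add: character_def cis_cnj)

lemma character_diff: "character m (x - y) = character m x * cnj (character m y)"
  using character_add[of m x "- y"] by (simp add: cnj_character)

lemma character_sum: "character m (\<Sum>i\<in>A. f i) = (\<Prod>i\<in>A. character m (f i))"
  by (induction A rule: infinite_finite_induct) (simp_all add: character_add)

lemma character_eq_1_iff:
  assumes "m \<ge> 1"
  shows "character m x = 1 \<longleftrightarrow> int m dvd x"
proof
  assume "character m x = 1"
  then have "cos (2 * pi * of_int x / of_nat m) = 1"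
    by (simp add: character_def complex_eq_iff)
  then obtain k :: int where "2 * pi * of_int x / of_nat m = of_int k * 2 * pi"
    using cos_one_2pi_int by auto
  then have "of_int x = (of_int (k * int m) :: real)"
    using assms by (simp add: field_simps)
  then have "x = k * int m" by (simp only: of_int_eq_iff)
  then show "int m dvd x" by simp
next
  assume "int m dvd x"
  then obtain k where "x = int m * k" by (elim dvdE)
  then have "2 * pi * of_int x / of_nat m = 2 * pi * of_int k"
    using assms by simp
  then show "character m x = 1"
    unfolding character_def by (simp add: cis_multiple_2pi)
qed

text \<open>The squared norm is \<open>2 + 2 * Re z\<close>, and 1 is the only point of the unit
  circle with real part 1. This strict inequality is the source of the gain in each digit
  block.\<close>

lemma norm_one_plus_less_2:
  fixes z :: complex
  assumes "cmod z = 1" "z \<noteq> 1"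
  shows "cmod (1 + z) < 2"
proof (rule ccontr)
  assume "\<not> ?thesis"
  then have "2 ^ 2 \<le> (cmod (1 + z)) ^ 2" by (intro power_mono) auto
  moreover have "(cmod (1 + z))\<^sup>2 = 1 + 2 * Re z + (cmod z)\<^sup>2"
    by (simp only: cmod_power2) (simp add: power2_eq_square algebra_simps)
  moreover have "Re z \<le> 1" using complex_Re_le_cmod[of z] assms by simp
  ultimately have "Re z = 1" using assms by simp
  moreover from this have "Im z = 0" using assms(1) cmod_power2[of z] by simp
  ultimately show False using assms(2) by (simp add: complex_eq_iff)
qed

subsection \<open>A multiplicative functional of independent blocks\<close>

text \<open>The recursion lets an induction on \<open>J\<close> peel off the lowest
  base-\<open>Q\<close> digit of all three arguments at once; \<open>block_sum_eq\<close> is the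
  closed form.\<close>

primrec block_sum ::
  "(nat \<Rightarrow> nat \<Rightarrow> nat \<Rightarrow> complex) \<Rightarrow> nat \<Rightarrow> nat \<Rightarrow> nat \<Rightarrow> nat \<Rightarrow> nat \<Rightarrow> nat \<Rightarrow> complex" where
  "block_sum \<Phi> Q 0 B x y d = \<Phi> x y d"
| "block_sum \<Phi> Q (Suc J) B x y d =
     (\<Sum>i<Q. \<Sum>j<Q. \<Sum>k<Q. block_sum \<Phi> Q J (B * Q) (x + B * i) (y + B * j) (d + B * k))"

lemma sum_swap_blocks:
  "(\<Sum>i\<in>I. \<Sum>j0\<in>J0. \<Sum>j\<in>J. \<Sum>k0\<in>K0. \<Sum>k\<in>K. F i j0 j k0 k) =
   (\<Sum>j0\<in>J0. \<Sum>k0\<in>K0. \<Sum>i\<in>I. \<Sum>j\<in>J. \<Sum>k\<in>K. F i j0 j k0 k)"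
proof -
  have "(\<Sum>i\<in>I. \<Sum>j0\<in>J0. \<Sum>j\<in>J. \<Sum>k0\<in>K0. \<Sum>k\<in>K. F i j0 j k0 k) =
      (\<Sum>j0\<in>J0. \<Sum>i\<in>I. \<Sum>j\<in>J. \<Sum>k0\<in>K0. \<Sum>k\<in>K. F i j0 j k0 k)"
    by (rule sum.swap)
  also have "\<dots> = (\<Sum>j0\<in>J0. \<Sum>i\<in>I. \<Sum>k0\<in>K0. \<Sum>j\<in>J. \<Sum>k\<in>K. F i j0 j k0 k)"
    by (rule sum.cong[OF refl], rule sum.cong[OF refl], rule sum.swap)
  also have "\<dots> = (\<Sum>j0\<in>J0. \<Sum>k0\<in>K0. \<Sum>i\<in>I. \<Sum>j\<in>J. \<Sum>k\<in>K. F i j0 j k0 k)"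
    by (rule sum.cong[OF refl], rule sum.swap)
  finally show ?thesis .
qed

lemma block_sum_eq:
  "block_sum \<Phi> Q J B x y d =
    (\<Sum>i<Q ^ J. \<Sum>j<Q ^ J. \<Sum>k<Q ^ J. \<Phi> (x + B * i) (y + B * j) (d + B * k))"
proof (induction J arbitrary: B x y d)
  case (Suc J)
  let ?F = "\<lambda>i0 i j0 j k0 k. \<Phi> (x + B * (i0 + Q * i)) (y + B * (j0 + Q * j)) (d + B * (k0 + Q * k))"
  have "block_sum \<Phi> Q (Suc J) B x y d =
      (\<Sum>i0<Q. \<Sum>j0<Q. \<Sum>k0<Q. \<Sum>i<Q ^ J. \<Sum>j<Q ^ J. \<Sum>k<Q ^ J. ?F i0 i j0 j k0 k)"
    unfolding block_sum.simps Suc by (simp add: distrib_left ac_simps)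
  also have "\<dots> = (\<Sum>i0<Q. \<Sum>i<Q ^ J. \<Sum>j0<Q. \<Sum>j<Q ^ J. \<Sum>k0<Q. \<Sum>k<Q ^ J. ?F i0 i j0 j k0 k)"
    by (rule sum.cong[OF refl], rule sum_swap_blocks[symmetric])
  also have "\<dots> = (\<Sum>i<Q ^ Suc J. \<Sum>j<Q ^ Suc J. \<Sum>k<Q ^ Suc J. \<Phi> (x + B * i) (y + B * j) (d + B * k))"
    by (simp only: power_Suc sum_lessThan_mult)
  finally show ?case .
qed simp

text \<open>
  Pairing the contents \<open>0\<close> and \<open>(z1, z2, z3)\<close> of a block replaces the trivial contribution \<open>2\<close> of the two
  by \<open>\<bar>1 + \<zeta>\<bar>\<close>.
\<close>
lemma block_sum_bound:
  assumes norm: "\<And>x y d. cmod (\<Phi> x y d) \<le> 1"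
    and z: "z1 < Q" "z2 < Q" "z3 < Q" "0 < z3" and B: "0 < B"
    and ins: "\<And>t x y d. \<lbrakk>t < J; (x div (B * Q ^ t)) mod Q = 0; (y div (B * Q ^ t)) mod Q = 0;
        (d div (B * Q ^ t)) mod Q = 0\<rbrakk> \<Longrightarrow>
        \<Phi> (x + B * Q ^ t * z1) (y + B * Q ^ t * z2) (d + B * Q ^ t * z3) = \<zeta> * \<Phi> x y d"
    and zero: "(x div B) mod Q ^ J = 0" "(y div B) mod Q ^ J = 0" "(d div B) mod Q ^ J = 0"
  shows "cmod (block_sum \<Phi> Q J B x y d) \<le> (real Q ^ 3 - 2 + cmod (1 + \<zeta>)) ^ J"
  using B ins zero
proof (induction J arbitrary: B x y d)
  case 0
  then show ?case using norm by simp
next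
  case (Suc J)
  note B = Suc.prems(1) and ins = Suc.prems(2)
  define c where "c = real Q ^ 3 - 2 + cmod (1 + \<zeta>)"
  define S where "S = (\<lambda>(i, j, k). block_sum \<Phi> Q J (B * Q) (x + B * i) (y + B * j) (d + B * k))"
  define T where "T = {..<Q} \<times> {..<Q} \<times> {..<Q}"
  have Q: "0 < Q" using z by simp
  have digit0: "((u + B * i) div (B * Q)) mod Q ^ J = 0" if "(u div B) mod Q ^ Suc J = 0" "i < Q" for u i
  proof -
    from that obtain h where h: "u div B = Q ^ Suc J * h" by (auto elim: dvdE)
    have "(u + B * i) div (B * Q) = (u div B + i) div Q"
      using B by (simp add: div_mult2_eq add.commute)
    also have "\<dots> = (i + Q * (Q ^ J * h)) div Q"
      by (simp add: h ac_simps)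
    also have "\<dots> = Q ^ J * h" using that(2) by simp
    finally show ?thesis by simp
  qed
  have bound: "cmod (S p) \<le> c ^ J" if p0: "p \<in> T" for p
  proof -
    obtain i j k where p: "p = (i, j, k)" "i < Q" "j < Q" "k < Q"
      using p0 by (auto simp: T_def)
    show ?thesis
      unfolding p S_def c_def prod.case
    proof (rule Suc.IH)
      fix t x y d
      assume "t < J" and 0: "x div (B * Q * Q ^ t) mod Q = 0" "y div (B * Q * Q ^ t) mod Q = 0"
        "d div (B * Q * Q ^ t) mod Q = 0"
      then show "\<Phi> (x + B * Q * Q ^ t * z1) (y + B * Q * Q ^ t * z2) (d + B * Q * Q ^ t * z3)
          = \<zeta> * \<Phi> x y d"
        using ins[of "Suc t" x y d] by (simp add: mult.assoc)
    qed (use B Q p digit0 Suc.prems in auto)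
  qed
  \<comment> \<open>The higher blocks run through the same contents in both sums, and the insertion
    rule for the lowest block holds whatever they are.\<close>
  have Sz: "S (z1, z2, z3) = \<zeta> * S (0, 0, 0)"
  proof -
    have low: "((u + B * Q * i) div (B * Q ^ 0)) mod Q = 0" if "(u div B) mod Q ^ Suc J = 0" for u i
    proof -
      from that obtain h where h: "u div B = Q ^ Suc J * h" by (auto elim: dvdE)
      have "(u + B * Q * i) div B = u div B + Q * i"
        using B by (metis div_mult_self2 less_not_refl mult.assoc add.commute)
      then show ?thesis by (simp add: h mult.assoc)
    qed
    have "\<Phi> (x + B * z1 + B * Q * i) (y + B * z2 + B * Q * j) (d + B * z3 + B * Q * k)
        = \<zeta> * \<Phi> (x + B * Q * i) (y + B * Q * j) (d + B * Q * k)" for i j k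
      using ins[of 0 "x + B * Q * i" "y + B * Q * j" "d + B * Q * k"]
        low[OF Suc.prems(3), of i] low[OF Suc.prems(4), of j] low[OF Suc.prems(5), of k]
      by (simp add: ac_simps)
    then show ?thesis
      by (simp add: S_def block_sum_eq sum_distrib_left)
  qed
  let ?o = "(0, 0, 0) :: nat \<times> nat \<times> nat" and ?z = "(z1, z2, z3)"
  have oz: "?o \<in> T" "?z \<in> T" "?o \<noteq> ?z" and fin: "finite T"
    using z Q by (auto simp: T_def)
  have "block_sum \<Phi> Q (Suc J) B x y d = sum S T"
    by (simp add: T_def S_def sum.cartesian_product)
  also have "\<dots> = sum S (T - {?o, ?z}) + (S ?o + S ?z)"
  proof -
    have "sum S T = sum S (T - {?o, ?z}) + sum S {?o, ?z}"
      using oz fin by (intro sum.subset_diff) auto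
    then show ?thesis using oz by simp
  qed
  also have "cmod \<dots> \<le> real (card (T - {?o, ?z})) * c ^ J + cmod (1 + \<zeta>) * c ^ J"
  proof (rule norm_triangle_le, rule add_mono)
    show "cmod (sum S (T - {?o, ?z})) \<le> real (card (T - {?o, ?z})) * c ^ J"
      by (rule order_trans[OF norm_sum sum_bounded_above]) (use bound in auto)
    have "S ?o + S ?z = (1 + \<zeta>) * S ?o" unfolding Sz by (simp add: distrib_right)
    then show "cmod (S ?o + S ?z) \<le> cmod (1 + \<zeta>) * c ^ J"
      using bound[OF oz(1)] by (simp add: norm_mult mult_left_mono)
  qed
  also have "real (card (T - {?o, ?z})) = real Q ^ 3 - 2"
  proof -
    have "card {?o, ?z} \<le> card T" using oz fin by (intro card_mono) auto
    moreover have "card T = Q ^ 3" by (simp add: T_def power3_eq_cube)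
    moreover have "card {?o, ?z} = 2" using oz(3) by simp
    ultimately show ?thesis
      using oz fin by (subst card_Diff_subset) (auto simp: of_nat_diff)
  qed
  finally show ?case by (simp add: c_def distrib_right)
qed

subsection \<open>A law of large numbers for pairwise independent shifts\<close>

definition mean :: "nat \<Rightarrow> (nat \<Rightarrow> complex) \<Rightarrow> complex" where
  "mean W f = (\<Sum>z<W. f z) / of_nat W"

text \<open>Pairwise independence and uniform distribution of \<open>U t n\<close> for random
  \<open>n < N\<close>, expressed by test functions because the second moment uses it in this
  form.\<close>

definition pairwise_uniform :: "nat \<Rightarrow> nat \<Rightarrow> nat \<Rightarrow> (nat \<Rightarrow> nat \<Rightarrow> nat) \<Rightarrow> bool" where
  "pairwise_uniform N W T U \<longleftrightarrow> (\<forall>t<T. \<forall>n. U t n < W) \<and>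
     (\<forall>t<T. \<forall>t'<T. t \<noteq> t' \<longrightarrow>
       (\<forall>f g. (\<Sum>n<N. f (U t n) * g (U t' n)) = of_nat N * mean W f * mean W g))"

lemma pairwise_uniformD:
  assumes "pairwise_uniform N W T U" "t < T" "t' < T" "t \<noteq> t'"
  shows "(\<Sum>n<N. f (U t n) * g (U t' n)) = of_nat N * mean W f * mean W g"
  using assms unfolding pairwise_uniform_def by blast

lemma norm_mean_le:
  assumes "\<And>z. z < W \<Longrightarrow> cmod (f z) \<le> c" "0 < W"
  shows "cmod (mean W f) \<le> c"
proof -
  have "cmod (\<Sum>z<W. f z) \<le> of_nat (card {..<W}) * c"
    by (rule order_trans[OF norm_sum sum_bounded_above]) (use assms in auto)
  then show ?thesis using assms(2) by (simp add: mean_def norm_divide field_simps)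
qed

text \<open>After subtraction of the mean all mixed terms vanish, so only \<open>T\<close> diagonal
  terms remain instead of the square of \<open>T\<close>.\<close>

lemma pairwise_variance:
  assumes pu: "pairwise_uniform N W T U" and W: "0 < W" and bd: "\<And>z. cmod (\<phi> z) \<le> 1"
  shows "(\<Sum>n<N. (cmod (\<Sum>t<T. \<phi> (U t n) - mean W \<phi>))\<^sup>2) \<le> 4 * real N * real T"
proof -
  define \<psi> where "\<psi> = (\<lambda>z. \<phi> z - mean W \<phi>)"
  have \<psi>2: "cmod (\<psi> z) \<le> 2" for z
    using norm_triangle_ineq4[of "\<phi> z" "mean W \<phi>"] bd[of z] norm_mean_le[of W \<phi> 1] bd W
    unfolding \<psi>_def by fastforce
  have m0: "mean W \<psi> = 0"
    using W by (simp add: mean_def \<psi>_def sum_subtractf)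
  have "complex_of_real (\<Sum>n<N. (cmod (\<Sum>t<T. \<psi> (U t n)))\<^sup>2)
      = (\<Sum>n<N. \<Sum>t<T. \<Sum>t'<T. \<psi> (U t n) * cnj (\<psi> (U t' n)))"
    by (simp only: of_real_sum norm_sum_squared)
  also have "\<dots> = (\<Sum>t<T. \<Sum>n<N. \<Sum>t'<T. \<psi> (U t n) * cnj (\<psi> (U t' n)))"
    by (rule sum.swap)
  also have "\<dots> = (\<Sum>t<T. \<Sum>t'<T. \<Sum>n<N. \<psi> (U t n) * cnj (\<psi> (U t' n)))"
    by (rule sum.cong[OF refl], rule sum.swap)
  also have "\<dots> = (\<Sum>t<T. \<Sum>t'<T. if t' = t then complex_of_real (\<Sum>n<N. (cmod (\<psi> (U t n)))\<^sup>2) else 0)"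
  proof (intro sum.cong refl)
    fix t t' assume t: "t \<in> {..<T}" "t' \<in> {..<T}"
    show "(\<Sum>n<N. \<psi> (U t n) * cnj (\<psi> (U t' n)))
      = (if t' = t then complex_of_real (\<Sum>n<N. (cmod (\<psi> (U t n)))\<^sup>2) else 0)"
    proof (cases "t' = t")
      case False
      then have "(\<Sum>n<N. \<psi> (U t n) * cnj (\<psi> (U t' n))) = of_nat N * mean W \<psi> * mean W (\<lambda>z. cnj (\<psi> z))"
        using t by (intro pairwise_uniformD[OF pu, where f = \<psi> and g = "\<lambda>z. cnj (\<psi> z)"]) auto
      then show ?thesis using m0 False by simp
    qed (simp add: complex_norm_square del: of_real_power)
  qed
  also have "\<dots> = complex_of_real (\<Sum>t<T. \<Sum>n<N. (cmod (\<psi> (U t n)))\<^sup>2)"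
    by (simp add: sum.delta')
  finally have "(\<Sum>n<N. (cmod (\<Sum>t<T. \<psi> (U t n)))\<^sup>2) = (\<Sum>t<T. \<Sum>n<N. (cmod (\<psi> (U t n)))\<^sup>2)"
    by (simp only: of_real_eq_iff)
  also have "\<dots> \<le> (\<Sum>t<T. \<Sum>n<N. 2\<^sup>2)"
    by (intro sum_mono power_mono \<psi>2) auto
  finally show ?thesis by (simp add: \<psi>_def mult.commute)
qed

lemma mean_shift: "mean W (\<lambda>u. f ((x + u) mod W)) = mean W f"
proof -
  have "(\<Sum>u<W. f ((u + x) mod W)) = (\<Sum>u<W. f (u mod W))"
    by (rule sum_periodic_shift[of "\<lambda>u. f (u mod W)"]) simp
  then show ?thesis by (simp add: mean_def add.commute)
qed

text \<open>Function and offset both vary with \<open>n\<close>, so independence cannot be applied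
  directly. They take at most \<open>card I * W\<close> values; the variance is summed over all of
  them, a loss that a large \<open>T\<close> outweighs.\<close>

lemma pairwise_deviation:
  fixes \<phi> :: "'i \<Rightarrow> nat \<Rightarrow> complex"
  assumes pu: "pairwise_uniform N W T U" and W: "0 < W" and fin: "finite I"
    and \<iota>: "\<And>n. n < N \<Longrightarrow> \<iota> n \<in> I" and bd: "\<And>i z. cmod (\<phi> i z) \<le> 1"
  shows "(\<Sum>n<N. cmod (\<Sum>t<T. \<phi> (\<iota> n) ((X n + U t n) mod W) - mean W (\<phi> (\<iota> n))))
    \<le> 2 * real N * sqrt (real (card I) * real W * real T)"
proof -
  define D where "D = (\<lambda>(i, x) n. cmod (\<Sum>t<T. \<phi> i ((x + U t n) mod W) - mean W (\<phi> i)))"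
  have var: "(\<Sum>n<N. (D p n)\<^sup>2) \<le> 4 * real N * real T" for p
  proof -
    obtain i x where p: "p = (i, x)" by force
    show ?thesis
      using pairwise_variance[OF pu W, of "\<lambda>u. \<phi> i ((x + u) mod W)"] bd
      by (simp add: D_def p mean_shift)
  qed
  have "(\<Sum>n<N. D (\<iota> n, X n mod W) n)\<^sup>2 \<le> real N * (\<Sum>n<N. (D (\<iota> n, X n mod W) n)\<^sup>2)"
    using sum_squared_le_card[of "\<lambda>n. D (\<iota> n, X n mod W) n" "{..<N}"] by simp
  also have "\<dots> \<le> real N * (\<Sum>n<N. \<Sum>p\<in>I \<times> {..<W}. (D p n)\<^sup>2)"
  proof (intro mult_left_mono sum_mono)
    fix n assume n: "n \<in> {..<N}"
    show "(D (\<iota> n, X n mod W) n)\<^sup>2 \<le> (\<Sum>p\<in>I \<times> {..<W}. (D p n)\<^sup>2)"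
      by (rule member_le_sum[of "(\<iota> n, X n mod W)" _ "\<lambda>p. (D p n)\<^sup>2"]) (use n \<iota> W fin in auto)
  qed simp
  also have "\<dots> = real N * (\<Sum>p\<in>I \<times> {..<W}. \<Sum>n<N. (D p n)\<^sup>2)"
    by (subst sum.swap) simp
  also have "\<dots> \<le> real N * (real (card (I \<times> {..<W})) * (4 * real N * real T))"
    by (intro mult_left_mono sum_bounded_above var) auto
  also have "\<dots> = (2 * real N * sqrt (real (card I) * real W * real T))\<^sup>2"
    by (simp add: power_mult_distrib card_cartesian_product power2_eq_square[of "real N"])
  finally have "(\<Sum>n<N. D (\<iota> n, X n mod W) n) \<le> 2 * real N * sqrt (real (card I) * real W * real T)"
    by (rule power2_le_imp_le) simp
  then show ?thesis by (simp add: D_def mod_add_left_eq)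
qed

text \<open>
  The set \<open>E i\<close> collects the residues at which a carry may spoil the description of \<open>f\<close> by \<open>\<phi> i\<close>.
\<close>
lemma shifted_average:
  fixes f :: "nat \<Rightarrow> complex" and \<phi> :: "'i \<Rightarrow> nat \<Rightarrow> complex"
  assumes pu: "pairwise_uniform N W T U" and W: "0 < W" and T: "0 < T" and fin: "finite I"
    and \<iota>: "\<And>n. n < N \<Longrightarrow> \<iota> n \<in> I"
    and bdf: "\<And>n. cmod (f n) \<le> 1" and bd: "\<And>i z. cmod (\<phi> i z) \<le> 1"
    and exc: "\<And>i. i \<in> I \<Longrightarrow> real (card (E i \<inter> {..<W})) \<le> \<beta> * real W"
    and sh: "\<And>t n. \<lbrakk>t < T; n < N; (X n + U t n) mod W \<notin> E (\<iota> n)\<rbrakk> \<Longrightarrow>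
      f (n + g t) = \<phi> (\<iota> n) ((X n + U t n) mod W)"
    and g: "\<And>t. t < T \<Longrightarrow> g t \<le> C"
  shows "cmod ((\<Sum>n<N. f n) - (\<Sum>n<N. mean W (\<phi> (\<iota> n))))
    \<le> real N * (6 * sqrt (real (card I) * real W / real T) + 2 * \<beta>) + 2 * real C"
proof -
  define R where "R = 2 * real N * sqrt (real (card I) * real W * real T)"
  let ?z = "\<lambda>t n. (X n + U t n) mod W"
  \<comment> \<open>Visits to exceptional residues are counted by the same law of large numbers,
    applied to the indicator.\<close>
  define ind where "ind = (\<lambda>i z. of_bool (z \<in> E i) :: complex)"
  have 1: "cmod (of_nat T * (\<Sum>n<N. f n) - (\<Sum>n<N. \<Sum>t<T. f (n + g t))) \<le> real T * (2 * real C)"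
  proof -
    have "of_nat T * (\<Sum>n<N. f n) - (\<Sum>n<N. \<Sum>t<T. f (n + g t))
        = - (\<Sum>t<T. (\<Sum>n<N. f (n + g t)) - (\<Sum>n<N. f n))"
      by (subst sum.swap) (simp add: sum_subtractf)
    also have "cmod \<dots> \<le> of_nat (card {..<T}) * (2 * real C)"
      unfolding norm_minus_cancel
    proof (rule order_trans[OF norm_sum sum_bounded_above])
      fix t assume "t \<in> {..<T}"
      then have "2 * real (g t) \<le> 2 * real C" using g by simp
      then show "cmod ((\<Sum>n<N. f (n + g t)) - (\<Sum>n<N. f n)) \<le> 2 * real C"
        using norm_sum_shift_le[of f "g t" N] bdf by (meson order_trans)
    qed
    finally show ?thesis by simp
  qed
  have 2: "cmod ((\<Sum>n<N. \<Sum>t<T. f (n + g t)) - (\<Sum>n<N. \<Sum>t<T. \<phi> (\<iota> n) (?z t n)))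
      \<le> 2 * (R + real T * (real N * \<beta>))"
  proof -
    have "cmod ((\<Sum>n<N. \<Sum>t<T. f (n + g t)) - (\<Sum>n<N. \<Sum>t<T. \<phi> (\<iota> n) (?z t n)))
        \<le> (\<Sum>n<N. \<Sum>t<T. cmod (f (n + g t) - \<phi> (\<iota> n) (?z t n)))"
      unfolding sum_subtractf[symmetric] by (intro sum_norm_le norm_sum)
    also have "\<dots> \<le> (\<Sum>n<N. \<Sum>t<T. 2 * of_bool (?z t n \<in> E (\<iota> n)))"
    proof (intro sum_mono)
      fix n t assume "n \<in> {..<N}" "t \<in> {..<T}"
      moreover have "cmod (f (n + g t) - \<phi> (\<iota> n) (?z t n)) \<le> 2"
        using norm_triangle_ineq4[of "f (n + g t)" "\<phi> (\<iota> n) (?z t n)"] bdf[of "n + g t"] bd[of "\<iota> n" "?z t n"]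
        by linarith
      ultimately show "cmod (f (n + g t) - \<phi> (\<iota> n) (?z t n)) \<le> 2 * of_bool (?z t n \<in> E (\<iota> n))"
        using sh[of t n] by (cases "?z t n \<in> E (\<iota> n)") auto
    qed
    also have "\<dots> = 2 * (\<Sum>n<N. \<Sum>t<T. of_bool (?z t n \<in> E (\<iota> n)))"
      by (simp only: sum_distrib_left)
    also have "(\<Sum>n<N. \<Sum>t<T. of_bool (?z t n \<in> E (\<iota> n))) =
        cmod (\<Sum>n<N. \<Sum>t<T. ind (\<iota> n) (?z t n))"
    proof -
      have "(\<Sum>n<N. \<Sum>t<T. ind (\<iota> n) (?z t n)) = of_real (\<Sum>n<N. \<Sum>t<T. of_bool (?z t n \<in> E (\<iota> n)))"
        by (simp add: ind_def)
      then show ?thesis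
        by (simp only: norm_of_real) (intro abs_of_nonneg[symmetric] sum_nonneg; simp)
    qed
    also have "\<dots> \<le> R + real T * (real N * \<beta>)"
    proof -
      have "(\<Sum>n<N. \<Sum>t<T. ind (\<iota> n) (?z t n))
          = (\<Sum>n<N. \<Sum>t<T. ind (\<iota> n) (?z t n) - mean W (ind (\<iota> n)))
            + of_nat T * (\<Sum>n<N. mean W (ind (\<iota> n)))"
        by (simp add: sum_subtractf sum_distrib_left)
      also have "cmod \<dots> \<le> R + cmod (of_nat T * (\<Sum>n<N. mean W (ind (\<iota> n))))"
      proof (intro norm_triangle_le add_mono order_refl)
        have "cmod (\<Sum>n<N. \<Sum>t<T. ind (\<iota> n) (?z t n) - mean W (ind (\<iota> n)))
          \<le> (\<Sum>n<N. cmod (\<Sum>t<T. ind (\<iota> n) (?z t n) - mean W (ind (\<iota> n))))"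
          by (rule norm_sum)
        also have "\<dots> \<le> R"
          unfolding R_def
          by (rule pairwise_deviation[OF pu W fin \<iota>]) (simp_all add: ind_def)
        finally show "cmod (\<Sum>n<N. \<Sum>t<T. ind (\<iota> n) (?z t n) - mean W (ind (\<iota> n))) \<le> R" .
      qed
      also have "cmod (of_nat T * (\<Sum>n<N. mean W (ind (\<iota> n)))) \<le> real T * (real N * \<beta>)"
      proof -
        have "cmod (\<Sum>n<N. mean W (ind (\<iota> n))) \<le> of_nat (card {..<N}) * \<beta>"
        proof (rule order_trans[OF norm_sum sum_bounded_above])
          fix n assume "n \<in> {..<N}"
          then have "real (card (E (\<iota> n) \<inter> {..<W})) \<le> \<beta> * real W" using exc \<iota> by simp
          moreover have "(\<Sum>z<W. ind (\<iota> n) z) = of_nat (card (E (\<iota> n) \<inter> {..<W}))"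
            by (simp add: ind_def sum.If_cases Int_commute of_bool_def)
          ultimately show "cmod (mean W (ind (\<iota> n))) \<le> \<beta>"
            using W by (simp add: mean_def norm_divide field_simps)
        qed
        then show ?thesis by (simp add: norm_mult mult_left_mono)
      qed
      finally show ?thesis by simp
    qed
    finally show ?thesis by simp
  qed
  have 3: "cmod ((\<Sum>n<N. \<Sum>t<T. \<phi> (\<iota> n) (?z t n)) - of_nat T * (\<Sum>n<N. mean W (\<phi> (\<iota> n)))) \<le> R"
  proof -
    have "(\<Sum>n<N. \<Sum>t<T. \<phi> (\<iota> n) (?z t n)) - of_nat T * (\<Sum>n<N. mean W (\<phi> (\<iota> n)))
      = (\<Sum>n<N. \<Sum>t<T. \<phi> (\<iota> n) (?z t n) - mean W (\<phi> (\<iota> n)))"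
      by (simp add: sum_subtractf sum_distrib_left)
    also have "cmod \<dots> \<le> (\<Sum>n<N. cmod (\<Sum>t<T. \<phi> (\<iota> n) (?z t n) - mean W (\<phi> (\<iota> n))))"
      by (rule norm_sum)
    also have "\<dots> \<le> R"
      unfolding R_def by (rule pairwise_deviation[OF pu W fin \<iota> bd])
    finally show ?thesis .
  qed
  \<comment> \<open>Three copies of \<open>R\<close> occur, two from the exceptional visits and one
    from \<open>\<phi>\<close>; with the factor 2 inside \<open>R\<close> they make the constant
    6.\<close>
  have "real T * cmod ((\<Sum>n<N. f n) - (\<Sum>n<N. mean W (\<phi> (\<iota> n))))
      = cmod (of_nat T * (\<Sum>n<N. f n) - of_nat T * (\<Sum>n<N. mean W (\<phi> (\<iota> n))))"
    by (simp add: norm_mult flip: right_diff_distrib)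
  also have "\<dots> \<le> real T * (2 * real C) + 2 * (R + real T * (real N * \<beta>)) + R"
    using norm_triangle_le[OF add_mono[OF norm_triangle_le[OF add_mono[OF 1 2]] 3]] by simp
  also have "\<dots> = real T * (real N * (6 * (sqrt (real (card I) * real W * real T) / real T) + 2 * \<beta>) + 2 * real C)"
    using T by (simp add: R_def field_simps)
  also have "sqrt (real (card I) * real W * real T) / real T = sqrt (real (card I) * real W / real T)"
  proof -
    have "real (card I) * real W * real T = real (card I) * real W / real T * (real T)\<^sup>2"
      using T by (simp add: power2_eq_square)
    then have "sqrt (real (card I) * real W * real T) = sqrt (real (card I) * real W / real T) * real T"
      by (simp only: real_sqrt_mult real_sqrt_abs abs_of_nat)
    then show ?thesis using T by simp
  qed
  finally show ?thesis using T by simp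
qed

section \<open>Independence of digit blocks of \<open>2 * n\<close>\<close>

lemma sum_mod_power:
  fixes f :: "nat \<Rightarrow> complex"
  assumes "s + w \<le> M" "0 < q"
  shows "(\<Sum>z<q ^ M. f ((z div q ^ s) mod q ^ w)) = of_nat (q ^ (M - w)) * (\<Sum>z<q ^ w. f z)"
proof -
  have "q ^ M = q ^ s * (q ^ w * q ^ (M - s - w))" using assms by (simp flip: power_add)
  then have "(\<Sum>z<q ^ M. f ((z div q ^ s) mod q ^ w))
      = (\<Sum>i<q ^ s. \<Sum>j<q ^ w. \<Sum>k<q ^ (M - s - w). f (((i + q ^ s * (j + q ^ w * k)) div q ^ s) mod q ^ w))"
    by (simp only: sum_lessThan_mult)
  also have "\<dots> = (\<Sum>i<q ^ s. \<Sum>j<q ^ w. \<Sum>k<q ^ (M - s - w). f j)"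
    using assms by (intro sum.cong refl arg_cong[where f = f]) (simp add: div_mult_self2)
  also have "\<dots> = of_nat (q ^ s * q ^ (M - s - w)) * (\<Sum>z<q ^ w. f z)"
    by (simp add: sum_distrib_left mult.assoc)
  also have "q ^ s * q ^ (M - s - w) = q ^ (M - w)" using assms by (simp flip: power_add)
  finally show ?thesis .
qed

lemma digit_windows_independent:
  fixes f g :: "nat \<Rightarrow> complex"
  assumes "s + w \<le> s'" "s' + w \<le> M" "0 < q"
  shows "(\<Sum>z<q ^ M. f ((z div q ^ s) mod q ^ w) * g ((z div q ^ s') mod q ^ w))
    = of_nat (q ^ M) * mean (q ^ w) f * mean (q ^ w) g"
proof -
  have M: "q ^ M = q ^ s' * q ^ (M - s')" using assms by (simp flip: power_add)
  have "(\<Sum>z<q ^ M. f ((z div q ^ s) mod q ^ w) * g ((z div q ^ s') mod q ^ w))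
      = (\<Sum>i<q ^ s'. \<Sum>j<q ^ (M - s'). f (((i + q ^ s' * j) div q ^ s) mod q ^ w)
          * g (((i + q ^ s' * j) div q ^ s') mod q ^ w))"
    by (simp only: M sum_lessThan_mult)
  also have "\<dots> = (\<Sum>i<q ^ s'. \<Sum>j<q ^ (M - s'). f ((i div q ^ s) mod q ^ w) * g ((j div q ^ 0) mod q ^ w))"
  proof (intro sum.cong refl arg_cong2[where f = "(*)"] arg_cong[where f = f] arg_cong[where f = g])
    fix i j assume ij: "i \<in> {..<q ^ s'}"
    have "q ^ s' = q ^ s * (q ^ w * q ^ (s' - s - w))" using assms by (simp flip: power_add)
    then have "(i + q ^ s' * j) div q ^ s = i div q ^ s + q ^ w * (q ^ (s' - s - w) * j)"
      using assms by (simp add: mult.assoc)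
    then show "(i + q ^ s' * j) div q ^ s mod q ^ w = i div q ^ s mod q ^ w" by simp
    show "(i + q ^ s' * j) div q ^ s' mod q ^ w = j div q ^ 0 mod q ^ w"
      using ij assms by simp
  qed
  also have "\<dots> = (\<Sum>i<q ^ s'. f ((i div q ^ s) mod q ^ w)) * (\<Sum>j<q ^ (M - s'). g ((j div q ^ 0) mod q ^ w))"
    by (simp add: sum_product)
  also have "\<dots> = of_nat (q ^ (s' - w)) * (\<Sum>z<q ^ w. f z) * (of_nat (q ^ (M - s' - w)) * (\<Sum>z<q ^ w. g z))"
    by (subst (1 2) sum_mod_power) (use assms in auto)
  also have "\<dots> = of_nat (q ^ (s' - w)) * of_nat (q ^ (M - s' - w)) * of_nat (q ^ w) * of_nat (q ^ w)
      * mean (q ^ w) f * mean (q ^ w) g"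
    using assms by (simp add: mean_def)
  also have "of_nat (q ^ (s' - w)) * of_nat (q ^ (M - s' - w)) * of_nat (q ^ w) * of_nat (q ^ w) = (of_nat (q ^ M) :: complex)"
    using assms by (simp flip: power_add of_nat_mult of_nat_power)
  finally show ?thesis .
qed

text \<open>
  For even \<open>q\<close>, doubling is not injective modulo a power of \<open>q\<close>; dropping the lowest digit restores the
  uniform distribution.
\<close>
lemma sum_doubled_digits:
  fixes h :: "nat \<Rightarrow> complex"
  assumes q: "2 \<le> q"
  shows "(\<Sum>n<q ^ Suc M. h ((2 * n div q) mod q ^ M)) = of_nat q * (\<Sum>z<q ^ M. h z)"
proof -
  define Q where "Q = q ^ Suc M"
  have Q0: "0 < Q" using q by (simp add: Q_def)
  have "(\<Sum>n<Q. h ((2 * n div q) mod q ^ M)) = (\<Sum>n<Q. h ((2 * n mod Q) div q))"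
    using q by (simp add: Q_def mod_mult2_eq)
  also have "\<dots> = (\<Sum>y<Q. h (y div q))"
  proof (cases "even q")
    case False
    then have cop: "coprime 2 Q" by (simp add: Q_def)
    have "inj_on (\<lambda>n. 2 * n mod Q) {..<Q}"
    proof (rule inj_onI)
      fix x y assume xy: "x \<in> {..<Q}" "y \<in> {..<Q}" "2 * x mod Q = 2 * y mod Q"
      then have "[2 * x = 2 * y] (mod Q)" by (simp add: cong_def)
      then have "[x = y] (mod Q)" using cong_mult_lcancel_nat cop by blast
      then show "x = y" using xy by (simp add: cong_def)
    qed
    then have "bij_betw (\<lambda>n. 2 * n mod Q) {..<Q} {..<Q}"
      unfolding bij_betw_def using Q0 by (intro conjI endo_inj_surj) auto
    then show ?thesis by (rule sum.reindex_bij_betw)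
  next
    \<comment> \<open>For even \<open>q\<close> doubling is two-to-one onto the even residues modulo
      \<open>Q\<close>. As \<open>2 * i\<close> and \<open>2 * i + 1\<close> have the same quotient
      by \<open>q\<close>, counting an even residue twice equals counting both once.\<close>
    case True
    then obtain Q' q' where Q': "Q = 2 * Q'" and q': "q = 2 * q'" by (auto simp: Q_def elim!: evenE)
    have "(\<Sum>n<Q. h ((2 * n mod Q) div q)) = (\<Sum>n<Q' * 2. h ((2 * n mod Q) div q))"
      by (simp add: Q' mult.commute)
    also have "\<dots> = (\<Sum>i<Q'. \<Sum>j<2::nat. h (2 * i div q))"
      unfolding sum_lessThan_mult
    proof (intro sum.cong refl)
      fix i j assume "i \<in> {..<Q'}"
      moreover have "2 * (i + Q' * j) = 2 * i + Q * j" by (simp add: Q')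
      ultimately have "2 * (i + Q' * j) mod Q = 2 * i" by (simp only: mod_mult_self2) (simp add: Q')
      then show "h (2 * (i + Q' * j) mod Q div q) = h (2 * i div q)" by simp
    qed
    also have "\<dots> = (\<Sum>i<Q'. h (2 * i div q) + h (2 * i div q))"
      by (simp add: numeral_2_eq_2)
    also have "\<dots> = (\<Sum>i<Q'. h (2 * i div q) + h ((2 * i + 1) div q))"
      by (simp add: q' div_mult2_eq)
    also have "\<dots> = (\<Sum>y<2 * Q'. h (y div q))"
      by (simp only: sum_lessThan_mult) (simp add: numeral_2_eq_2 sum.distrib)
    finally show ?thesis by (simp add: Q')
  qed
  also have "\<dots> = (\<Sum>i<q. \<Sum>j<q ^ M. h ((i + q * j) div q))"
    by (simp only: Q_def power_Suc sum_lessThan_mult)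
  also have "\<dots> = (\<Sum>i<q. \<Sum>j<q ^ M. h j)"
    using q by (intro sum.cong refl arg_cong[where f = h]) simp
  finally show ?thesis by (simp add: Q_def)
qed

text \<open>The condition \<open>1 \<le> s0\<close> allows the lowest digit of \<open>2 * n\<close>
  to be dropped, as \<open>sum_doubled_digits\<close> requires. The next \<open>L - 1\<close> digits
  are jointly uniform, and the windows occupy disjoint parts of them.\<close>

lemma pairwise_uniform_doubled:
  assumes q: "2 \<le> q" and s: "1 \<le> s0" "s0 + T * w \<le> L"
  shows "pairwise_uniform (q ^ L) (q ^ w) T (\<lambda>t n. (2 * n div q ^ (s0 + t * w)) mod q ^ w)"
  unfolding pairwise_uniform_def
proof (intro conjI allI impI)
  fix t n show "2 * n div q ^ (s0 + t * w) mod q ^ w < q ^ w" using q by simp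
next
  have main: "(\<Sum>n<q ^ L. f (2 * n div q ^ (s0 + t * w) mod q ^ w) * g (2 * n div q ^ (s0 + t' * w) mod q ^ w))
      = of_nat (q ^ L) * mean (q ^ w) f * mean (q ^ w) g"
    if "t < t'" "t' < T" for t t' and f g :: "nat \<Rightarrow> complex"
  proof -
    have tT: "Suc t * w \<le> t' * w" "Suc t' * w \<le> T * w"
      using that by (intro mult_le_mono1; simp)+
    then have ineq: "s0 + t * w + w \<le> s0 + t' * w" "s0 + t' * w + w \<le> L" using s by auto
    obtain M where L: "L = Suc M" using s by (cases L) auto
    have shiftdown: "2 * n div q ^ r mod q ^ w = ((2 * n div q) mod q ^ M) div q ^ (r - 1) mod q ^ w"
      if "1 \<le> r" "r + w \<le> L" for n r
    proof -
      have M: "q ^ M = q ^ (r - 1) * q ^ (M - (r - 1))" and "q ^ r = q * q ^ (r - 1)"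
        using that L by (simp_all flip: power_add power_Suc)
      then have "2 * n div q ^ r = (2 * n div q) div q ^ (r - 1)" by (simp add: div_mult2_eq)
      moreover have "((2 * n div q) mod q ^ M) div q ^ (r - 1) = (2 * n div q div q ^ (r - 1)) mod q ^ (M - (r - 1))"
        unfolding M using q by (simp add: mod_mult2_eq)
      moreover have "q ^ w dvd q ^ (M - (r - 1))"
        using that L by (intro le_imp_power_dvd) auto
      ultimately show ?thesis by (simp add: mod_mod_cancel)
    qed
    define F where "F = (\<lambda>z. f (z div q ^ (s0 + t * w - 1) mod q ^ w) * g (z div q ^ (s0 + t' * w - 1) mod q ^ w))"
    have "(\<Sum>n<q ^ L. f (2 * n div q ^ (s0 + t * w) mod q ^ w) * g (2 * n div q ^ (s0 + t' * w) mod q ^ w))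
        = (\<Sum>n<q ^ Suc M. F ((2 * n div q) mod q ^ M))"
      using ineq s unfolding F_def L[symmetric] by (subst (1 2) shiftdown) auto
    also have "\<dots> = of_nat q * (\<Sum>z<q ^ M. F z)" by (rule sum_doubled_digits[OF q])
    also have "(\<Sum>z<q ^ M. F z) = of_nat (q ^ M) * mean (q ^ w) f * mean (q ^ w) g"
      unfolding F_def by (rule digit_windows_independent) (use ineq s L q in auto)
    finally show ?thesis by (simp add: L)
  qed
  fix t t' and f g :: "nat \<Rightarrow> complex"
  assume t: "t < T" "t' < T" "t \<noteq> t'"
  show "(\<Sum>n<q ^ L. f (2 * n div q ^ (s0 + t * w) mod q ^ w) * g (2 * n div q ^ (s0 + t' * w) mod q ^ w))
      = of_nat (q ^ L) * mean (q ^ w) f * mean (q ^ w) g"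
  proof (cases "t < t'")
    case False
    then show ?thesis using main[of t' t g f] t by (simp add: ac_simps)
  qed (use main t in simp)
qed

subsection \<open>The box inequality\<close>

text \<open>Cauchy-Schwarz in \<open>r\<close>, and once more in the pair \<open>(s, s')\<close>,
  gives products over the corners of a rectangle. There a unimodular factor of \<open>M r s\<close>
  depending on \<open>r\<close> alone or on \<open>s\<close> alone cancels, which removes the low
  and the high digits.\<close>

lemma box_inequality:
  fixes M :: "'a \<Rightarrow> 'b \<Rightarrow> complex"
  shows "(cmod (\<Sum>r\<in>R. \<Sum>s\<in>S. M r s)) ^ 4 \<le> (real (card R))\<^sup>2 * (real (card S))\<^sup>2 *
    Re (\<Sum>s\<in>S. \<Sum>s'\<in>S. \<Sum>r\<in>R. \<Sum>r'\<in>R. (M r s * cnj (M r s')) * cnj (M r' s * cnj (M r' s')))"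
proof -
  let ?G = "\<lambda>s s'. \<Sum>r\<in>R. M r s * cnj (M r s')"
  have "(cmod (\<Sum>r\<in>R. \<Sum>s\<in>S. M r s))\<^sup>2 \<le> (\<Sum>r\<in>R. cmod (\<Sum>s\<in>S. M r s))\<^sup>2"
    by (intro power_mono norm_sum norm_ge_zero)
  also have "\<dots> \<le> real (card R) * (\<Sum>r\<in>R. (cmod (\<Sum>s\<in>S. M r s))\<^sup>2)"
    by (rule sum_squared_le_card)
  also have "(\<Sum>r\<in>R. (cmod (\<Sum>s\<in>S. M r s))\<^sup>2) \<le> (\<Sum>s\<in>S. \<Sum>s'\<in>S. cmod (?G s s'))"
  proof -
    have "complex_of_real (\<Sum>r\<in>R. (cmod (\<Sum>s\<in>S. M r s))\<^sup>2)
        = (\<Sum>r\<in>R. \<Sum>s\<in>S. \<Sum>s'\<in>S. M r s * cnj (M r s'))"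
      by (simp only: of_real_sum norm_sum_squared)
    also have "\<dots> = (\<Sum>s\<in>S. \<Sum>r\<in>R. \<Sum>s'\<in>S. M r s * cnj (M r s'))" by (rule sum.swap)
    also have "\<dots> = (\<Sum>s\<in>S. \<Sum>s'\<in>S. ?G s s')" by (rule sum.cong[OF refl], rule sum.swap)
    finally have eq: "complex_of_real (\<Sum>r\<in>R. (cmod (\<Sum>s\<in>S. M r s))\<^sup>2) = (\<Sum>s\<in>S. \<Sum>s'\<in>S. ?G s s')" .
    have "(\<Sum>r\<in>R. (cmod (\<Sum>s\<in>S. M r s))\<^sup>2) = cmod (\<Sum>s\<in>S. \<Sum>s'\<in>S. ?G s s')"
      unfolding eq[symmetric] norm_of_real by (rule abs_of_nonneg[symmetric]) (simp add: sum_nonneg)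
    also have "\<dots> \<le> (\<Sum>s\<in>S. \<Sum>s'\<in>S. cmod (?G s s'))" by (intro sum_norm_le norm_sum)
    finally show ?thesis .
  qed
  finally have "(cmod (\<Sum>r\<in>R. \<Sum>s\<in>S. M r s))\<^sup>2 \<le> real (card R) * (\<Sum>s\<in>S. \<Sum>s'\<in>S. cmod (?G s s'))"
    by (simp add: mult_left_mono)
  then have "((cmod (\<Sum>r\<in>R. \<Sum>s\<in>S. M r s))\<^sup>2)\<^sup>2 \<le> (real (card R) * (\<Sum>s\<in>S. \<Sum>s'\<in>S. cmod (?G s s')))\<^sup>2"
    by (intro power_mono) auto
  also have "\<dots> = (real (card R))\<^sup>2 * (\<Sum>p\<in>S \<times> S. cmod (?G (fst p) (snd p)))\<^sup>2"
    by (simp add: power_mult_distrib sum.cartesian_product case_prod_unfold)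
  also have "\<dots> \<le> (real (card R))\<^sup>2 * (real (card (S \<times> S)) * (\<Sum>p\<in>S \<times> S. (cmod (?G (fst p) (snd p)))\<^sup>2))"
    by (intro mult_left_mono sum_squared_le_card) auto
  also have "\<dots> = (real (card R))\<^sup>2 * (real (card S))\<^sup>2 * (\<Sum>s\<in>S. \<Sum>s'\<in>S. (cmod (?G s s'))\<^sup>2)"
    by (simp add: sum.cartesian_product case_prod_unfold card_cartesian_product power2_eq_square)
  also have "(\<Sum>s\<in>S. \<Sum>s'\<in>S. (cmod (?G s s'))\<^sup>2) = Re (\<Sum>s\<in>S. \<Sum>s'\<in>S. complex_of_real ((cmod (?G s s'))\<^sup>2))"
    by (simp add: Re_sum)
  also have "\<dots> = Re (\<Sum>s\<in>S. \<Sum>s'\<in>S. \<Sum>r\<in>R. \<Sum>r'\<in>R. (M r s * cnj (M r s')) * cnj (M r' s * cnj (M r' s')))"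
    by (simp only: norm_sum_squared)
  finally show ?thesis by (simp flip: power_mult)
qed

subsection \<open>Correlations along the middle digits\<close>

text \<open>Every prime of the gcd divides \<open>q\<close>, and its exponent \<open>e\<close>
  satisfies \<open>e < 2 ^ e \<le> s \<le> k\<close>. The point is that \<open>k\<close> does not
  depend on \<open>K\<close>.\<close>

lemma gcd_power_dvd:
  fixes s q :: nat
  assumes "0 < s" "s \<le> k" "0 < q"
  shows "gcd s (q ^ K) dvd q ^ k"
proof (rule multiplicity_le_imp_dvd)
  show g0: "gcd s (q ^ K) \<noteq> 0" using assms by simp
  fix p :: nat assume p: "prime p"
  show "multiplicity p (gcd s (q ^ K)) \<le> multiplicity p (q ^ k)"
  proof (cases "p dvd gcd s (q ^ K)")
    case True
    have "p dvd q" using True p by (meson dvd_trans gcd_dvd2 prime_dvd_power)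
    then have 1: "1 \<le> multiplicity p q"
      using p assms(3) by (simp add: Suc_leI prime_multiplicity_gt_zero_iff)
    let ?e = "multiplicity p (gcd s (q ^ K))"
    have "?e < 2 ^ ?e" by simp
    also have "(2::nat) ^ ?e \<le> p ^ ?e" using p by (intro power_mono) (auto dest: prime_ge_2_nat)
    also have "p ^ ?e \<le> gcd s (q ^ K)" using g0 by (intro dvd_imp_le multiplicity_dvd) auto
    also have "\<dots> \<le> s" using assms by (simp add: gcd_le1_nat)
    finally have "?e \<le> k" using assms by simp
    also have "k \<le> k * multiplicity p q" using 1 by simp
    also have "\<dots> = multiplicity p (q ^ k)"
      using p assms(3) by (simp add: prime_elem_multiplicity_power_distrib)
    finally show ?thesis .
  qed (simp add: not_dvd_imp_multiplicity_0)
qed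

text \<open>A substitute for the inverse of \<open>s\<close> modulo \<open>q ^ K\<close>, which need
  not exist.\<close>

lemma ex_cong_power:
  fixes s q :: nat
  assumes "0 < s" "s \<le> k" "0 < q"
  obtains z where "[s * z = q ^ k] (mod q ^ K)"
proof -
  obtain x where x: "[s * x = gcd s (q ^ K)] (mod q ^ K)"
    using cong_solve_nat[of s "q ^ K"] assms by auto
  obtain y where y: "q ^ k = gcd s (q ^ K) * y" using gcd_power_dvd[OF assms, of K] by (elim dvdE)
  have "[s * (x * y) = q ^ k] (mod q ^ K)"
    using cong_scalar_right[OF x, of y] unfolding y by (simp add: mult.assoc)
  then show thesis by (rule that)
qed

lemma card_top_residues:
  fixes W Q h t :: nat
  assumes "Q dvd W" "0 < Q"
  shows "real (card ({z. Q - h \<le> (z + t) mod Q} \<inter> {..<W})) \<le> real W * real h / real Q"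
proof -
  obtain k where k: "W = Q * k" using assms by (elim dvdE)
  define f where "f = (\<lambda>z. of_bool (Q - h \<le> z mod Q) :: real)"
  have "real (card ({z. Q - h \<le> (z + t) mod Q} \<inter> {..<W})) = (\<Sum>z<W. f (z + t))"
    by (simp add: f_def Int_commute)
  also have "\<dots> = (\<Sum>z<W. f z)"
    by (rule sum_periodic_shift) (simp add: f_def k)
  also have "\<dots> = (\<Sum>i<Q. \<Sum>j<k. of_bool (Q - h \<le> i))"
    unfolding k sum_lessThan_mult by (intro sum.cong refl) (simp add: f_def)
  also have "\<dots> = real k * real (card ({..<Q} \<inter> {i. Q - h \<le> i}))"
    by (simp add: sum_distrib_left mult.commute)
  also have "{..<Q} \<inter> {i. Q - h \<le> i} = {Q - h..<Q}" by auto
  also have "real k * real (card {Q - h..<Q}) \<le> real k * real h" by (intro mult_left_mono) auto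
  also have "\<dots> = real W * real h / real Q" using assms by (simp add: k)
  finally show ?thesis .
qed

text \<open>Since \<open>n\<close> runs over full periods, \<open>n\<close> may be replaced by
  \<open>n + z0 * t\<close>, which moves the argument by \<open>q ^ (G + \<kappa>) * t\<close>.
  Averaging over \<open>t\<close> thus turns the step into a power of \<open>q\<close>, and the
  triangle inequality disposes of \<open>n\<close>. The inner sum is constant on classes modulo
  \<open>q ^ (G + \<kappa>)\<close>, which restores the factor lost in averaging.\<close>

lemma sum_shifted_AP_le:
  fixes H :: "nat \<Rightarrow> complex"
  assumes q: "0 < (q::nat)" and per: "\<And>x. H (x + q ^ (G + K)) = H x"
    and z0: "[\<sigma> * z0 = q ^ \<kappa>] (mod q ^ K)" and \<kappa>: "\<kappa> \<le> K" and P: "q ^ K dvd P"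
  shows "(\<Sum>z<q ^ (G + K). cmod (\<Sum>n<P. H (z + q ^ G * \<sigma> * n)))
    \<le> real P * (\<Sum>X<q ^ (G + \<kappa>). cmod (\<Sum>t<q ^ (K - \<kappa>). H (X + q ^ (G + \<kappa>) * t)))"
proof -
  define T where "T = q ^ (K - \<kappa>)"
  define W where "W = q ^ (G + K)"
  have W: "W = q ^ (G + \<kappa>) * T" using \<kappa> by (simp add: W_def T_def flip: power_add)
  have T: "0 < T" using q by (simp add: T_def)
  let ?S = "\<lambda>z. \<Sum>t<T. H (z + q ^ (G + \<kappa>) * t)"
  obtain k where k: "P = q ^ K * k" using P by (elim dvdE)
  have shift: "of_nat T * (\<Sum>n<P. H (z + q ^ G * \<sigma> * n)) = (\<Sum>n<P. ?S (z + q ^ G * \<sigma> * n))" for z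
  proof -
    have "(\<Sum>n<P. H (z + q ^ G * \<sigma> * (n + z0 * t))) = (\<Sum>n<P. H (z + q ^ G * \<sigma> * n))" for t
    proof (rule sum_periodic_shift[of "\<lambda>n. H (z + q ^ G * \<sigma> * n)"])
      fix n
      have e: "z + q ^ G * \<sigma> * (n + P) = (z + q ^ G * \<sigma> * n) + q ^ (G + K) * (\<sigma> * k)"
        by (simp add: k power_add algebra_simps)
      show "H (z + q ^ G * \<sigma> * (n + P)) = H (z + q ^ G * \<sigma> * n)"
        unfolding e by (rule periodic_mult[of H, OF per])
    qed
    then have "of_nat T * (\<Sum>n<P. H (z + q ^ G * \<sigma> * n)) = (\<Sum>t<T. \<Sum>n<P. H (z + q ^ G * \<sigma> * (n + z0 * t)))"
      by simp
    also have "\<dots> = (\<Sum>n<P. \<Sum>t<T. H (z + q ^ G * \<sigma> * (n + z0 * t)))" by (rule sum.swap)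
    also have "\<dots> = (\<Sum>n<P. ?S (z + q ^ G * \<sigma> * n))"
    proof (intro sum.cong refl periodic_cong[of H, OF per])
      fix n t
      have "[q ^ G * (\<sigma> * z0 * t) = q ^ G * (q ^ \<kappa> * t)] (mod q ^ G * q ^ K)"
        using cong_scalar_right[OF z0, of t] by (simp add: cong_def mult_mod_right[symmetric])
      from cong_add[OF cong_refl[of "z + q ^ G * \<sigma> * n"] this]
      show "[z + q ^ G * \<sigma> * (n + z0 * t) = z + q ^ G * \<sigma> * n + q ^ (G + \<kappa>) * t] (mod q ^ (G + K))"
        by (simp add: power_add algebra_simps)
    qed
    finally show ?thesis .
  qed
  have Sper: "cmod (?S (x + W)) = cmod (?S x)" for x
  proof -
    have "H (x + W + q ^ (G + \<kappa>) * t) = H (x + q ^ (G + \<kappa>) * t)" for t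
      using per[of "x + q ^ (G + \<kappa>) * t"] by (simp add: W_def ac_simps)
    then show ?thesis by simp
  qed
  have "real T * (\<Sum>z<W. cmod (\<Sum>n<P. H (z + q ^ G * \<sigma> * n)))
      = (\<Sum>z<W. cmod (of_nat T * (\<Sum>n<P. H (z + q ^ G * \<sigma> * n))))"
    unfolding norm_mult norm_of_nat by (rule sum_distrib_left)
  also have "\<dots> = (\<Sum>z<W. cmod (\<Sum>n<P. ?S (z + q ^ G * \<sigma> * n)))"
    by (simp only: shift)
  also have "\<dots> \<le> (\<Sum>z<W. \<Sum>n<P. cmod (?S (z + q ^ G * \<sigma> * n)))"
    by (intro sum_mono norm_sum)
  also have "\<dots> = (\<Sum>n<P. \<Sum>z<W. cmod (?S (z + q ^ G * \<sigma> * n)))" by (rule sum.swap)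
  also have "\<dots> = (\<Sum>n<P. \<Sum>z<W. cmod (?S z))"
    by (rule sum.cong[OF refl], rule sum_periodic_shift[of "\<lambda>z. cmod (?S z)"]) (rule Sper)
  also have "\<dots> = real P * (\<Sum>z<W. cmod (?S z))" by simp
  also have "(\<Sum>z<W. cmod (?S z)) = (\<Sum>X<q ^ (G + \<kappa>). \<Sum>j<T. cmod (?S X))"
    unfolding W sum_lessThan_mult
  proof (intro sum.cong refl)
    fix X j
    have "(\<Sum>t<T. H (X + q ^ (G + \<kappa>) * (t + j))) = (\<Sum>t<T. H (X + q ^ (G + \<kappa>) * t))"
    proof (rule sum_periodic_shift[of "\<lambda>t. H (X + q ^ (G + \<kappa>) * t)"])
      fix t
      show "H (X + q ^ (G + \<kappa>) * (t + T)) = H (X + q ^ (G + \<kappa>) * t)"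
        using per[of "X + q ^ (G + \<kappa>) * t"] W by (simp add: W_def distrib_left add.assoc)
    qed
    moreover have "X + q ^ (G + \<kappa>) * j + q ^ (G + \<kappa>) * t = X + q ^ (G + \<kappa>) * (t + j)" for t
      by (simp add: distrib_left)
    ultimately show "cmod (?S (X + q ^ (G + \<kappa>) * j)) = cmod (?S X)" by (simp only:)
  qed
  also have "real P * \<dots> = real T * (real P * (\<Sum>X<q ^ (G + \<kappa>). cmod (?S X)))"
    by (simp add: sum_distrib_left ac_simps)
  finally show ?thesis using T by (simp add: T_def W_def)
qed

lemma sum_swap_last:
  "(\<Sum>x\<in>A. \<Sum>y\<in>B. \<Sum>z\<in>C. f x y z) = (\<Sum>z\<in>C. \<Sum>x\<in>A. \<Sum>y\<in>B. f x y z)"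
proof -
  have "(\<Sum>x\<in>A. \<Sum>y\<in>B. \<Sum>z\<in>C. f x y z) = (\<Sum>x\<in>A. \<Sum>z\<in>C. \<Sum>y\<in>B. f x y z)"
    by (rule sum.cong[OF refl], rule sum.swap)
  also have "\<dots> = (\<Sum>z\<in>C. \<Sum>x\<in>A. \<Sum>y\<in>B. f x y z)" by (rule sum.swap)
  finally show ?thesis .
qed

lemma sum_split_blocks:
  fixes F :: "nat \<Rightarrow> nat \<Rightarrow> nat \<Rightarrow> 'a::comm_monoid_add"
  shows "(\<Sum>x<M * K. \<Sum>y<M * K. \<Sum>d<B * (M * D). F x y d) =
    (\<Sum>x2<K. \<Sum>y2<K. \<Sum>d0<B. \<Sum>d2<D. \<Sum>x1<M. \<Sum>y1<M. \<Sum>d1<M.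
       F (x1 + M * x2) (y1 + M * y2) (d0 + B * (d1 + M * d2)))"
proof -
  have split: "(\<Sum>x<A * N. f x) = (\<Sum>j<N. \<Sum>i<A. f (i + A * j))" for A N and f :: "nat \<Rightarrow> 'a"
    unfolding sum_lessThan_mult by (rule sum.swap)
  let ?F = "\<lambda>x1 x2 y1 y2 d0 d1 d2. F (x1 + M * x2) (y1 + M * y2) (d0 + B * (d1 + M * d2))"
  have "(\<Sum>x<M * K. \<Sum>y<M * K. \<Sum>d<B * (M * D). F x y d)
      = (\<Sum>x2<K. \<Sum>x1<M. \<Sum>y2<K. \<Sum>y1<M. \<Sum>d0<B. \<Sum>d2<D. \<Sum>d1<M. ?F x1 x2 y1 y2 d0 d1 d2)"
    unfolding split[of _ M K] sum_lessThan_mult[of _ B] split[of _ M D] ..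
  also have "\<dots> = (\<Sum>x2<K. \<Sum>y2<K. \<Sum>x1<M. \<Sum>y1<M. \<Sum>d0<B. \<Sum>d2<D. \<Sum>d1<M. ?F x1 x2 y1 y2 d0 d1 d2)"
    by (rule sum.cong[OF refl], rule sum.swap)
  also have "\<dots> = (\<Sum>x2<K. \<Sum>y2<K. \<Sum>d0<B. \<Sum>x1<M. \<Sum>y1<M. \<Sum>d2<D. \<Sum>d1<M. ?F x1 x2 y1 y2 d0 d1 d2)"
    by (rule sum.cong[OF refl], rule sum.cong[OF refl], rule sum_swap_last)
  also have "\<dots> = (\<Sum>x2<K. \<Sum>y2<K. \<Sum>d0<B. \<Sum>d2<D. \<Sum>x1<M. \<Sum>y1<M. \<Sum>d1<M. ?F x1 x2 y1 y2 d0 d1 d2)"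
    by (rule sum.cong[OF refl], rule sum.cong[OF refl], rule sum.cong[OF refl], rule sum_swap_last)
  finally show ?thesis .
qed

section \<open>Exponential decay of window correlations\<close>

context block_additive
begin

definition window :: "nat \<Rightarrow> nat \<Rightarrow> nat \<Rightarrow> int" where
  "window G K X = window_part K ((X div q ^ G) mod q ^ K)"

text \<open>\<open>X\<close> stands for a square read in units of \<open>q ^ p\<close>, and
  \<open>2 * i * d\<close> for the cross term of the shift by \<open>i\<close>, where
  \<open>d\<close> carries the leading digits of \<open>n\<close>.\<close>

definition phase :: "(nat \<Rightarrow> int) \<Rightarrow> nat \<Rightarrow> nat \<Rightarrow> nat \<Rightarrow> nat \<Rightarrow> nat \<Rightarrow> complex" where
  "phase A I G K d X = character m (\<Sum>i<I. A i * window G K (X + 2 * i * d))"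

lemma norm_phase [simp]: "cmod (phase A I G K d X) = 1"
  by (simp add: phase_def)

lemma window_periodic: "window G K (X + q ^ (G + K)) = window G K X"
proof -
  have "X + q ^ (G + K) = X + q ^ G * q ^ K" by (simp add: power_add)
  then have "(X + q ^ (G + K)) div q ^ G = X div q ^ G + q ^ K" by (simp only: div_mult_self2) simp
  then show ?thesis by (simp add: window_def)
qed

lemma phase_periodic: "phase A I G K d (X + q ^ (G + K)) = phase A I G K d X"
proof -
  have "window G K (X + q ^ (G + K) + 2 * i * d) = window G K (X + 2 * i * d)" for i
    using window_periodic[of G K "X + 2 * i * d"] by (simp add: ac_simps)
  then show ?thesis by (simp add: phase_def)
qed

text \<open>From the bottom, the zero block offers \<open>c\<close> digits for the carry of
  \<open>x + j * d\<close> out of lower positions (less than \<open>(1 + j) * q ^ p\<close>),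
  \<open>a\<close> zeros, \<open>s\<close> digits for \<open>v\<close>, and \<open>a\<close>
  zeros.\<close>

lemma window_insert:
  assumes "G + a \<le> p" "p + (c + a + s + a) + a \<le> G + K" "1 + j \<le> q ^ c" "v < q ^ s"
    and x: "(x div q ^ p) mod q ^ (c + a + s + a) = 0" and d: "(d div q ^ p) mod q ^ (c + a + s + a) = 0"
  shows "window G K (x + j * d + q ^ p * (q ^ (c + a) * v)) = window G K (x + j * d) + b v"
proof -
  define e where "e = c + a + s + a"
  define p' where "p' = p - G"
  have p: "p = G + p'" using assms(1) by (simp add: p'_def)
  obtain h where h: "x div q ^ p = q ^ e * h" using x by (auto simp: e_def elim: dvdE)
  obtain h' where h': "d div q ^ p = q ^ e * h'" using d by (auto simp: e_def elim: dvdE)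
  define r where "r = x mod q ^ p + j * (d mod q ^ p)"
  define H where "H = h + j * h'"
  have xe: "x = q ^ p * (q ^ e * h) + x mod q ^ p" and de: "d = q ^ p * (q ^ e * h') + d mod q ^ p"
    using h h' by (metis mult_div_mod_eq)+
  have X: "x + j * d = q ^ G * (H * q ^ (p' + e)) + r"
    by (subst xe, subst de) (simp add: r_def H_def p power_add algebra_simps)
  have r: "r < q ^ (G + (p' + c))"
  proof -
    have "r < q ^ p + j * q ^ p"
      unfolding r_def by (intro add_less_le_mono mult_left_mono) (auto simp: less_imp_le)
    also have "\<dots> = (1 + j) * q ^ p" by simp
    also have "\<dots> \<le> q ^ c * q ^ p" using assms(3) by (intro mult_right_mono) auto
    also have "\<dots> = q ^ (G + (p' + c))" by (simp add: p power_add ac_simps)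
    finally show ?thesis .
  qed
  have dv: "(q ^ G * Y + r) div q ^ G = Y + r div q ^ G" for Y by simp
  have r': "r div q ^ G < q ^ (p' + c)"
    using r by (intro less_mult_imp_div_less) (simp add: power_add ac_simps)
  have Xv: "x + j * d + q ^ p * (q ^ (c + a) * v)
      = q ^ G * (H * q ^ (p' + e) + v * q ^ (p' + (c + a))) + r"
    unfolding X by (simp add: p power_add algebra_simps)
  show ?thesis
    unfolding window_def Xv unfolding X dv e_def
    by (rule window_part_insert[OF _ r' assms(4)]) (use assms p in auto)
qed

text \<open>Inserting \<open>y\<close> into \<open>x\<close> and a digit 1 into \<open>d\<close> at
  the same place gives the term of index \<open>i\<close> the pattern \<open>y + 2 * i\<close>, as
  in \<open>nondegenerate\<close>.\<close>

lemma phase_insert: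
  assumes "G + a \<le> p" "p + (c + a + s + a) + a \<le> G + K" "1 + 2 * I \<le> q ^ c" "y + 2 * I < q ^ s"
    and "(x div q ^ p) mod q ^ (c + a + s + a) = 0" and "(d div q ^ p) mod q ^ (c + a + s + a) = 0"
  shows "phase A I G K (d + q ^ p * q ^ (c + a)) (x + q ^ p * (q ^ (c + a) * y))
    = character m (\<Sum>i<I. A i * b (y + 2 * i)) * phase A I G K d x"
proof -
  have "window G K (x + q ^ p * (q ^ (c + a) * y) + 2 * i * (d + q ^ p * q ^ (c + a)))
      = window G K (x + 2 * i * d) + b (y + 2 * i)" if "i < I" for i
  proof -
    have e: "x + q ^ p * (q ^ (c + a) * y) + 2 * i * (d + q ^ p * q ^ (c + a))
        = x + (2 * i) * d + q ^ p * (q ^ (c + a) * (y + 2 * i))"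
      by (simp add: algebra_simps)
    show ?thesis unfolding e
      using window_insert[OF assms(1,2) _ _ assms(5,6), of "2 * i" "y + 2 * i"] assms that by simp
  qed
  then have "(\<Sum>i<I. A i * window G K (x + q ^ p * (q ^ (c + a) * y) + 2 * i * (d + q ^ p * q ^ (c + a))))
      = (\<Sum>i<I. A i * b (y + 2 * i)) + (\<Sum>i<I. A i * window G K (x + 2 * i * d))"
    by (simp add: distrib_left sum.distrib)
  then show ?thesis by (simp add: phase_def character_add)
qed

text \<open>Expanding the square leaves two window arguments and \<open>d\<close>, which have
  \<open>J\<close> blocks of \<open>l\<close> digits at their free disposal. In each block the
  contents zero and \<open>(y, y', 1)\<close> contribute phases differing by the factor
  \<open>\<zeta> \<noteq> 1\<close>, hence \<open>cmod (1 + \<zeta>)\<close> in place of 2. The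
  ratio \<open>\<theta>\<close> to the trivial bound does not depend on \<open>G\<close>,
  \<open>K\<close>, \<open>\<kappa>\<close>, \<open>J\<close> or \<open>T\<close>.\<close>

lemma phase_decay:
  assumes sum0: "(\<Sum>i<I. A i) = 0" and nd: "j < I" "\<not> int m dvd A j"
  obtains l :: nat and \<theta> :: real where "0 < l" "0 \<le> \<theta>" "\<theta> < 1"
    and "\<And>G K \<kappa> J T. \<lbrakk>a \<le> \<kappa>; \<kappa> + l * J + a \<le> K; G + \<kappa> + l * J \<le> T\<rbrakk> \<Longrightarrow>
      (\<Sum>d<q ^ T. \<Sum>X<q ^ (G + \<kappa>). (cmod (\<Sum>t<q ^ (K - \<kappa>). phase A I G K d (X + q ^ (G + \<kappa>) * t)))\<^sup>2)
      \<le> \<theta> ^ J * (real (q ^ T) * real (q ^ (G + \<kappa>)) * (real (q ^ (K - \<kappa>)))\<^sup>2)"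
proof -
  obtain y y' where yy: "\<not> int m dvd (\<Sum>i<I. A i * (b (y + 2 * i) - b (y' + 2 * i)))"
    by (rule nondegenerate[OF sum0 nd])
  define \<zeta> where "\<zeta> = character m (\<Sum>i<I. A i * (b (y + 2 * i) - b (y' + 2 * i)))"
  have "\<zeta> \<noteq> 1" using yy m_ge_1 by (simp add: \<zeta>_def character_eq_1_iff)
  then have \<zeta>: "cmod (1 + \<zeta>) < 2" by (intro norm_one_plus_less_2) (simp_all add: \<zeta>_def)
  have \<zeta>_eq: "\<zeta> = character m (\<Sum>i<I. A i * b (y + 2 * i)) * cnj (character m (\<Sum>i<I. A i * b (y' + 2 * i)))"
    unfolding \<zeta>_def by (simp add: right_diff_distrib sum_subtractf character_diff)
  \<comment> \<open>By the crude bound \<open>x < q ^ x\<close>, \<open>c\<close> digits have room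
    for the carry factor \<open>1 + 2 * I\<close>, and \<open>s\<close> digits for
    \<open>y + 2 * i\<close> and \<open>y' + 2 * i\<close>.\<close>
  define c where "c = 1 + 2 * I"
  define s where "s = y + y' + 2 * I + 2"
  define l where "l = c + a + s + a"
  define Q where "Q = q ^ l"
  have c: "1 + 2 * I \<le> q ^ c" unfolding c_def using power_gt_expt[of q "1 + 2 * I"] q_ge_2 by simp
  have s: "s < q ^ s" by (rule power_gt_expt) (use q_ge_2 in auto)
  have l0: "0 < l" by (simp add: l_def s_def)
  have "2 ^ 1 \<le> Q" unfolding Q_def
    by (rule order_trans[OF power_mono[OF q_ge_2] power_increasing]) (use l0 q_ge_2 in auto)
  then have "2 ^ 3 \<le> real Q ^ 3" by (intro power_mono) auto
  then have Q3: "8 \<le> real Q ^ 3" by simp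
  define \<theta> where "\<theta> = (real Q ^ 3 - 2 + cmod (1 + \<zeta>)) / real Q ^ 3"
  show thesis
  proof (rule that[of l \<theta>])
    show "0 < l" by (rule l0)
    show "0 \<le> \<theta>" using Q3 by (simp add: \<theta>_def)
    show "\<theta> < 1" unfolding \<theta>_def using Q3 \<zeta> by (subst divide_less_eq_1_pos) linarith+
  next
    fix G K \<kappa> J T
    assume \<kappa>: "a \<le> \<kappa>" and K: "\<kappa> + l * J + a \<le> K" and T: "G + \<kappa> + l * J \<le> T"
    \<comment> \<open>\<open>B\<close> counts the digits below the blocks, \<open>M\<close> the
      blocks themselves, and \<open>D\<close> and \<open>R\<close> what lies above them in
      \<open>d\<close> and in the summation variable \<open>t\<close>.\<close>
    define B where "B = q ^ (G + \<kappa>)"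
    define M where "M = Q ^ J"
    define D where "D = q ^ (T - (G + \<kappa> + l * J))"
    define R where "R = q ^ (K - \<kappa> - l * J)"
    have M: "M = q ^ (l * J)" by (simp add: M_def Q_def power_mult)
    have qT: "q ^ T = B * (M * D)" using T by (simp add: B_def M D_def flip: power_add)
    have qK: "q ^ (K - \<kappa>) = M * R" using K by (simp add: M R_def flip: power_add)
    have B0: "0 < B" by (simp add: B_def)
    define \<Phi> where "\<Phi> = (\<lambda>x y d. phase A I G K d x * cnj (phase A I G K d y))"
    have bound: "cmod (block_sum \<Phi> Q J B (X + B * (M * x2)) (X + B * (M * y2)) (d0 + B * (M * d2)))
        \<le> (real Q ^ 3 - 2 + cmod (1 + \<zeta>)) ^ J" if "X < B" "d0 < B" for X x2 y2 d0 d2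
    proof (rule block_sum_bound[where ?z1.0 = "q ^ (c + a) * y" and ?z2.0 = "q ^ (c + a) * y'" and ?z3.0 = "q ^ (c + a)"])
      show "cmod (\<Phi> x y d) \<le> 1" for x y d by (simp add: \<Phi>_def norm_mult)
      have less_Q: "q ^ (c + a) * u < Q" if "u < q ^ s" for u
      proof -
        have "q ^ (c + a) * u < q ^ (c + a) * q ^ s" using that by simp
        also have "\<dots> \<le> Q" unfolding Q_def l_def power_add[symmetric]
          using q_ge_2 by (intro power_increasing) auto
        finally show ?thesis .
      qed
      show "q ^ (c + a) * y < Q" "q ^ (c + a) * y' < Q"
        by (rule less_Q, use s in \<open>simp add: s_def\<close>)+
      show "q ^ (c + a) < Q" using less_Q[of 1] s by (simp add: s_def)
      show "0 < q ^ (c + a)" "0 < B" by (simp_all add: B0)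
      show "(X + B * (M * x2)) div B mod Q ^ J = 0" "(X + B * (M * y2)) div B mod Q ^ J = 0"
        "(d0 + B * (M * d2)) div B mod Q ^ J = 0"
        using that B0 by (simp_all add: M_def)
    next
      fix t x1 x2 d
      assume t: "t < J" and 0: "x1 div (B * Q ^ t) mod Q = 0" "x2 div (B * Q ^ t) mod Q = 0"
        "d div (B * Q ^ t) mod Q = 0"
      define p where "p = G + \<kappa> + l * t"
      have p: "B * Q ^ t = q ^ p" by (simp add: p_def B_def Q_def power_mult power_add)
      have "l * Suc t \<le> l * J" using t by (intro mult_le_mono2) simp
      then have 1: "G + a \<le> p" "p + (c + a + s + a) + a \<le> G + K"
        using \<kappa> K by (simp_all add: p_def l_def)
      have ys: "y + 2 * I < q ^ s" "y' + 2 * I < q ^ s" using s by (simp_all add: s_def)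
      note 0 = 0[unfolded p, unfolded Q_def l_def]
      show "\<Phi> (x1 + B * Q ^ t * (q ^ (c + a) * y)) (x2 + B * Q ^ t * (q ^ (c + a) * y')) (d + B * Q ^ t * q ^ (c + a))
          = \<zeta> * \<Phi> x1 x2 d"
        unfolding p \<Phi>_def \<zeta>_eq
          phase_insert[OF 1 c ys(1) 0(1,3)] phase_insert[OF 1 c ys(2) 0(2,3)] by simp
    qed
    let ?RHS = "\<Sum>X<B. \<Sum>x2<R. \<Sum>y2<R. \<Sum>d0<B. \<Sum>d2<D.
        block_sum \<Phi> Q J B (X + B * (M * x2)) (X + B * (M * y2)) (d0 + B * (M * d2))"
    let ?LHS = "\<Sum>d<q ^ T. \<Sum>X<B. (cmod (\<Sum>t<q ^ (K - \<kappa>). phase A I G K d (X + B * t)))\<^sup>2"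
    have "complex_of_real (\<Sum>d<q ^ T. \<Sum>X<B. (cmod (\<Sum>t<q ^ (K - \<kappa>). phase A I G K d (X + B * t)))\<^sup>2)
        = (\<Sum>d<q ^ T. \<Sum>X<B. \<Sum>t<q ^ (K - \<kappa>). \<Sum>t'<q ^ (K - \<kappa>). \<Phi> (X + B * t) (X + B * t') d)"
      unfolding of_real_sum norm_sum_squared \<Phi>_def ..
    also have "\<dots> = (\<Sum>X<B. \<Sum>d<q ^ T. \<Sum>t<q ^ (K - \<kappa>). \<Sum>t'<q ^ (K - \<kappa>). \<Phi> (X + B * t) (X + B * t') d)"
      by (rule sum.swap)
    also have "\<dots> = (\<Sum>X<B. \<Sum>t<q ^ (K - \<kappa>). \<Sum>t'<q ^ (K - \<kappa>). \<Sum>d<q ^ T. \<Phi> (X + B * t) (X + B * t') d)"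
      by (rule sum.cong[OF refl], rule sum_swap_last[symmetric])
    also have "\<dots> = ?RHS"
      unfolding qT qK sum_split_blocks block_sum_eq M_def[symmetric]
      by (simp add: distrib_left ac_simps)
    finally have eq: "complex_of_real ?LHS = ?RHS" .
    have "?LHS \<le> \<bar>?LHS\<bar>" by simp
    also have "\<dots> = cmod ?RHS" unfolding eq[symmetric] norm_of_real ..
    also have "\<dots> \<le> (\<Sum>X<B. \<Sum>x2<R. \<Sum>y2<R. \<Sum>d0<B. \<Sum>d2<D. (real Q ^ 3 - 2 + cmod (1 + \<zeta>)) ^ J)"
      by (intro sum_norm_le bound) auto
    also have "\<dots> = real B * (real R)\<^sup>2 * real B * real D * (real Q ^ 3 - 2 + cmod (1 + \<zeta>)) ^ J"
    proof -
      have "(\<Sum>X<B. \<Sum>x2<R. \<Sum>y2<R. \<Sum>d0<B. \<Sum>d2<D. z) = real B * (real R)\<^sup>2 * real B * real D * z" for z :: real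
        by (simp only: sum_constant card_lessThan power2_eq_square mult.assoc)
      then show ?thesis .
    qed
    also have "real Q ^ 3 - 2 + cmod (1 + \<zeta>) = \<theta> * real Q ^ 3" 
      unfolding \<theta>_def times_divide_eq_left using Q3 by (subst nonzero_mult_div_cancel_right) linarith+
    also have "(\<theta> * real Q ^ 3) ^ J = \<theta> ^ J * real M ^ 3"
      unfolding M_def power_mult_distrib by (simp add: mult.commute flip: power_mult)
    also have "real B * (real R)\<^sup>2 * real B * real D * (\<theta> ^ J * real M ^ 3)
        = \<theta> ^ J * (real (q ^ T) * real (q ^ (G + \<kappa>)) * (real (q ^ (K - \<kappa>)))\<^sup>2)"
    proof -
      have "u * v\<^sup>2 * u * w * (t * z ^ 3) = t * ((u * (z * w)) * u * (z * v)\<^sup>2)" for u v w t z :: real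
        by algebra
      then show ?thesis unfolding qT qK B_def[symmetric] of_nat_mult .
    qed
    finally have "?LHS \<le> \<theta> ^ J * (real (q ^ T) * real (q ^ (G + \<kappa>)) * (real (q ^ (K - \<kappa>)))\<^sup>2)" .
    then show "(\<Sum>d<q ^ T. \<Sum>X<q ^ (G + \<kappa>). (cmod (\<Sum>t<q ^ (K - \<kappa>). phase A I G K d (X + q ^ (G + \<kappa>) * t)))\<^sup>2)
      \<le> \<theta> ^ J * (real (q ^ T) * real (q ^ (G + \<kappa>)) * (real (q ^ (K - \<kappa>)))\<^sup>2)"
      unfolding B_def by simp
  qed
qed

end

section \<open>Reduction of shifted squares to a bounded window\<close>

lemma div_add_small:
  fixes V \<delta> M :: nat
  assumes "V mod M + \<delta> < M"
  shows "(V + \<delta>) div M = V div M"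
proof -
  have "V + \<delta> = (V mod M + \<delta>) + M * (V div M)" using mult_div_mod_eq[of M V] by linarith
  then have "(V + \<delta>) div M = V div M + (V mod M + \<delta>) div M"
    using assms by (metis div_mult_self2 less_nat_zero_code add.commute)
  then show ?thesis using assms by simp
qed

context block_additive
begin

lemma window_cong:
  assumes "[X = Y] (mod q ^ (G + K))"
  shows "window G K X = window G K Y"
  using window_periodic assms by (rule periodic_cong)

text \<open>
  The squares are read in units of \<open>q\<^sup>p\<close>. The window starts \<open>G\<close> digits higher, so that an error of fewer
  than \<open>4 I\<close> units changes it only if \<open>g1\<close> fails; \<open>g2\<close> excludes carries out of the window at the top.
\<close>
lemma window_reduction:
  fixes p c n i s z c' d G D E E1 K I :: nat
  assumes d: "d = n div q ^ p" and K: "K = D + E + 2 * a" and i: "i < I"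
    and nL: "n < q ^ (p + G + a + D)" and c: "K \<le> c" "2 * c \<le> p" and pE: "D + E \<le> p"
    and E1: "8 * I \<le> q ^ E1" and Ip: "I\<^sup>2 \<le> q ^ p" and s: "s \<le> q ^ D"
    and z: "[z = n\<^sup>2 div q ^ p + 2 * n div q ^ (p - c)] (mod q ^ (G + K))"
    and c': "[c' = n] (mod q ^ K)"
    and g1: "(z + 2 * i * d) mod q ^ G + 4 * I < q ^ G"
    and g2: "(z + 2 * s * q ^ (a + G) * c') mod q ^ (E + D + a + G) + q ^ (E1 + D + a + G)
      < q ^ (E + D + a + G)"
  shows "b ((n + q ^ c + i + s * q ^ (p + G + a))\<^sup>2) = b ((n + q ^ c + i)\<^sup>2 mod q ^ (p + G + a))
    + b ((n + q ^ c + s * q ^ (p + G + a))\<^sup>2 div q ^ (p + G + a + D + E))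
    + window G K (z + 2 * i * d + 2 * s * q ^ (a + G) * (c' + i))"
proof -
  define P g h \<mu> where "P = q ^ p" and "g = q ^ c" and "h = q ^ (a + G)" and "\<mu> = p + G + a"
  define N where "N = n + g"
  define X x2 U u n1 where "X = n\<^sup>2 div P" and "x2 = n\<^sup>2 mod P" and "U = 2 * n div q ^ (p - c)"
    and "u = 2 * n mod q ^ (p - c)" and "n1 = n mod P"
  \<comment> \<open>\<open>V j\<close> collects whole units of \<open>P\<close> and
    \<open>rem j\<close> the rest. The index \<open>j\<close> is free because the high digits are
    compared with those for \<open>j = 0\<close>.\<close>
  define V where "V = (\<lambda>j. X + U + 2 * j * d + 2 * s * h * (N + j) + s\<^sup>2 * P * h\<^sup>2)"
  define rem where "rem = (\<lambda>j. x2 + g * u + g\<^sup>2 + 2 * j * n1 + 2 * g * j + j\<^sup>2)"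
  have P0: "0 < P" and qmu: "q ^ \<mu> = P * h" by (simp_all add: P_def \<mu>_def h_def power_add)
  have gP: "P = g * q ^ (p - c)" using c by (simp add: P_def g_def flip: power_add)
  have g2P: "g\<^sup>2 \<le> P" using c q_ge_2
    by (simp add: P_def g_def mult.commute flip: power_mult)
  have g_le: "g \<le> P" unfolding P_def g_def using c q_ge_2 by (intro power_increasing) auto
  have fine: "(N + j + s * q ^ \<mu>)\<^sup>2 = P * V j + rem j" for j
  proof -
    have 1: "n\<^sup>2 = P * X + x2" by (simp add: X_def x2_def)
    \<comment> \<open>The cross term of the shift by \<open>g = q ^ c\<close> moves the square by
      \<open>U\<close> units, and \<open>U\<close> consists of the digits of \<open>2 * n\<close>
      from position \<open>p - c\<close> on.\<close>
    have 2: "g * (2 * n) = P * U + g * u"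
    proof -
      have "2 * n = q ^ (p - c) * U + u" unfolding U_def u_def by (rule mult_div_mod_eq[symmetric])
      then have "g * (2 * n) = g * (q ^ (p - c) * U + u)" by (rule arg_cong)
      then show ?thesis unfolding gP by (simp add: algebra_simps)
    qed
    have 3: "2 * j * n = P * (2 * j * d) + 2 * j * n1"
    proof -
      have "n = P * d + n1" by (simp add: d P_def n1_def)
      then have "2 * j * n = 2 * j * (P * d + n1)" by (rule arg_cong)
      then show ?thesis by (simp add: algebra_simps)
    qed
    have "(N + j + s * q ^ \<mu>)\<^sup>2 = n\<^sup>2 + g * (2 * n) + 2 * j * n + (g\<^sup>2 + 2 * g * j + j\<^sup>2)
        + P * (2 * s * h * (N + j) + s\<^sup>2 * P * h\<^sup>2)"
      unfolding qmu N_def by (simp add: power2_eq_square algebra_simps)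
    also have "\<dots> = P * V j + rem j"
      unfolding 1 2 3 V_def rem_def by (simp add: algebra_simps)
    finally show ?thesis .
  qed
  \<comment> \<open>Four of the six terms are at most \<open>P\<close> and two at most
    \<open>2 * j * P\<close>, in total \<open>4 * (j + 1)\<close> units; this is the origin of
    \<open>4 * I\<close> in \<open>g1\<close>.\<close>
  have rem: "rem j div P < 4 * I" if "j < I" for j
  proof -
    have "x2 < P" using P0 by (simp add: x2_def)
    moreover have "g * u < P"
      unfolding gP using c by (intro mult_strict_left_mono) (simp_all add: u_def g_def)
    moreover have "2 * j * n1 \<le> 2 * j * P"
      using P0 by (intro mult_left_mono) (auto simp: n1_def less_imp_le)
    moreover have "2 * g * j \<le> 2 * j * P" using g_le by (simp add: mult.commute)
    moreover have "j\<^sup>2 \<le> P"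
    proof -
      have "j\<^sup>2 \<le> I\<^sup>2" using that by (intro power_mono) auto
      then show ?thesis using Ip unfolding P_def by (rule order_trans)
    qed
    ultimately have "rem j < P + P + P + 2 * j * P + 2 * j * P + P"
      unfolding rem_def using g2P by linarith
    also have "\<dots> = (4 * (j + 1)) * P" by (simp add: algebra_simps)
    also have "\<dots> \<le> (4 * I) * P" using that by (intro mult_right_mono) auto
    finally show ?thesis by (rule less_mult_imp_div_less)
  qed
  have coarse: "(N + j + s * q ^ \<mu>)\<^sup>2 div P = V j + rem j div P" for j
    unfolding fine using P0 by simp
  have Vcong: "[V j = z + 2 * j * d + 2 * s * h * (c' + j)] (mod q ^ (G + K))" for j
  proof -
    have "q ^ K dvd g" unfolding g_def using c by (intro le_imp_power_dvd)
    then have "[n + g = n + 0] (mod q ^ K)" by (intro cong_add cong_refl) (simp add: cong_0_iff)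
    then have "[N = n] (mod q ^ K)" by (simp add: N_def)
    then have "[N = c'] (mod q ^ K)" using cong_sym[OF c'] by (rule cong_trans)
    then have "[q ^ G * N = q ^ G * c'] (mod q ^ G * q ^ K)"
      by (simp add: cong_def mult_mod_right[symmetric])
    then have "[2 * s * q ^ a * (q ^ G * N) = 2 * s * q ^ a * (q ^ G * c')] (mod q ^ (G + K))"
      unfolding power_add by (rule cong_scalar_left)
    then have 1: "[2 * s * h * N = 2 * s * h * c'] (mod q ^ (G + K))"
      by (simp add: h_def power_add ac_simps)
    have "q ^ (G + K) dvd P * h\<^sup>2"
    proof -
      have e: "P * h\<^sup>2 = q ^ (p + (a + G) * 2)"
        unfolding P_def h_def by (simp only: power_add power_mult)
      show ?thesis unfolding e using K pE by (intro le_imp_power_dvd) simp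
    qed
    then have 2: "[s\<^sup>2 * P * h\<^sup>2 = 0] (mod q ^ (G + K))"
      unfolding cong_0_iff mult.assoc by (rule dvd_mult)
    have z': "[X + U = z] (mod q ^ (G + K))"
      using cong_sym[OF z] by (simp only: X_def U_def P_def)
    have "[X + U + 2 * j * d + (2 * s * h * N + 2 * s * h * j) + s\<^sup>2 * P * h\<^sup>2
        = z + 2 * j * d + (2 * s * h * c' + 2 * s * h * j) + 0] (mod q ^ (G + K))"
      by (intro cong_add cong_refl 1 2 z')
    then show ?thesis by (simp add: V_def distrib_left)
  qed
  let ?x = "(N + i + s * q ^ \<mu>)\<^sup>2" and ?y = "(N + 0 + s * q ^ \<mu>)\<^sup>2"
  define e where "e = E + D + a + G"
  have low: "?x mod q ^ \<mu> = (N + i)\<^sup>2 mod q ^ \<mu>"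
  proof -
    have "[N + i + s * q ^ \<mu> = N + i + 0] (mod q ^ \<mu>)"
      by (intro cong_add cong_refl) (simp add: cong_0_iff)
    then have "[?x = (N + i + 0)\<^sup>2] (mod q ^ \<mu>)" by (rule cong_pow)
    then show ?thesis by (simp add: cong_def)
  qed
  \<comment> \<open>In units of \<open>P\<close>, the shift \<open>i\<close> and the remainder move
    the square by less than \<open>8 * I * Y\<close>. The choice of \<open>E1\<close> keeps this
    within the margin that \<open>g2\<close> leaves free.\<close>
  have high: "?x div q ^ (\<mu> + D + E) = ?y div q ^ (\<mu> + D + E)"
  proof -
    define Y where "Y = q ^ (D + (a + G))"
    have L: "q ^ (\<mu> + D + E) = P * q ^ e"
      by (simp add: P_def e_def \<mu>_def ac_simps flip: power_add)
    have Yp: "q ^ D * h = Y" by (simp add: Y_def h_def power_add)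
    have "d < Y"
      unfolding d by (rule less_mult_imp_div_less) (use nL in \<open>simp add: Y_def power_add ac_simps\<close>)
    then have "2 * i * d \<le> 2 * I * Y" using i by (intro mult_mono) auto
    moreover have "2 * s * h * i \<le> 2 * I * Y"
    proof -
      have "s * h \<le> Y" using s unfolding Yp[symmetric] by (rule mult_right_mono) simp
      then have "(s * h) * i \<le> Y * I" using i by (intro mult_mono) auto
      then show ?thesis by (simp add: ac_simps)
    qed
    moreover have "4 * I \<le> 4 * I * Y"
      using mult_le_mono2[of 1 Y "4 * I"] q_power_pos by (simp add: Y_def Suc_le_eq)
    moreover have "8 * I * Y \<le> q ^ (E1 + D + a + G)"
      using mult_right_mono[OF E1, of Y] by (simp add: Y_def power_add ac_simps)
    moreover have "rem i div P < 4 * I" using rem i by blast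
    ultimately have delta: "2 * i * d + 2 * s * h * i + rem i div P < q ^ (E1 + D + a + G)"
      by linarith
    have "rem 0 div P < 4 * I" using rem[of 0] i by simp
    then have delta0: "rem 0 div P < q ^ (E1 + D + a + G)"
      using \<open>4 * I \<le> 4 * I * Y\<close> \<open>8 * I * Y \<le> q ^ (E1 + D + a + G)\<close> by linarith
    have "[V 0 = z + 2 * s * h * c'] (mod q ^ (G + K))" using Vcong[of 0] by simp
    then have "[V 0 = z + 2 * s * h * c'] (mod q ^ e)"
      by (rule cong_dvd_modulus_nat) (simp_all add: e_def K le_imp_power_dvd)
    then have V0: "V 0 mod q ^ e + q ^ (E1 + D + a + G) < q ^ e"
      using g2 by (simp add: cong_def e_def h_def)
    have Vi: "V i + rem i div P = V 0 + (2 * i * d + 2 * s * h * i + rem i div P)"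
      by (simp add: V_def distrib_left)
    have "?x div q ^ (\<mu> + D + E) = (V i + rem i div P) div q ^ e"
      unfolding L div_mult2_eq coarse ..
    also have "\<dots> = V 0 div q ^ e"
      unfolding Vi by (rule div_add_small) (use V0 delta in linarith)
    also have "\<dots> = (V 0 + rem 0 div P) div q ^ e"
      by (rule div_add_small[symmetric]) (use V0 delta0 in linarith)
    also have "\<dots> = ?y div q ^ (\<mu> + D + E)"
      unfolding L div_mult2_eq coarse ..
    finally show ?thesis .
  qed
  have mid: "window_part K ((?x div q ^ (p + G)) mod q ^ K)
      = window G K (z + 2 * i * d + 2 * s * h * (c' + i))"
  proof -
    have "[V i = z + 2 * i * d + 2 * s * h * (c' + i)] (mod q ^ G)"
      using Vcong[of i] by (rule cong_dvd_modulus_nat) (simp_all add: le_imp_power_dvd)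
    \<comment> \<open>The term containing \<open>s\<close> is a multiple of \<open>q ^ G\<close>, so
      a single condition \<open>g1\<close> serves every \<open>s\<close>.\<close>
    also have "[z + 2 * i * d + 2 * s * h * (c' + i) = z + 2 * i * d + 0] (mod q ^ G)"
      by (intro cong_add cong_refl) (simp add: cong_0_iff h_def power_add)
    finally have "V i mod q ^ G = (z + 2 * i * d) mod q ^ G" by (simp add: cong_def)
    then have "V i mod q ^ G + rem i div P < q ^ G" using g1 rem[OF i] by linarith
    then have "(V i + rem i div P) div q ^ G = V i div q ^ G" by (rule div_add_small)
    then have "?x div q ^ (p + G) = V i div q ^ G"
      unfolding power_add div_mult2_eq P_def[symmetric] coarse .
    then have "window_part K ((?x div q ^ (p + G)) mod q ^ K) = window G K (V i)"
      by (simp add: window_def)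
    also have "\<dots> = window G K (z + 2 * i * d + 2 * s * h * (c' + i))"
      by (rule window_cong[OF Vcong])
    finally show ?thesis .
  qed
  have "b ?x = b (?x mod q ^ \<mu>) + b (?x div q ^ (\<mu> + D + E))
      + window_part K ((?x div q ^ (\<mu> - a)) mod q ^ K)"
    by (rule b_decompose) (auto simp: \<mu>_def K)
  also have "\<mu> - a = p + G" by (simp add: \<mu>_def)
  finally show ?thesis
    unfolding low high mid by (simp add: N_def g_def h_def \<mu>_def)
qed

text \<open>With \<open>h = q ^ (a + G)\<close>, the displacement
  \<open>2 * i * d + 2 * r * h * (n1 + i)\<close> regroups as
  \<open>2 * r * h * n1 + 2 * i * (d + r * h)\<close>, so each factor is a \<open>phase\<close> with
  difference \<open>d + r * h\<close>. Translating \<open>z\<close> frees the factor for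
  \<open>s\<close> from \<open>n1\<close>; being unimodular it drops out, and the other is summed
  over a progression, where \<open>sum_shifted_AP_le\<close> and \<open>decay\<close> apply.\<close>

lemma phase_mean_bound:
  assumes s: "s < s'" "s' \<le> q ^ D" and pK: "K \<le> p" and \<kappa>: "\<kappa> \<le> K"
    and z0: "[2 * (s' - s) * q ^ a * z0 = q ^ \<kappa>] (mod q ^ K)" and \<eta>: "0 \<le> \<eta>"
    and T: "T = D + a + G + 1" and L: "L = p + G + a + D"
    and decay: "(\<Sum>d<q ^ T. \<Sum>X<q ^ (G + \<kappa>). (cmod (\<Sum>t<q ^ (K - \<kappa>). phase A I G K d (X + q ^ (G + \<kappa>) * t)))\<^sup>2)
      \<le> \<eta>\<^sup>2 * (real (q ^ T) * real (q ^ (G + \<kappa>)) * (real (q ^ (K - \<kappa>)))\<^sup>2)"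
  shows "cmod (\<Sum>n<q ^ L. mean (q ^ (G + K)) (\<lambda>z. character m (\<Sum>i<I. A i *
      (window G K (z + 2 * i * (n div q ^ p) + 2 * s * q ^ (a + G) * (n mod q ^ K + i))
       - window G K (z + 2 * i * (n div q ^ p) + 2 * s' * q ^ (a + G) * (n mod q ^ K + i))))))
    \<le> real (q ^ L) * (real q * \<eta>)"
proof -
  define P h Y W \<sigma> where "P = q ^ p" and "h = q ^ (a + G)" and "Y = q ^ (D + (a + G))"
    and "W = q ^ (G + K)" and "\<sigma> = 2 * (s' - s) * q ^ a"
  define F where "F = (\<lambda>d. phase A I G K (d + s * h))"
  define H where "H = (\<lambda>d. phase A I G K (d + s' * h))"
  define g where "g = (\<lambda>d. \<Sum>X<q ^ (G + \<kappa>). cmod (\<Sum>t<q ^ (K - \<kappa>). phase A I G K d (X + q ^ (G + \<kappa>) * t)))"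
  define f where "f = (\<lambda>n. \<Sum>z<W. character m (\<Sum>i<I. A i *
      (window G K (z + 2 * i * (n div q ^ p) + 2 * s * q ^ (a + G) * (n mod q ^ K + i))
       - window G K (z + 2 * i * (n div q ^ p) + 2 * s' * q ^ (a + G) * (n mod q ^ K + i)))))"
  have P0: "0 < P" and W0: "0 < W" by (simp_all add: P_def W_def)
  have KP: "q ^ K dvd P" unfolding P_def by (intro le_imp_power_dvd pK)
  have qL: "q ^ L = P * Y" by (simp add: L P_def Y_def ac_simps flip: power_add)
  have f_eq: "f (n1 + P * d) = (\<Sum>z<W. F d z * cnj (H d (z + q ^ G * \<sigma> * n1)))" if "n1 < P" for n1 d
  proof -
    have dv: "(n1 + P * d) div q ^ p = d" using that by (simp add: P_def)
    have win: "window G K (z + 2 * i * d + 2 * r * h * ((n1 + P * d) mod q ^ K + i))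
        = window G K (z + 2 * r * h * n1 + 2 * i * (d + r * h))" for z i r
    proof (rule window_cong)
      have "[P * d = 0] (mod q ^ K)" using KP by (simp add: cong_0_iff)
      from cong_add[OF cong_refl this]
      have "[(n1 + P * d) mod q ^ K = n1] (mod q ^ K)" by (simp add: cong_def)
      then have "[q ^ G * ((n1 + P * d) mod q ^ K) = q ^ G * n1] (mod q ^ G * q ^ K)"
        by (simp add: cong_def mult_mod_right[symmetric])
      then have "[2 * r * q ^ a * (q ^ G * ((n1 + P * d) mod q ^ K)) = 2 * r * q ^ a * (q ^ G * n1)] (mod q ^ (G + K))"
        unfolding power_add by (rule cong_scalar_left)
      then have 1: "[2 * r * h * ((n1 + P * d) mod q ^ K) = 2 * r * h * n1] (mod q ^ (G + K))"
        by (simp only: h_def power_add ac_simps)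
      have "[z + 2 * i * d + (2 * r * h * ((n1 + P * d) mod q ^ K) + 2 * r * h * i)
        = z + 2 * i * d + (2 * r * h * n1 + 2 * r * h * i)] (mod q ^ (G + K))"
        by (intro cong_add cong_refl 1)
      then show "[z + 2 * i * d + 2 * r * h * ((n1 + P * d) mod q ^ K + i)
        = z + 2 * r * h * n1 + 2 * i * (d + r * h)] (mod q ^ (G + K))"
        by (simp add: algebra_simps)
    qed
    have "f (n1 + P * d) = (\<Sum>z<W. F d (z + 2 * s * h * n1) * cnj (H d (z + 2 * s' * h * n1)))"
      unfolding f_def dv h_def[symmetric] win F_def H_def phase_def
      by (simp add: right_diff_distrib sum_subtractf character_diff)
    also have "\<dots> = (\<Sum>z<W. F d (z + 2 * s * h * n1) * cnj (H d ((z + 2 * s * h * n1) + q ^ G * \<sigma> * n1)))"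
    proof -
      have "s' = s + (s' - s)" using s by simp
      then have "2 * s' * h * n1 = 2 * (s + (s' - s)) * h * n1" by simp
      also have "\<dots> = 2 * s * h * n1 + 2 * (s' - s) * h * n1"
        by (simp only: distrib_left distrib_right)
      also have "2 * (s' - s) * h * n1 = q ^ G * \<sigma> * n1"
        by (simp only: \<sigma>_def h_def power_add ac_simps)
      finally show ?thesis by (simp add: add.assoc)
    qed
    also have "\<dots> = (\<Sum>z<W. F d z * cnj (H d (z + q ^ G * \<sigma> * n1)))"
    proof (rule sum_periodic_shift[of "\<lambda>z. F d z * cnj (H d (z + q ^ G * \<sigma> * n1))"])
      fix z
      have "F d (z + W) = F d z" unfolding F_def W_def by (rule phase_periodic)
      moreover have "H d ((z + q ^ G * \<sigma> * n1) + W) = H d (z + q ^ G * \<sigma> * n1)"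
        unfolding H_def W_def by (rule phase_periodic)
      ultimately show "F d (z + W) * cnj (H d (z + W + q ^ G * \<sigma> * n1)) = F d z * cnj (H d (z + q ^ G * \<sigma> * n1))"
        by (simp add: ac_simps)
    qed
    finally show ?thesis .
  qed
  have "(\<Sum>n<q ^ L. f n) = (\<Sum>n1<P. \<Sum>d<Y. \<Sum>z<W. F d z * cnj (H d (z + q ^ G * \<sigma> * n1)))"
    unfolding qL sum_lessThan_mult by (intro sum.cong refl f_eq) simp
  also have "\<dots> = (\<Sum>d<Y. \<Sum>z<W. \<Sum>n1<P. F d z * cnj (H d (z + q ^ G * \<sigma> * n1)))"
    by (rule sum_swap_last[symmetric])
  also have "\<dots> = (\<Sum>d<Y. \<Sum>z<W. F d z * cnj (\<Sum>n1<P. H d (z + q ^ G * \<sigma> * n1)))"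
    by (simp add: sum_distrib_left)
  finally have f_sum: "(\<Sum>n<q ^ L. f n) = (\<Sum>d<Y. \<Sum>z<W. F d z * cnj (\<Sum>n1<P. H d (z + q ^ G * \<sigma> * n1)))" .
  have "cmod (\<Sum>n<q ^ L. f n) \<le> (\<Sum>d<Y. \<Sum>z<W. cmod (F d z * cnj (\<Sum>n1<P. H d (z + q ^ G * \<sigma> * n1))))"
    unfolding f_sum by (intro sum_norm_le norm_sum)
  also have "\<dots> = (\<Sum>d<Y. \<Sum>z<W. cmod (\<Sum>n1<P. H d (z + q ^ G * \<sigma> * n1)))"
    unfolding norm_mult complex_mod_cnj by (simp add: F_def)
  also have "\<dots> \<le> (\<Sum>d<Y. real P * g (d + s' * h))"
  proof (rule sum_mono)
    fix d
    show "(\<Sum>z<W. cmod (\<Sum>n1<P. H d (z + q ^ G * \<sigma> * n1))) \<le> real P * g (d + s' * h)"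
      unfolding W_def g_def H_def \<sigma>_def
      by (rule sum_shifted_AP_le[where H = "phase A I G K (d + s' * h)", unfolded h_def,
            OF q_pos phase_periodic z0 \<kappa> KP, folded h_def])
  qed
  also have "\<dots> = real P * (\<Sum>d<Y. g (d + s' * h))" by (simp only: sum_distrib_left)
  \<comment> \<open>The argument stays below \<open>2 * Y \<le> q ^ T\<close>. The extra digit in
    \<open>T\<close> costs the factor \<open>q\<close> in the final bound.\<close>
  also have "(\<Sum>d<Y. g (d + s' * h)) \<le> (\<Sum>d<q ^ T. g d)"
  proof -
    have "s' * h \<le> Y" using mult_right_mono[OF s(2), of h] by (simp add: Y_def h_def power_add)
    moreover have "2 * Y \<le> q * Y" using q_ge_2 by (rule mult_right_mono) simp
    moreover have "q * Y = q ^ T" by (simp add: Y_def T ac_simps flip: power_Suc)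
    ultimately have "(\<lambda>d. d + s' * h) ` {..<Y} \<subseteq> {..<q ^ T}" by auto
    then have "(\<Sum>d\<in>(\<lambda>d. d + s' * h) ` {..<Y}. g d) \<le> (\<Sum>d<q ^ T. g d)"
      by (intro sum_mono2) (auto simp: g_def intro: sum_nonneg)
    then show ?thesis by (simp add: sum.reindex)
  qed
  also have "(\<Sum>d<q ^ T. g d) \<le> \<eta> * (real (q ^ T) * real W)"
  proof (rule power2_le_imp_le)
    have W: "real W = real (q ^ (G + \<kappa>)) * real (q ^ (K - \<kappa>))"
      using \<kappa> by (simp add: W_def flip: power_add of_nat_mult of_nat_power)
    let ?c = "\<lambda>d X. cmod (\<Sum>t<q ^ (K - \<kappa>). phase A I G K d (X + q ^ (G + \<kappa>) * t))"
    have "(\<Sum>d<q ^ T. g d)\<^sup>2 = (\<Sum>p\<in>{..<q ^ T} \<times> {..<q ^ (G + \<kappa>)}. ?c (fst p) (snd p))\<^sup>2"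
      by (simp add: g_def sum.cartesian_product case_prod_unfold)
    also have "\<dots> \<le> real (card ({..<q ^ T} \<times> {..<q ^ (G + \<kappa>)})) *
        (\<Sum>p\<in>{..<q ^ T} \<times> {..<q ^ (G + \<kappa>)}. (?c (fst p) (snd p))\<^sup>2)"
      by (rule sum_squared_le_card)
    also have "\<dots> = real (q ^ T) * real (q ^ (G + \<kappa>)) * (\<Sum>d<q ^ T. \<Sum>X<q ^ (G + \<kappa>). (?c d X)\<^sup>2)"
      by (simp add: sum.cartesian_product case_prod_unfold card_cartesian_product)
    also have "\<dots> \<le> real (q ^ T) * real (q ^ (G + \<kappa>)) *
        (\<eta>\<^sup>2 * (real (q ^ T) * real (q ^ (G + \<kappa>)) * (real (q ^ (K - \<kappa>)))\<^sup>2))"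
      by (intro mult_left_mono decay) auto
    also have "\<dots> = (\<eta> * (real (q ^ T) * real W))\<^sup>2"
      unfolding W by algebra
    finally show "(\<Sum>d<q ^ T. g d)\<^sup>2 \<le> (\<eta> * (real (q ^ T) * real W))\<^sup>2" .
    show "0 \<le> \<eta> * (real (q ^ T) * real W)" using \<eta> by simp
  qed
  finally have main: "cmod (\<Sum>n<q ^ L. f n) \<le> real P * (\<eta> * (real (q ^ T) * real W))"
    by (simp add: mult_left_mono)
  have "real P * real (q ^ T) = real (q ^ L) * real q"
  proof -
    have "P * q ^ T = q ^ L * q" by (simp add: P_def T L ac_simps flip: power_add power_Suc)
    then show ?thesis by (metis of_nat_mult)
  qed
  then have e: "real P * (\<eta> * (real (q ^ T) * real W)) = real (q ^ L) * (real q * \<eta>) * real W"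
    by algebra
  have "(\<Sum>n<q ^ L. mean W (\<lambda>z. character m (\<Sum>i<I. A i *
      (window G K (z + 2 * i * (n div q ^ p) + 2 * s * q ^ (a + G) * (n mod q ^ K + i))
       - window G K (z + 2 * i * (n div q ^ p) + 2 * s' * q ^ (a + G) * (n mod q ^ K + i))))))
      = (\<Sum>n<q ^ L. f n) / of_nat W"
    unfolding mean_def f_def by (rule sum_divide_distrib[symmetric])
  then show ?thesis
    using main W0 unfolding e W_def[symmetric] by (simp only: norm_divide norm_of_nat) (simp add: pos_divide_le_eq)
qed

end

section \<open>Off-diagonal terms and the choice of parameters\<close>

lemma ex_power_gt:
  fixes q :: nat
  assumes "2 \<le> q"
  obtains n where "(x::real) < real (q ^ n)"
proof -
  obtain n where "x < real q ^ n" using real_arch_pow[of "real q" x] assms by auto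
  then show thesis by (intro that[of n]) simp
qed

context block_additive
begin

text \<open>The low part \<open>lw i\<close> is common to \<open>s\<close> and \<open>s'\<close> and
  cancels; the high part \<open>hd r\<close> is free of \<open>i\<close> and is annihilated by
  \<open>sum0\<close>.\<close>

lemma shifted_phase_eq:
  fixes p c n z s s' d c' G D E E1 K I :: nat
  assumes sum0: "(\<Sum>i<I. A i) = 0"
    and d: "d = n div q ^ p" and K: "K = D + E + 2 * a"
    and nL: "n < q ^ (p + G + a + D)" and c: "K \<le> c" "2 * c \<le> p" and pE: "D + E \<le> p"
    and E1: "8 * I \<le> q ^ E1" and Ip: "I\<^sup>2 \<le> q ^ p" and s: "s \<le> q ^ D" "s' \<le> q ^ D"
    and z: "[z = n\<^sup>2 div q ^ p + 2 * n div q ^ (p - c)] (mod q ^ (G + K))"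
    and c': "[c' = n] (mod q ^ K)"
    and g1: "\<And>i. i < I \<Longrightarrow> (z + 2 * i * d) mod q ^ G + 4 * I < q ^ G"
    and g2: "\<And>r. r \<in> {s, s'} \<Longrightarrow> (z + 2 * r * q ^ (a + G) * c') mod q ^ (E + D + a + G) + q ^ (E1 + D + a + G)
      < q ^ (E + D + a + G)"
  shows "character m (\<Sum>i<I. A i * (b ((n + q ^ c + i + s * q ^ (p + G + a))\<^sup>2)
        - b ((n + q ^ c + i + s' * q ^ (p + G + a))\<^sup>2)))
    = character m (\<Sum>i<I. A i * (window G K (z + 2 * i * d + 2 * s * q ^ (a + G) * (c' + i))
        - window G K (z + 2 * i * d + 2 * s' * q ^ (a + G) * (c' + i))))"
proof -
  define hd where "hd = (\<lambda>r. b ((n + q ^ c + r * q ^ (p + G + a))\<^sup>2 div q ^ (p + G + a + D + E)))"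
  define lw where "lw = (\<lambda>i. b ((n + q ^ c + i)\<^sup>2 mod q ^ (p + G + a)))"
  define wd where "wd = (\<lambda>r i. window G K (z + 2 * i * d + 2 * r * q ^ (a + G) * (c' + i)))"
  have eq: "b ((n + q ^ c + i + r * q ^ (p + G + a))\<^sup>2) = lw i + hd r + wd r i"
    if "i < I" "r \<in> {s, s'}" for r i
    unfolding lw_def hd_def wd_def
    by (rule window_reduction[OF d K that(1) nL c pE E1 Ip _ z c' g1[OF that(1)] g2[OF that(2)]])
       (use that(2) s in auto)
  have "(\<Sum>i<I. A i * (b ((n + q ^ c + i + s * q ^ (p + G + a))\<^sup>2)
        - b ((n + q ^ c + i + s' * q ^ (p + G + a))\<^sup>2)))
      = (\<Sum>i<I. A i * (hd s - hd s') + A i * (wd s i - wd s' i))"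
  proof (intro sum.cong refl)
    fix i assume "i \<in> {..<I}"
    then have i: "i < I" by simp
    show "A i * (b ((n + q ^ c + i + s * q ^ (p + G + a))\<^sup>2) - b ((n + q ^ c + i + s' * q ^ (p + G + a))\<^sup>2))
        = A i * (hd s - hd s') + A i * (wd s i - wd s' i)"
      unfolding eq[OF i, of s, simplified] eq[OF i, of s', simplified] by (simp add: algebra_simps)
  qed
  also have "\<dots> = (\<Sum>i<I. A i) * (hd s - hd s') + (\<Sum>i<I. A i * (wd s i - wd s' i))"
    by (simp only: sum.distrib sum_distrib_right)
  finally show ?thesis using sum0 by (simp add: wd_def)
qed

text \<open>The residues violating \<open>g1\<close> or \<open>g2\<close> of
  \<open>window_reduction\<close>, for given leading and last digits of \<open>n\<close>. Under
  truncated subtraction \<open>q ^ G - 4 * I \<le> x\<close> is exactly the negation of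
  \<open>x + 4 * I < q ^ G\<close>.\<close>

definition exceptional :: "nat \<Rightarrow> nat \<Rightarrow> nat \<Rightarrow> nat \<Rightarrow> nat \<Rightarrow> nat set \<Rightarrow> nat \<times> nat \<Rightarrow> nat set" where
  "exceptional I G D E E1 S = (\<lambda>(d, c).
     (\<Union>i<I. {z. q ^ G - 4 * I \<le> (z + 2 * i * d) mod q ^ G}) \<union>
     (\<Union>r\<in>S. {z. q ^ (E + D + a + G) - q ^ (E1 + D + a + G) \<le> (z + 2 * r * q ^ (a + G) * c) mod q ^ (E + D + a + G)}))"

lemma card_exceptional:
  assumes "finite S" and E: "E = E1 + E2" and K: "K = D + E + 2 * a"
  shows "real (card (exceptional I G D E E1 S dc \<inter> {..<q ^ (G + K)}))
    \<le> (real I * real (4 * I) / real (q ^ G) + real (card S) / real (q ^ E2)) * real (q ^ (G + K))"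
proof -
  obtain d c where dc: "dc = (d, c)" by force
  define W where "W = q ^ (G + K)"
  define \<Lambda> where "\<Lambda> = q ^ (E + D + a + G)"
  define A where "A = (\<lambda>i. {z. q ^ G - 4 * I \<le> (z + 2 * i * d) mod q ^ G} \<inter> {..<W})"
  define B where "B = (\<lambda>r. {z. \<Lambda> - q ^ (E1 + D + a + G) \<le> (z + 2 * r * q ^ (a + G) * c) mod \<Lambda>} \<inter> {..<W})"
  have A: "real (card (A i)) \<le> real W * real (4 * I) / real (q ^ G)" for i
    unfolding A_def by (rule card_top_residues) (simp_all add: W_def le_imp_power_dvd)
  have \<Lambda>W: "\<Lambda> dvd W" by (simp add: \<Lambda>_def W_def K le_imp_power_dvd)
  have B: "real (card (B r)) \<le> real W / real (q ^ E2)" for r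
  proof -
    have "\<Lambda> = q ^ E2 * q ^ (E1 + D + a + G)" by (simp add: \<Lambda>_def E ac_simps flip: power_add)
    then have "real W * real (q ^ (E1 + D + a + G)) / real \<Lambda> = real W / real (q ^ E2)" by simp
    then show ?thesis
      using card_top_residues[OF \<Lambda>W, of "q ^ (E1 + D + a + G)" "2 * r * q ^ (a + G) * c"]
      by (simp add: B_def \<Lambda>_def)
  qed
  have "exceptional I G D E E1 S dc \<inter> {..<W} = (\<Union>i<I. A i) \<union> (\<Union>r\<in>S. B r)"
    by (auto simp: exceptional_def dc A_def B_def \<Lambda>_def)
  then have "card (exceptional I G D E E1 S dc \<inter> {..<W}) \<le> (\<Sum>i<I. card (A i)) + (\<Sum>r\<in>S. card (B r))"
    using card_Un_le[of "\<Union>i<I. A i" "\<Union>r\<in>S. B r"] card_UN_le[of "{..<I}" A] card_UN_le[of S B] assms(1)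
    by simp
  then have "real (card (exceptional I G D E E1 S dc \<inter> {..<W}))
      \<le> (\<Sum>i<I. real (card (A i))) + (\<Sum>r\<in>S. real (card (B r)))"
    by (simp flip: of_nat_sum of_nat_add)
  also have "\<dots> \<le> real (card {..<I}) * (real W * real (4 * I) / real (q ^ G)) + real (card S) * (real W / real (q ^ E2))"
    by (intro add_mono sum_bounded_above A B)
  also have "\<dots> = (real I * real (4 * I) / real (q ^ G) + real (card S) / real (q ^ E2)) * real W"
    by (simp add: field_simps)
  finally show ?thesis by (simp add: W_def)
qed

text \<open>In the bound, the square root is the error of the law of large numbers, the next two
  terms come from exceptional residues, \<open>real q * \<eta>\<close> from the decay of
  correlations, and the last summand from the longest shift.\<close>

lemma offdiagonal_bound:
  fixes A :: "nat \<Rightarrow> int" and \<epsilon> \<eta> :: real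
  assumes sum0: "(\<Sum>i<I. A i) = 0" and ss: "s < s'" "s' \<le> q ^ D"
    and E: "E = E1 + E2" and K: "K = D + E + 2 * a" and L: "L = p + G + a + D"
    and E1: "8 * I \<le> q ^ E1" and Ip: "I\<^sup>2 \<le> q ^ p" and \<kappa>: "\<kappa> \<le> K"
    and z0: "[2 * (s' - s) * q ^ a * z0 = q ^ \<kappa>] (mod q ^ K)" and \<eta>: "0 \<le> \<eta>"
    and T: "T = D + a + G + 1"
    and decay: "(\<Sum>d<q ^ T. \<Sum>X<q ^ (G + \<kappa>). (cmod (\<Sum>t<q ^ (K - \<kappa>). phase A I G K d (X + q ^ (G + \<kappa>) * t)))\<^sup>2)
      \<le> \<eta>\<^sup>2 * (real (q ^ T) * real (q ^ (G + \<kappa>)) * (real (q ^ (K - \<kappa>)))\<^sup>2)"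
    and N: "0 < N" and p: "p div 2 + 1 + N * (G + K) + K \<le> p"
  shows "cmod (\<Sum>n<q ^ L. character m (\<Sum>i<I. A i *
      (b ((n + i + s * q ^ (L - D))\<^sup>2) - b ((n + i + s' * q ^ (L - D))\<^sup>2))))
    \<le> real (q ^ L) * (6 * sqrt (real (q ^ (D + a + G) * q ^ K) * real (q ^ (G + K)) / real N)
        + 2 * (real I * real (4 * I) / real (q ^ G) + 2 / real (q ^ E2)) + real q * \<eta>)
      + 2 * real (q ^ (p - (p div 2 + 1)))"
proof -
  \<comment> \<open>Exceeding half of \<open>p\<close> ensures \<open>2 * cc t \<le> p\<close>. The
    exponent \<open>cc t\<close> is complementary: \<open>q ^ cc t\<close> brings the digits of
    \<open>2 * n\<close> from position \<open>s0 + t * (G + K)\<close> to position \<open>p\<close>.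
    It stays at least \<open>K\<close>, so the last \<open>K\<close> digits of \<open>n\<close> are
    untouched.\<close>
  define s0 where "s0 = p div 2 + 1"
  define cc where "cc = (\<lambda>t. p - (s0 + t * (G + K)))"
  define W where "W = q ^ (G + K)"
  define U where "U = (\<lambda>t n. (2 * n div q ^ (s0 + t * (G + K))) mod q ^ (G + K))"
  define f where "f = (\<lambda>n. character m (\<Sum>i<I. A i *
      (b ((n + i + s * q ^ (L - D))\<^sup>2) - b ((n + i + s' * q ^ (L - D))\<^sup>2))))"
  define \<iota> where "\<iota> = (\<lambda>n. (n div q ^ p, n mod q ^ K))"
  define \<phi> where "\<phi> = (\<lambda>(d, c) z. character m (\<Sum>i<I. A i *
      (window G K (z + 2 * i * d + 2 * s * q ^ (a + G) * (c + i))
       - window G K (z + 2 * i * d + 2 * s' * q ^ (a + G) * (c + i)))))"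
  define Ix where "Ix = {..<q ^ (D + a + G)} \<times> {..<q ^ K}"
  define \<beta> where "\<beta> = real I * real (4 * I) / real (q ^ G) + 2 / real (q ^ E2)"
  have LD: "L - D = p + G + a" by (simp add: L)
  have t_le: "s0 + t * (G + K) + K \<le> p" if "t < N" for t
  proof -
    have "t * (G + K) \<le> N * (G + K)" using that by (intro mult_right_mono) auto
    then show ?thesis using p unfolding s0_def by linarith
  qed
  have avg: "cmod ((\<Sum>n<q ^ L. f n) - (\<Sum>n<q ^ L. mean W (\<phi> (\<iota> n))))
    \<le> real (q ^ L) * (6 * sqrt (real (card Ix) * real W / real N) + 2 * \<beta>) + 2 * real (q ^ (p - s0))"
  proof (rule shifted_average[where U = U and E = "exceptional I G D E E1 {s, s'}"
        and X = "\<lambda>n. n\<^sup>2 div q ^ p" and g = "\<lambda>t. q ^ cc t"])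
    show "pairwise_uniform (q ^ L) W N U"
      unfolding W_def U_def
      by (rule pairwise_uniform_doubled[OF q_ge_2]) (use p in \<open>simp_all add: s0_def L\<close>)
    show "0 < W" by (simp add: W_def)
    show "0 < N" by (rule N)
    show "finite Ix" by (simp add: Ix_def)
    show "\<iota> n \<in> Ix" if "n < q ^ L" for n
    proof -
      have "n div q ^ p < q ^ (D + a + G)"
        by (rule less_mult_imp_div_less) (use that in \<open>simp add: L ac_simps flip: power_add\<close>)
      then show ?thesis by (simp add: \<iota>_def Ix_def)
    qed
    show "cmod (f n) \<le> 1" for n by (simp add: f_def)
    show "cmod (\<phi> i z) \<le> 1" for i z by (simp add: \<phi>_def case_prod_unfold)
    show "real (card (exceptional I G D E E1 {s, s'} i \<inter> {..<W})) \<le> \<beta> * real W" for i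
      using card_exceptional[of "{s, s'}", OF _ E K, of I G i] ss by (simp add: \<beta>_def W_def)
    show "q ^ cc t \<le> q ^ (p - s0)" for t
      using q_ge_2 by (intro power_increasing) (auto simp: cc_def)
  next
    fix t n
    assume t: "t < N" and n: "n < q ^ L"
      and z: "(n\<^sup>2 div q ^ p + U t n) mod W \<notin> exceptional I G D E E1 {s, s'} (\<iota> n)"
    let ?z = "(n\<^sup>2 div q ^ p + U t n) mod W"
    have pcc: "p - cc t = s0 + t * (G + K)" using t_le[OF t] by (simp add: cc_def)
    have c: "K \<le> cc t" "2 * cc t \<le> p" using t_le[OF t] by (auto simp: cc_def s0_def)
    have pK: "K \<le> p" using p by linarith
    have "character m (\<Sum>i<I. A i * (b ((n + q ^ cc t + i + s * q ^ (p + G + a))\<^sup>2)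
        - b ((n + q ^ cc t + i + s' * q ^ (p + G + a))\<^sup>2)))
      = character m (\<Sum>i<I. A i * (window G K (?z + 2 * i * (n div q ^ p) + 2 * s * q ^ (a + G) * (n mod q ^ K + i))
        - window G K (?z + 2 * i * (n div q ^ p) + 2 * s' * q ^ (a + G) * (n mod q ^ K + i))))"
    proof (rule shifted_phase_eq[OF sum0 refl K _ c _ E1 Ip])
      show "n < q ^ (p + G + a + D)" using n by (simp add: L)
      show "D + E \<le> p" using pK K by simp
      show "s \<le> q ^ D" "s' \<le> q ^ D" using ss by auto
      show "[?z = n\<^sup>2 div q ^ p + 2 * n div q ^ (p - cc t)] (mod q ^ (G + K))"
        unfolding pcc by (simp add: U_def W_def cong_def mod_add_right_eq)
      show "[n mod q ^ K = n] (mod q ^ K)" by (simp add: cong_def)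
    next
      fix i assume "i < I"
      then have "\<not> q ^ G - 4 * I \<le> (?z + 2 * i * (n div q ^ p)) mod q ^ G"
        using z by (auto simp: exceptional_def \<iota>_def)
      then show "(?z + 2 * i * (n div q ^ p)) mod q ^ G + 4 * I < q ^ G" by linarith
    next
      fix r assume "r \<in> {s, s'}"
      then have "\<not> q ^ (E + D + a + G) - q ^ (E1 + D + a + G)
          \<le> (?z + 2 * r * q ^ (a + G) * (n mod q ^ K)) mod q ^ (E + D + a + G)"
        using z by (auto simp: exceptional_def \<iota>_def)
      then show "(?z + 2 * r * q ^ (a + G) * (n mod q ^ K)) mod q ^ (E + D + a + G) + q ^ (E1 + D + a + G)
          < q ^ (E + D + a + G)" by linarith
    qed
    then show "f (n + q ^ cc t) = \<phi> (\<iota> n) ?z"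
      by (simp add: f_def \<phi>_def \<iota>_def LD)
  qed
  have "cmod (\<Sum>n<q ^ L. mean W (\<phi> (\<iota> n))) \<le> real (q ^ L) * (real q * \<eta>)"
    unfolding W_def \<phi>_def \<iota>_def prod.case
    by (rule phase_mean_bound[OF ss _ \<kappa> z0 \<eta> T L decay]) (use p in linarith)
  moreover have "cmod (\<Sum>n<q ^ L. f n) \<le> cmod ((\<Sum>n<q ^ L. f n) - (\<Sum>n<q ^ L. mean W (\<phi> (\<iota> n))))
      + cmod (\<Sum>n<q ^ L. mean W (\<phi> (\<iota> n)))"
    by (metis add.commute norm_triangle_sub)
  ultimately have "cmod (\<Sum>n<q ^ L. f n) \<le>
      real (q ^ L) * (6 * sqrt (real (card Ix) * real W / real N) + 2 * \<beta> + real q * \<eta>) + 2 * real (q ^ (p - s0))"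
    using avg by (simp add: distrib_left)
  then show ?thesis
    by (simp add: f_def Ix_def W_def \<beta>_def s0_def card_cartesian_product)
qed

text \<open>\<open>D\<close> only has to make room for \<open>J\<close> blocks above
  \<open>\<kappa>\<close>. Stating the bound for all large \<open>D\<close> lets finitely many
  quadruples \<open>r, r', s, s'\<close> share one \<open>D\<close>.\<close>

lemma offdiagonal_small:
  fixes A :: "nat \<Rightarrow> int" and \<epsilon> :: real
  assumes sum0: "(\<Sum>i<I. A i) = 0" and nd: "j < I" "\<not> int m dvd A j" and ss: "s < s'" and \<epsilon>: "0 < \<epsilon>"
  shows "\<forall>\<^sub>F D in sequentially. \<forall>\<^sub>F L in sequentially.
    cmod (\<Sum>n<q ^ L. character m (\<Sum>i<I. A i *
      (b ((n + i + s * q ^ (L - D))\<^sup>2) - b ((n + i + s' * q ^ (L - D))\<^sup>2)))) \<le> \<epsilon> * real (q ^ L)"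
proof -
  obtain l \<theta> where l: "0 < l" and \<theta>: "0 \<le> \<theta>" "\<theta> < 1"
    and decay: "\<And>G K \<kappa> J T. \<lbrakk>a \<le> \<kappa>; \<kappa> + l * J + a \<le> K; G + \<kappa> + l * J \<le> T\<rbrakk> \<Longrightarrow>
      (\<Sum>d<q ^ T. \<Sum>X<q ^ (G + \<kappa>). (cmod (\<Sum>t<q ^ (K - \<kappa>). phase A I G K d (X + q ^ (G + \<kappa>) * t)))\<^sup>2)
      \<le> \<theta> ^ J * (real (q ^ T) * real (q ^ (G + \<kappa>)) * (real (q ^ (K - \<kappa>)))\<^sup>2)"
    by (rule phase_decay[OF sum0 nd]; rule that; assumption)
  obtain G where G: "real I * real (4 * I) * 20 / \<epsilon> < real (q ^ G)" by (rule ex_power_gt[OF q_ge_2])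
  obtain E2 where E2: "40 / \<epsilon> < real (q ^ E2)" by (rule ex_power_gt[OF q_ge_2])
  obtain n0 where n0: "10 / \<epsilon> < real (q ^ n0)" by (rule ex_power_gt[OF q_ge_2])
  define E1 where "E1 = 8 * I"
  define E where "E = E1 + E2"
  have E1: "8 * I \<le> q ^ E1"
    unfolding E1_def using power_gt_expt[of q "8 * I"] q_ge_2 by simp
  \<comment> \<open>The same number serves as multiplier and as exponent, since
    \<open>ex_cong_power\<close> only asks that the exponent be no smaller than the
    multiplier.\<close>
  define \<kappa> where "\<kappa> = 2 * (s' - s) * q ^ a"
  have \<kappa>0: "0 < \<kappa>" using ss by (simp add: \<kappa>_def)
  have a\<kappa>: "a \<le> \<kappa>"
  proof -
    have "a < q ^ a" by (rule power_gt_expt) (use q_ge_2 in auto)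
    also have "q ^ a \<le> \<kappa>" using ss by (simp add: \<kappa>_def)
    finally show ?thesis by simp
  qed
  obtain J where J: "\<theta> ^ J < (\<epsilon> / (5 * real q))\<^sup>2"
    using real_arch_pow_inv[of "(\<epsilon> / (5 * real q))\<^sup>2" \<theta>] \<theta> \<epsilon> q_ge_2 by auto
  define \<eta> where "\<eta> = sqrt (\<theta> ^ J)"
  have \<eta>0: "0 \<le> \<eta>" and \<eta>2: "\<eta>\<^sup>2 = \<theta> ^ J" using \<theta> by (simp_all add: \<eta>_def)
  have "\<eta> \<le> \<epsilon> / (5 * real q)"
    unfolding \<eta>_def using J \<epsilon> q_ge_2 by (intro real_le_lsqrt) auto
  then have \<eta>: "real q * \<eta> \<le> \<epsilon> / 5" using q_ge_2 by (simp add: field_simps)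
  have \<beta>: "2 * (real I * real (4 * I) / real (q ^ G) + 2 / real (q ^ E2)) \<le> \<epsilon> / 5"
  proof -
    have "real I * real (4 * I) / real (q ^ G) \<le> \<epsilon> / 20" "2 / real (q ^ E2) \<le> \<epsilon> / 20"
      using G E2 \<epsilon> by (simp_all add: field_simps)
    moreover have "2 * (x + y) \<le> \<epsilon> / 5" if "x \<le> \<epsilon> / 20" "y \<le> \<epsilon> / 20" for x y
      using add_mono[OF that] by simp
    ultimately show ?thesis by blast
  qed
  have "\<forall>\<^sub>F L in sequentially. cmod (\<Sum>n<q ^ L. character m (\<Sum>i<I. A i *
      (b ((n + i + s * q ^ (L - D))\<^sup>2) - b ((n + i + s' * q ^ (L - D))\<^sup>2)))) \<le> \<epsilon> * real (q ^ L)"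
    if D: "\<kappa> + l * J + s' \<le> D" for D
  proof -
    define K where "K = D + E + 2 * a"
    obtain z0 where "[\<kappa> * z0 = q ^ \<kappa>] (mod q ^ K)"
      using ex_cong_power[OF \<kappa>0 order_refl q_pos] by blast
    then have z0: "[2 * (s' - s) * q ^ a * z0 = q ^ \<kappa>] (mod q ^ K)" by (simp add: \<kappa>_def)
    define B where "B = real (q ^ (D + a + G) * q ^ K) * real (q ^ (G + K))"
    obtain N where N: "B * (30 / \<epsilon>)\<^sup>2 < real N" using reals_Archimedean2 by blast
    have B0: "0 < B" by (simp add: B_def)
    have "0 < real N" using N B0 \<epsilon> by (intro le_less_trans[OF _ N]) simp
    then have N0: "0 < N" by simp
    have sqrtN: "6 * sqrt (B / real N) \<le> \<epsilon> / 5"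
    proof -
      have "B * (900 / \<epsilon>\<^sup>2) < real N" using N by (simp add: power_divide)
      then have "B / real N \<le> (\<epsilon> / 30)\<^sup>2"
        using \<open>0 < real N\<close> \<epsilon> by (simp add: field_simps power_divide)
      then have "sqrt (B / real N) \<le> \<epsilon> / 30" using \<epsilon> by (intro real_le_lsqrt) auto
      then show ?thesis by simp
    qed
    have sD: "s' \<le> q ^ D"
    proof -
      have "s' \<le> D" using D by simp
      also have "D \<le> q ^ D" using power_gt_expt[of q D] q_ge_2 by simp
      finally show ?thesis .
    qed
    \<comment> \<open>The factor 2 appears because the shifts can use only half of the
      \<open>p\<close> positions; \<open>n0\<close> makes the last summand of the bound
      small.\<close>
    define L0 where "L0 = 2 * (2 + N * (G + K) + K + I + n0) + G + a + D"
    show ?thesis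
    proof (rule eventually_sequentiallyI)
      fix L assume L0: "L0 \<le> L"
      define p where "p = L - (G + a + D)"
      have L: "L = p + G + a + D" and p_ge: "2 * (2 + N * (G + K) + K + I + n0) \<le> p"
        using L0 by (simp_all add: p_def L0_def)
      have Ip: "I\<^sup>2 \<le> q ^ p"
      proof -
        have "I \<le> q ^ I" using power_gt_expt[of q I] q_ge_2 by simp
        then have "I\<^sup>2 \<le> (q ^ I)\<^sup>2" by (rule power_mono) simp
        also have "\<dots> = q ^ (I * 2)" by (simp only: power_mult)
        also have "\<dots> \<le> q ^ p" using q_ge_2 p_ge by (intro power_increasing) auto
        finally show ?thesis .
      qed
      have dec: "(\<Sum>d<q ^ (D + a + G + 1). \<Sum>X<q ^ (G + \<kappa>). (cmod (\<Sum>t<q ^ (K - \<kappa>). phase A I G K d (X + q ^ (G + \<kappa>) * t)))\<^sup>2)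
        \<le> \<eta>\<^sup>2 * (real (q ^ (D + a + G + 1)) * real (q ^ (G + \<kappa>)) * (real (q ^ (K - \<kappa>)))\<^sup>2)"
        unfolding \<eta>2 by (rule decay) (use a\<kappa> D in \<open>auto simp: K_def\<close>)
      have "cmod (\<Sum>n<q ^ L. character m (\<Sum>i<I. A i *
          (b ((n + i + s * q ^ (L - D))\<^sup>2) - b ((n + i + s' * q ^ (L - D))\<^sup>2))))
        \<le> real (q ^ L) * (6 * sqrt (real (q ^ (D + a + G) * q ^ K) * real (q ^ (G + K)) / real N)
            + 2 * (real I * real (4 * I) / real (q ^ G) + 2 / real (q ^ E2)) + real q * \<eta>)
          + 2 * real (q ^ (p - (p div 2 + 1)))"
        by (rule offdiagonal_bound[OF sum0 ss sD E_def K_def L E1 Ip _ z0 \<eta>0 refl dec N0])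
           (use D p_ge in \<open>auto simp: K_def\<close>)
      also have "\<dots> \<le> real (q ^ L) * (\<epsilon> / 5 + \<epsilon> / 5 + \<epsilon> / 5) + real (q ^ L) * (\<epsilon> / 5)"
      proof (intro add_mono mult_left_mono \<beta> \<eta> sqrtN[unfolded B_def])
        have "q ^ (p - (p div 2 + 1)) * q ^ n0 \<le> q ^ L"
          unfolding power_add[symmetric] using q_ge_2 p_ge by (intro power_increasing) (auto simp: L)
        then have "real (q ^ (p - (p div 2 + 1))) * real (q ^ n0) \<le> real (q ^ L)"
          by (simp only: of_nat_mult[symmetric] of_nat_le_iff)
        moreover have "real (q ^ (p - (p div 2 + 1))) * (10 / \<epsilon>) \<le> real (q ^ (p - (p div 2 + 1))) * real (q ^ n0)"
          using n0 by (intro mult_left_mono) auto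
        ultimately have "real (q ^ (p - (p div 2 + 1))) * (10 / \<epsilon>) \<le> real (q ^ L)" by linarith
        then show "2 * real (q ^ (p - (p div 2 + 1))) \<le> real (q ^ L) * (\<epsilon> / 5)"
          using \<epsilon> by (simp add: field_simps)
      qed simp
      also have "\<dots> \<le> \<epsilon> * real (q ^ L)" using \<epsilon> by (simp add: algebra_simps)
      finally show "cmod (\<Sum>n<q ^ L. character m (\<Sum>i<I. A i *
          (b ((n + i + s * q ^ (L - D))\<^sup>2) - b ((n + i + s' * q ^ (L - D))\<^sup>2)))) \<le> \<epsilon> * real (q ^ L)" .
    qed
  qed
  then show ?thesis by (rule eventually_sequentiallyI)
qed

end

subsection \<open>Exponential sums along squares\<close>

lemma power4_sum_le:
  fixes x :: "nat \<Rightarrow> real"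
  shows "(\<Sum>n<N. x n) ^ 4 \<le> real N ^ 3 * (\<Sum>n<N. x n ^ 4)"
proof -
  have 1: "(\<Sum>n<N. x n)\<^sup>2 \<le> real N * (\<Sum>n<N. (x n)\<^sup>2)"
    using sum_squared_le_card[of x "{..<N}"] by simp
  have 2: "(\<Sum>n<N. (x n)\<^sup>2)\<^sup>2 \<le> real N * (\<Sum>n<N. ((x n)\<^sup>2)\<^sup>2)"
    using sum_squared_le_card[of "\<lambda>n. (x n)\<^sup>2" "{..<N}"] by simp
  have "(\<Sum>n<N. x n) ^ 4 = ((\<Sum>n<N. x n)\<^sup>2)\<^sup>2" by (simp flip: power_mult)
  also have "\<dots> \<le> (real N * (\<Sum>n<N. (x n)\<^sup>2))\<^sup>2" by (intro power_mono 1) simp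
  also have "\<dots> = (real N)\<^sup>2 * (\<Sum>n<N. (x n)\<^sup>2)\<^sup>2" by (rule power_mult_distrib)
  also have "\<dots> \<le> (real N)\<^sup>2 * (real N * (\<Sum>n<N. ((x n)\<^sup>2)\<^sup>2))" by (intro mult_left_mono 2) simp
  also have "\<dots> = real N ^ 3 * (\<Sum>n<N. x n ^ 4)"
  proof -
    have "((x n)\<^sup>2)\<^sup>2 = x n ^ 4" for n by (simp flip: power_mult)
    then show ?thesis by (simp add: power2_eq_square[of "real N"] power3_eq_cube)
  qed
  finally show ?thesis .
qed

lemma sum_character:
  assumes "m \<ge> 1"
  shows "(\<Sum>j<m. character m (int j * y)) = (if int m dvd y then of_nat m else 0)"
proof -
  let ?z = "character m y"
  have pow: "character m (int j * y) = ?z ^ j" for j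
    by (induction j) (simp_all add: character_add distrib_right)
  have zm: "?z ^ m = 1"
    using assms unfolding pow[symmetric] by (simp add: character_eq_1_iff)
  show ?thesis
  proof (cases "?z = 1")
    case True
    then show ?thesis using character_eq_1_iff[OF assms, of y] by (simp add: pow)
  next
    case False
    then show ?thesis
      using character_eq_1_iff[OF assms, of y] geometric_sum[OF False, of m] zm by (simp add: pow)
  qed
qed

text \<open>Moving \<open>c\<close> up by \<open>r\<close> turns the phases at all
  \<open>n + r\<close> into linear forms in the same values
  \<open>b ((n + i)\<^sup>2)\<close>.\<close>

definition shifted_coeff :: "nat \<Rightarrow> (nat \<Rightarrow> int) \<Rightarrow> nat \<Rightarrow> nat \<Rightarrow> int" where
  "shifted_coeff k c r i = (if r \<le> i \<and> i - r < k then c (i - r) else 0)"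

lemma sum_shifted_coeff:
  assumes "r < R"
  shows "(\<Sum>i<k + R. shifted_coeff k c r i * g i) = (\<Sum>l<k. c l * g (l + r))"
proof -
  have "(\<Sum>i<k + R. shifted_coeff k c r i * g i) = (\<Sum>i\<in>(\<lambda>l. l + r) ` {..<k}. shifted_coeff k c r i * g i)"
  proof (rule sum.mono_neutral_right)
    show "(\<lambda>l. l + r) ` {..<k} \<subseteq> {..<k + R}" using assms by auto
    show "\<forall>i\<in>{..<k + R} - (\<lambda>l. l + r) ` {..<k}. shifted_coeff k c r i * g i = 0"
    proof
      fix i assume "i \<in> {..<k + R} - (\<lambda>l. l + r) ` {..<k}"
      then have "\<not> (r \<le> i \<and> i - r < k)" by (auto simp: image_iff) (metis le_add_diff_inverse2 lessThan_iff)
      then show "shifted_coeff k c r i * g i = 0"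
        unfolding shifted_coeff_def by (simp only: if_False mult_zero_left)
    qed
  qed simp
  also have "\<dots> = (\<Sum>l<k. c l * g (l + r))"
    by (subst sum.reindex) (auto simp: shifted_coeff_def)
  finally show ?thesis .
qed

context block_additive
begin

text \<open>Take the smallest \<open>l\<close> with \<open>c l\<close> not divisible by
  \<open>m\<close>, moved by the smaller shift. At this place the other vector shows an earlier
  coefficient or 0, both divisible by \<open>m\<close>.\<close>

lemma difference_nondegenerate:
  assumes l0: "l0 < k" "\<not> int m dvd c l0" and r: "r < R" "r' < R" "r \<noteq> r'"
  obtains i where "i < k + R" "\<not> int m dvd shifted_coeff k c r i - shifted_coeff k c r' i"
proof -
  define l where "l = (LEAST l. \<not> int m dvd c l)"
  have l: "\<not> int m dvd c l" unfolding l_def by (rule LeastI[of _ l0]) (rule l0)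
  have "l \<le> l0" unfolding l_def by (rule Least_le) (rule l0)
  then have lk: "l < k" using l0 by simp
  have small: "int m dvd c j" if "j < l" for j
    using that not_less_Least[of j "\<lambda>l. \<not> int m dvd c l"] by (auto simp: l_def)
  have main: "int m dvd shifted_coeff k c t' (l + t) \<and> shifted_coeff k c t (l + t) = c l" if "t < t'" for t t'
  proof -
    have "int m dvd c (l + t - t')" if "t' \<le> l + t" by (rule small) (use \<open>t < t'\<close> that in linarith)
    then show ?thesis using lk by (simp add: shifted_coeff_def)
  qed
  show thesis
  proof (cases "r < r'")
    case True
    show thesis
      by (rule that[of "l + r"]) (use main[OF True] lk l r in \<open>auto simp: dvd_diff_left_iff\<close>)
  next
    case False
    then have "r' < r" using r by simp
    from main[OF this] show thesis
      by (intro that[of "l + r'"]) (use lk l r in \<open>auto simp: dvd_diff_right_iff\<close>)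
  qed
qed

context
  fixes k :: nat and c :: "nat \<Rightarrow> int"
begin

definition square_phase :: "nat \<Rightarrow> complex" where
  "square_phase n = character m (\<Sum>l<k. c l * b ((n + l)\<^sup>2))"

lemma norm_square_phase [simp]: "cmod (square_phase n) = 1"
  by (simp add: square_phase_def)

definition box_phase :: "nat \<Rightarrow> nat \<Rightarrow> nat \<Rightarrow> nat \<Rightarrow> nat \<Rightarrow> nat \<Rightarrow> complex" where
  "box_phase \<mu> r r' s s' n =
    (square_phase (n + r + s * q ^ \<mu>) * cnj (square_phase (n + r + s' * q ^ \<mu>))) *
    cnj (square_phase (n + r' + s * q ^ \<mu>) * cnj (square_phase (n + r' + s' * q ^ \<mu>)))"

lemma box_phase_eq:
  assumes "r < R" "r' < R"
  shows "box_phase \<mu> r r' s s' n = character m (\<Sum>i<k + R. (shifted_coeff k c r i - shifted_coeff k c r' i) *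
    (b ((n + i + s * q ^ \<mu>)\<^sup>2) - b ((n + i + s' * q ^ \<mu>)\<^sup>2)))"
proof -
  define g where "g = (\<lambda>t i. b ((n + i + t * q ^ \<mu>)\<^sup>2))"
  have S: "(\<Sum>l<k. c l * b ((n + u + t * q ^ \<mu> + l)\<^sup>2)) = (\<Sum>i<k + R. shifted_coeff k c u i * g t i)"
    if "u < R" for u t
    unfolding sum_shifted_coeff[OF that] g_def by (simp add: ac_simps)
  have "box_phase \<mu> r r' s s' n = character m
      ((\<Sum>i<k + R. shifted_coeff k c r i * g s i) - (\<Sum>i<k + R. shifted_coeff k c r i * g s' i)
       - ((\<Sum>i<k + R. shifted_coeff k c r' i * g s i) - (\<Sum>i<k + R. shifted_coeff k c r' i * g s' i)))"
    unfolding box_phase_def square_phase_def S[OF assms(1)] S[OF assms(2)] character_diff ..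
  also have "(\<Sum>i<k + R. shifted_coeff k c r i * g s i) - (\<Sum>i<k + R. shifted_coeff k c r i * g s' i)
       - ((\<Sum>i<k + R. shifted_coeff k c r' i * g s i) - (\<Sum>i<k + R. shifted_coeff k c r' i * g s' i))
      = (\<Sum>i<k + R. (shifted_coeff k c r i - shifted_coeff k c r' i) * (g s i - g s' i))"
    unfolding sum_subtractf[symmetric] by (intro sum.cong refl) (simp add: algebra_simps)
  finally show ?thesis by (simp add: g_def)
qed

text \<open>Both shifted vectors have the same sum, which provides \<open>sum0\<close>. For
  \<open>s' < s\<close> the two are exchanged and the coefficients negated.\<close>

lemma box_phase_small:
  assumes l0: "l0 < k" "\<not> int m dvd c l0"
    and r: "r \<noteq> r'" and s: "s \<noteq> s'" and \<epsilon>: "0 < (\<epsilon>::real)"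
  shows "\<forall>\<^sub>F D in sequentially. \<forall>\<^sub>F L in sequentially.
    cmod (\<Sum>n<q ^ L. box_phase (L - D) r r' s s' n) \<le> \<epsilon> * real (q ^ L)"
proof -
  define R where "R = Suc (max r r')"
  have R: "r < R" "r' < R" by (auto simp: R_def)
  define A where "A = (\<lambda>i. shifted_coeff k c r i - shifted_coeff k c r' i)"
  obtain i where i: "i < k + R" "\<not> int m dvd A i"
    unfolding A_def by (rule difference_nondegenerate[of l0 k c r R r', OF l0 R r])
  have sum0: "(\<Sum>i<k + R. A i) = 0"
    using sum_shifted_coeff[OF R(1), of k c "\<lambda>_. 1"] sum_shifted_coeff[OF R(2), of k c "\<lambda>_. 1"]
    by (simp add: A_def sum_subtractf)
  show ?thesis
  proof (cases "s < s'")
    case True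
    show ?thesis
      using offdiagonal_small[OF sum0 i True \<epsilon>] unfolding box_phase_eq[OF R] A_def .
  next
    case False
    then have s': "s' < s" using s by simp
    have A_eq: "shifted_coeff k c r i - shifted_coeff k c r' i = A i" for i by (simp add: A_def)
    have neg: "(\<Sum>i<k + R. A i * (f i - g i)) = (\<Sum>i<k + R. - A i * (g i - f i))" for f g
      by (intro sum.cong refl) (simp add: algebra_simps)
    have "(\<Sum>i<k + R. - A i) = 0" "\<not> int m dvd - A i" using sum0 i by (simp_all add: sum_negf)
    from offdiagonal_small[OF this(1) i(1) this(2) s' \<epsilon>] show ?thesis
      unfolding box_phase_eq[OF R] A_eq neg .
  qed
qed

text \<open>Quadruples with \<open>r = r'\<close> or \<open>s = s'\<close> are bounded trivially,
  all others by \<open>1 / real R\<close>. The bounds add up to \<open>3 * real R ^ 3\<close>, and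
  \<open>box_inequality\<close> contributes \<open>real R ^ 4\<close>, a saving of one power of
  \<open>R\<close>.\<close>

lemma fourth_moment:
  assumes l0: "l0 < k" "\<not> int m dvd c l0" and R: "0 < R"
  shows "\<forall>\<^sub>F D in sequentially. \<forall>\<^sub>F L in sequentially.
    (\<Sum>n<q ^ L. (cmod (\<Sum>r<R. \<Sum>s<R. square_phase (n + r + s * q ^ (L - D)))) ^ 4) \<le> 3 * real R ^ 7 * real (q ^ L)"
proof -
  define bnd where "bnd = (\<lambda>(r::nat) r' (s::nat) s'. of_bool (r = r') + of_bool (s = s') + 1 / real R :: real)"
  have pt: "\<forall>\<^sub>F D in sequentially. \<forall>\<^sub>F L in sequentially.
      cmod (\<Sum>n<q ^ L. box_phase (L - D) r r' s s' n) \<le> bnd r r' s s' * real (q ^ L)" for r r' s s'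
  proof (cases "r = r' \<or> s = s'")
    case True
    have "cmod (\<Sum>n<q ^ L. box_phase \<mu> r r' s s' n) \<le> bnd r r' s s' * real (q ^ L)" for \<mu> L
    proof -
      have "cmod (\<Sum>n<q ^ L. box_phase \<mu> r r' s s' n) \<le> of_nat (card {..<q ^ L}) * 1"
        by (rule order_trans[OF norm_sum sum_bounded_above]) (simp add: box_phase_def norm_mult)
      also have "\<dots> \<le> bnd r r' s s' * real (q ^ L)"
        using True by (auto simp: bnd_def mult_le_cancel_right1 add_nonneg_nonneg)
      finally show ?thesis .
    qed
    then show ?thesis by simp
  next
    case False
    have "0 < 1 / real R" using R by simp
    from box_phase_small[OF l0 _ _ this, of r r' s s'] False show ?thesis by (simp add: bnd_def)
  qed
  have "\<forall>\<^sub>F D in sequentially. \<forall>\<^sub>F L in sequentially. \<forall>s\<in>{..<R}. \<forall>s'\<in>{..<R}. \<forall>r\<in>{..<R}. \<forall>r'\<in>{..<R}.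
      cmod (\<Sum>n<q ^ L. box_phase (L - D) r r' s s' n) \<le> bnd r r' s s' * real (q ^ L)"
    by (simp only: eventually_ball_finite_distrib finite_lessThan) (intro ballI pt)
  then show ?thesis
  proof (elim eventually_mono)
    fix D L
    assume all: "\<forall>s\<in>{..<R}. \<forall>s'\<in>{..<R}. \<forall>r\<in>{..<R}. \<forall>r'\<in>{..<R}.
      cmod (\<Sum>n<q ^ L. box_phase (L - D) r r' s s' n) \<le> bnd r r' s s' * real (q ^ L)"
    let ?B = "\<lambda>n. \<Sum>s<R. \<Sum>s'<R. \<Sum>r<R. \<Sum>r'<R. box_phase (L - D) r r' s s' n"
    have "(\<Sum>n<q ^ L. (cmod (\<Sum>r<R. \<Sum>s<R. square_phase (n + r + s * q ^ (L - D)))) ^ 4)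
        \<le> (\<Sum>n<q ^ L. (real R)\<^sup>2 * (real R)\<^sup>2 * Re (?B n))"
      using box_inequality[of "\<lambda>r s. square_phase (_ + r + s * q ^ (L - D))" "{..<R}" "{..<R}"]
      by (intro sum_mono) (simp add: box_phase_def)
    also have "\<dots> = real R ^ 4 * Re (\<Sum>n<q ^ L. ?B n)"
      by (simp add: sum_distrib_left Re_sum flip: power_add)
    also have "(\<Sum>n<q ^ L. ?B n) = (\<Sum>s<R. \<Sum>s'<R. \<Sum>n<q ^ L. \<Sum>r<R. \<Sum>r'<R. box_phase (L - D) r r' s s' n)"
      by (rule sum_swap_last[symmetric, where A = "{..<R}" and B = "{..<R}" and C = "{..<q ^ L}",
            of "\<lambda>s s' n. \<Sum>r<R. \<Sum>r'<R. box_phase (L - D) r r' s s' n"])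
    also have "\<dots> = (\<Sum>s<R. \<Sum>s'<R. \<Sum>r<R. \<Sum>r'<R. \<Sum>n<q ^ L. box_phase (L - D) r r' s s' n)"
      by (rule sum.cong[OF refl], rule sum.cong[OF refl], rule sum_swap_last[symmetric])
    also have "Re \<dots> \<le> cmod \<dots>" by (rule complex_Re_le_cmod)
    also have "\<dots> \<le> (\<Sum>s<R. \<Sum>s'<R. \<Sum>r<R. \<Sum>r'<R. bnd r r' s s' * real (q ^ L))"
      using all by (intro sum_norm_le) auto
    also have "\<dots> = 3 * real R ^ 3 * real (q ^ L)"
    proof -
      have d: "(\<Sum>x<R. \<Sum>y<R. of_bool (x = y)) = real R"
        by (simp add: of_bool_def sum.delta)
      have "(\<Sum>s<R. \<Sum>s'<R. \<Sum>r<R. \<Sum>r'<R. bnd r r' s s') = real R ^ 3 + real R ^ 3 + real R ^ 4 / real R"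
        unfolding bnd_def sum.distrib d
        by (simp add: sum_distrib_left[symmetric] d power3_eq_cube power4_eq_xxxx)
      also have "\<dots> = 3 * real R ^ 3" using R by (simp add: power3_eq_cube power4_eq_xxxx)
      finally show ?thesis by (simp flip: sum_distrib_right)
    qed
    finally have "(\<Sum>n<q ^ L. (cmod (\<Sum>r<R. \<Sum>s<R. square_phase (n + r + s * q ^ (L - D)))) ^ 4)
        \<le> real R ^ 4 * (3 * real R ^ 3 * real (q ^ L))"
      by (simp add: mult_left_mono)
    then show "(\<Sum>n<q ^ L. (cmod (\<Sum>r<R. \<Sum>s<R. square_phase (n + r + s * q ^ (L - D)))) ^ 4)
        \<le> 3 * real R ^ 7 * real (q ^ L)"
      by (simp add: mult.assoc mult.left_commute flip: power_add)
  qed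
qed

lemma square_phase_average:
  assumes l0: "l0 < k" "\<not> int m dvd c l0"
  shows "(\<lambda>N. (\<Sum>n<N. square_phase n) / of_nat N) \<longlonglongrightarrow> 0"
proof (rule LIMSEQ_I)
  fix e :: real assume e: "0 < e"
  \<comment> \<open>Makes \<open>3 * real R ^ 7 * real q\<close> smaller than
    \<open>real R ^ 8 * (e / 4) ^ 4\<close>; the factor \<open>q\<close> pays for enlarging
    \<open>N\<close> to the next power of \<open>q\<close>.\<close>
  obtain R where R: "3 * real q / (e / 4) ^ 4 < real R" using reals_Archimedean2 by blast
  have "0 < real R" using R e by (intro le_less_trans[OF _ R]) simp
  then have R0: "0 < R" by simp
  \<comment> \<open>Keeps the largest shift, about \<open>R * q ^ (L - D)\<close>, small against
    \<open>N\<close>.\<close>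
  obtain D1 where D1: "2 * real R * real q * 4 / e < real (q ^ D1)" by (rule ex_power_gt[OF q_ge_2])
  have "\<forall>\<^sub>F D in sequentially. D1 \<le> D \<and> (\<forall>\<^sub>F L in sequentially.
    (\<Sum>n<q ^ L. (cmod (\<Sum>r<R. \<Sum>s<R. square_phase (n + r + s * q ^ (L - D)))) ^ 4) \<le> 3 * real R ^ 7 * real (q ^ L))"
    by (intro eventually_conj fourth_moment[OF l0 R0] eventually_ge_at_top)
  then obtain D where D: "D1 \<le> D" and "\<forall>\<^sub>F L in sequentially.
    (\<Sum>n<q ^ L. (cmod (\<Sum>r<R. \<Sum>s<R. square_phase (n + r + s * q ^ (L - D)))) ^ 4) \<le> 3 * real R ^ 7 * real (q ^ L)"
    by (auto dest: eventually_happens)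
  then obtain L0 where L0: "\<And>L. L0 \<le> L \<Longrightarrow>
    (\<Sum>n<q ^ L. (cmod (\<Sum>r<R. \<Sum>s<R. square_phase (n + r + s * q ^ (L - D)))) ^ 4) \<le> 3 * real R ^ 7 * real (q ^ L)"
    unfolding eventually_sequentially by blast
  obtain N1 where N1: "2 * real R * 4 / e < real N1" using reals_Archimedean2 by blast
  define N0 where "N0 = q ^ (L0 + D) + N1"
  show "\<exists>N0. \<forall>N\<ge>N0. cmod ((\<Sum>n<N. square_phase n) / of_nat N - 0) < e"
  proof (intro exI[of _ N0] allI impI)
    fix N assume N: "N0 \<le> N"
    have N_ge: "q ^ (L0 + D) \<le> N" "N1 \<le> N" using N by (simp_all add: N0_def)
    have "1 \<le> q ^ (L0 + D)" by (simp add: Suc_le_eq)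
    then have Npos: "1 \<le> N" using N_ge by linarith
    obtain L' where L': "q ^ L' \<le> N" "N < q ^ (L' + 1)"
      using ex_power_ivl1[OF q_ge_2 Npos] by blast
    define L where "L = L' + 1"
    have "q ^ (L0 + D) < q ^ L" using N_ge L' by (simp add: L_def)
    then have "L0 + D < L" using q_ge_2 by (simp add: power_strict_increasing_iff)
    then have LD: "L0 \<le> L" "D \<le> L" by auto
    define Q where "Q = q ^ (L - D)"
    have QN: "real Q * real (q ^ D) \<le> real q * real N"
    proof -
      have "Q * q ^ D = q ^ L" using LD by (simp add: Q_def flip: power_add)
      also have "\<dots> \<le> q * N" using L' by (simp add: L_def)
      finally have "real (Q * q ^ D) \<le> real (q * N)" by (simp only: of_nat_le_iff)
      then show ?thesis by (simp only: of_nat_mult)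
    qed
    let ?X = "\<lambda>n. \<Sum>r<R. \<Sum>s<R. square_phase (n + r + s * Q)"
    have shift: "cmod (of_nat (R * R) * (\<Sum>n<N. square_phase n) - (\<Sum>n<N. ?X n)) \<le> real R * (real R * (2 * (real R + real R * real Q)))"
    proof -
      have "(\<Sum>n<N. ?X n) = (\<Sum>r<R. \<Sum>s<R. \<Sum>n<N. square_phase (n + (r + s * Q)))"
        unfolding add.assoc by (rule sum_swap_last[symmetric])
      then have "of_nat (R * R) * (\<Sum>n<N. square_phase n) - (\<Sum>n<N. ?X n)
          = - (\<Sum>r<R. \<Sum>s<R. (\<Sum>n<N. square_phase (n + (r + s * Q))) - (\<Sum>n<N. square_phase n))"
        by (simp add: sum_subtractf)
      also have "cmod \<dots> \<le> (\<Sum>r<R. \<Sum>s<R. 2 * (real R + real R * real Q))"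
        unfolding norm_minus_cancel
      proof (intro sum_norm_le)
        fix r s assume rs: "r \<in> {..<R}" "s \<in> {..<R}"
        have "r + s * Q \<le> R + R * Q" using rs by (intro add_mono mult_right_mono) auto
        then have "real (r + s * Q) \<le> real (R + R * Q)" by (simp only: of_nat_le_iff)
        moreover have "cmod ((\<Sum>n<N. square_phase (n + (r + s * Q))) - (\<Sum>n<N. square_phase n)) \<le> 2 * real (r + s * Q)"
          by (rule norm_sum_shift_le) simp
        ultimately show "cmod ((\<Sum>n<N. square_phase (n + (r + s * Q))) - (\<Sum>n<N. square_phase n)) \<le> 2 * (real R + real R * real Q)"
          by simp
      qed
      finally show ?thesis by simp
    qed
    have "cmod (\<Sum>n<N. ?X n) \<le> real R ^ 2 * real N * (e / 4)"
    proof (rule power_le_imp_le_base)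
      have "(cmod (\<Sum>n<N. ?X n)) ^ 4 \<le> (\<Sum>n<N. cmod (?X n)) ^ 4" by (intro power_mono norm_sum) simp
      also have "\<dots> \<le> real N ^ 3 * (\<Sum>n<N. (cmod (?X n)) ^ 4)" by (rule power4_sum_le)
      also have "(\<Sum>n<N. (cmod (?X n)) ^ 4) \<le> (\<Sum>n<q ^ L. (cmod (?X n)) ^ 4)"
        using L' by (intro sum_mono2) (auto simp: L_def)
      also have "\<dots> \<le> 3 * real R ^ 7 * real (q ^ L)" unfolding Q_def by (rule L0[OF LD(1)])
      also have "\<dots> \<le> 3 * real R ^ 7 * (real q * real N)"
      proof (rule mult_left_mono)
        have "q ^ L \<le> q * N" using L' by (simp add: L_def)
        then have "real (q ^ L) \<le> real (q * N)" by (simp only: of_nat_le_iff)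
        then show "real (q ^ L) \<le> real q * real N" by (simp only: of_nat_mult)
      qed simp
      also have "real N ^ 3 * (3 * real R ^ 7 * (real q * real N)) = real N ^ 4 * real R ^ 7 * (3 * real q)"
        by algebra
      also have "\<dots> \<le> real N ^ 4 * real R ^ 7 * (real R * (e / 4) ^ 4)"
        using R e by (intro mult_left_mono) (simp_all add: field_simps)
      also have "\<dots> = (real R ^ 2 * real N * (e / 4)) ^ Suc 3"
        by (simp add: numeral_eq_Suc)
      finally show "(cmod (\<Sum>n<N. ?X n)) ^ Suc 3 \<le> (real R ^ 2 * real N * (e / 4)) ^ Suc 3"
        by (simp add: mult_left_mono)
      show "0 \<le> real R ^ 2 * real N * (e / 4)" using e by simp
    qed
    then have part1: "cmod (\<Sum>n<N. ?X n) \<le> real R ^ 2 * (real N * (e / 4))" by (simp add: mult.assoc)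
    have part2: "2 * real R \<le> real N * (e / 4)"
    proof -
      have "real N1 \<le> real N" using N_ge by simp
      then have "2 * real R * 4 / e < real N" using N1 by linarith
      then show ?thesis using e by (simp add: field_simps)
    qed
    have part3: "2 * (real R * real Q) \<le> real N * (e / 4)"
    proof -
      have "q ^ D1 \<le> q ^ D" using D q_ge_2 by (intro power_increasing) auto
      then have "real (q ^ D1) \<le> real (q ^ D)" by (simp only: of_nat_le_iff)
      then have "2 * real R * real q * 4 / e \<le> real (q ^ D)" using D1 by linarith
      then have 1: "2 * real R * real q \<le> real (q ^ D) * (e / 4)" using e by (simp add: field_simps)
      have "2 * (real R * real Q) * real (q ^ D) = 2 * real R * (real Q * real (q ^ D))" by simp
      also have "\<dots> \<le> 2 * real R * (real q * real N)" by (rule mult_left_mono[OF QN]) simp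
      also have "\<dots> = (2 * real R * real q) * real N" by simp
      also have "\<dots> \<le> (real (q ^ D) * (e / 4)) * real N" by (rule mult_right_mono[OF 1]) simp
      also have "\<dots> = (real N * (e / 4)) * real (q ^ D)" by simp
      finally show ?thesis by (rule mult_right_le_imp_le) simp
    qed
    have part4: "2 * (real R + real R * real Q) \<le> 2 * (real N * (e / 4))"
      using part2 part3 unfolding distrib_left by linarith
    have "real R ^ 2 * cmod (\<Sum>n<N. square_phase n) = cmod (of_nat (R * R) * (\<Sum>n<N. square_phase n))"
      by (simp only: norm_mult norm_of_nat of_nat_mult power2_eq_square)
    also have "\<dots> \<le> cmod (of_nat (R * R) * (\<Sum>n<N. square_phase n) - (\<Sum>n<N. ?X n)) + cmod (\<Sum>n<N. ?X n)"
      by (subst add.commute) (rule norm_triangle_sub)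
    also have "\<dots> \<le> real R * (real R * (2 * (real N * (e / 4)))) + real R ^ 2 * (real N * (e / 4))"
      by (intro add_mono part1 part4 order_trans[OF shift] mult_left_mono) simp_all
    also have "\<dots> = real R ^ 2 * (3 / 4 * e * real N)" by (simp add: power2_eq_square algebra_simps)
    finally have "cmod (\<Sum>n<N. square_phase n) \<le> 3 / 4 * e * real N" using R0 by simp
    also have "\<dots> < e * real N" using e Npos by simp
    finally show "cmod ((\<Sum>n<N. square_phase n) / of_nat N - 0) < e"
      using Npos by (simp add: norm_divide pos_divide_less_eq)
  qed
qed

end

section \<open>From exponential sums to normality\<close>

lemma normal_along_squares:
  assumes v: "\<And>l. l < k \<Longrightarrow> v l < m"
  shows "(\<lambda>N. real (card {i. i < N \<and> (\<forall>l<k. b ((i + l)\<^sup>2) mod int m = int (v l))}) / real N)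
    \<longlonglongrightarrow> 1 / real m ^ k"
proof -
  define F where "F = ({..<k} \<rightarrow>\<^sub>E {..<m})"
  define z where "z = (\<lambda>f N. (\<Sum>i<N. character m (\<Sum>l<k. int (f l) * b ((i + l)\<^sup>2))) / of_nat N)"
  define w where "w = (\<lambda>f. character m (- (\<Sum>l<k. int (f l) * int (v l))))"
  \<comment> \<open>The trivial frequency, the only one whose exponential mean does not vanish; it
    yields the limit 1.\<close>
  define o0 where "o0 = (\<lambda>l\<in>{..<k}. 0::nat)"
  have finF: "finite F" by (simp add: F_def finite_PiE)
  have o0F: "o0 \<in> F" using m_ge_1 by (auto simp: o0_def F_def)
  have ind: "of_bool (b x mod int m = int y) * of_nat m = (\<Sum>j<m. character m (int j * (b x - int y)))"
    if "y < m" for x y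
  proof -
    have "int m dvd b x - int y \<longleftrightarrow> b x mod int m = int y mod int m" by (simp only: mod_eq_dvd_iff)
    then show ?thesis using that by (simp add: sum_character[OF m_ge_1])
  qed
  have pt: "of_bool (\<forall>l<k. b ((i + l)\<^sup>2) mod int m = int (v l)) * of_nat m ^ k
      = (\<Sum>f\<in>F. w f * character m (\<Sum>l<k. int (f l) * b ((i + l)\<^sup>2)))" for i
  proof -
    have "(of_bool (\<forall>l<k. b ((i + l)\<^sup>2) mod int m = int (v l)) :: complex)
        = (\<Prod>l<k. of_bool (b ((i + l)\<^sup>2) mod int m = int (v l)))"
      by (auto simp: of_bool_def intro!: prod_zero)
    then have "of_bool (\<forall>l<k. b ((i + l)\<^sup>2) mod int m = int (v l)) * of_nat m ^ k
        = (\<Prod>l<k. of_bool (b ((i + l)\<^sup>2) mod int m = int (v l)) * (of_nat m :: complex))"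
      by (simp add: prod.distrib)
    also have "\<dots> = (\<Prod>l<k. \<Sum>j<m. character m (int j * (b ((i + l)\<^sup>2) - int (v l))))"
      by (intro prod.cong refl ind v) simp
    also have "\<dots> = (\<Sum>f\<in>F. \<Prod>l<k. character m (int (f l) * (b ((i + l)\<^sup>2) - int (v l))))"
      unfolding F_def by (rule prod_sum_PiE) auto
    also have "\<dots> = (\<Sum>f\<in>F. w f * character m (\<Sum>l<k. int (f l) * b ((i + l)\<^sup>2)))"
      unfolding w_def character_sum[symmetric] character_add[symmetric]
      by (simp add: right_diff_distrib sum_subtractf)
    finally show ?thesis .
  qed
  have lim: "z f \<longlonglongrightarrow> of_bool (f = o0)" if f: "f \<in> F" for f
  proof (cases "f = o0")
    case True
    have "z f N = of_nat N / of_nat N" for N by (simp add: z_def True o0_def)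
    then have "\<forall>\<^sub>F N in sequentially. z f N = 1"
      by (auto simp: eventually_sequentially intro!: exI[of _ 1])
    then show ?thesis using True by (simp add: tendsto_eventually)
  next
    case False
    have "\<exists>l<k. f l \<noteq> 0"
    proof (rule ccontr)
      assume "\<not> ?thesis"
      then have "f = o0"
        using f o0F unfolding F_def by (intro PiE_ext[of f _ _ o0]) (auto simp: o0_def)
      with False show False by simp
    qed
    then obtain l where l: "l < k" "f l \<noteq> 0" by blast
    have "f l < m" using f l by (auto simp: F_def PiE_iff)
    then have "\<not> int m dvd int (f l)" using l by (auto dest: dvd_imp_le)
    from square_phase_average[of l k "\<lambda>l. int (f l)", OF l(1) this]
    show ?thesis using False by (simp add: z_def square_phase_def)
  qed
  have "(\<lambda>N. \<Sum>f\<in>F. w f * z f N) \<longlonglongrightarrow> (\<Sum>f\<in>F. w f * of_bool (f = o0))"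
    by (intro tendsto_intros lim)
  also have "(\<Sum>f\<in>F. w f * of_bool (f = o0)) = 1"
  proof -
    have "(\<Sum>f\<in>F. w f * of_bool (f = o0)) = (\<Sum>f\<in>F. if f = o0 then w f else 0)"
      by (intro sum.cong refl) simp
    also have "\<dots> = w o0" using finF o0F by (simp add: sum.delta)
    also have "w o0 = 1" by (simp add: w_def o0_def)
    finally show ?thesis .
  qed
  finally have lim1: "(\<lambda>N. \<Sum>f\<in>F. w f * z f N) \<longlonglongrightarrow> 1" .
  define cnt where "cnt = (\<lambda>N. card {i. i < N \<and> (\<forall>l<k. b ((i + l)\<^sup>2) mod int m = int (v l))})"
  have "(\<Sum>f\<in>F. w f * z f N) = of_real (real (cnt N) / real N * real m ^ k)" for N
  proof -
    have "(\<Sum>f\<in>F. w f * z f N) = (\<Sum>f\<in>F. \<Sum>i<N. w f * character m (\<Sum>l<k. int (f l) * b ((i + l)\<^sup>2))) / of_nat N"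
      by (simp add: z_def sum_distrib_left sum_divide_distrib)
    also have "\<dots> = (\<Sum>i<N. \<Sum>f\<in>F. w f * character m (\<Sum>l<k. int (f l) * b ((i + l)\<^sup>2))) / of_nat N"
      by (subst sum.swap) simp
    also have "\<dots> = (\<Sum>i<N. of_bool (\<forall>l<k. b ((i + l)\<^sup>2) mod int m = int (v l)) * of_nat m ^ k) / of_nat N"
      by (simp only: pt)
    also have "\<dots> = of_nat (cnt N) * of_nat m ^ k / of_nat N"
    proof -
      have "{..<N} \<inter> {i. \<forall>l<k. b ((i + l)\<^sup>2) mod int m = int (v l)}
          = {i. i < N \<and> (\<forall>l<k. b ((i + l)\<^sup>2) mod int m = int (v l))}" by auto
      then have "(\<Sum>i<N. of_bool (\<forall>l<k. b ((i + l)\<^sup>2) mod int m = int (v l)) :: complex) = of_nat (cnt N)"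
        by (simp add: cnt_def)
      then show ?thesis by (simp only: sum_distrib_right[symmetric])
    qed
    finally show ?thesis by simp
  qed
  then have "(\<lambda>N. complex_of_real (real (cnt N) / real N * real m ^ k)) \<longlonglongrightarrow> of_real 1"
    using lim1 by simp
  then have "(\<lambda>N. real (cnt N) / real N * real m ^ k) \<longlonglongrightarrow> 1"
    by (simp only: tendsto_of_real_iff)
  then have "(\<lambda>N. real (cnt N) / real N * real m ^ k / real m ^ k) \<longlonglongrightarrow> 1 / real m ^ k"
    by (intro tendsto_divide tendsto_const) (use m_ge_1 in auto)
  then show ?thesis using m_ge_1 by (simp add: cnt_def)
qed

end

theorem theorem1:
  fixes q m' :: nat and b :: "nat \<Rightarrow> nat"
  assumes "q \<ge> 2"
    and "digital_function q b"
    and "m' \<ge> 1"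
    and "gcd (q - 1) m' = 1"
    and "gcd m' (Gcd (range b)) = 1"
  shows "normal_sequence m' (\<lambda>n. b (n ^ 2) mod m')"
proof -
  obtain a where b: "b 0 = 0" "\<And>n. b (q * n) = b n"
    "\<And>u v w p. \<lbrakk>v < q ^ a; w < q ^ p\<rbrakk> \<Longrightarrow>
      b (u * q ^ (a + p) + v * q ^ p + w) + b v = b (u * q ^ a + v) + b (v * q ^ p + w)"
    using digital_function_glue[OF assms(1,2)] by metis
  interpret block_additive q m' a "\<lambda>n. int (b n)"
  proof
    show "coprime (int q - 1) (int m')"
    proof -
      have "int q - 1 = int (q - 1)" using assms(1) by simp
      then show ?thesis using assms(4) unfolding coprime_iff_gcd_eq_1[symmetric] by (simp only: coprime_int_iff)
    qed
    \<comment> \<open>A common divisor of all \<open>x * b n\<close> divides the absolute value of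
      \<open>x\<close> times the gcd of the values of \<open>b\<close>.\<close>
    show "int m' dvd x" if "\<And>n. int m' dvd x * int (b n)" for x
    proof -
      have "m' dvd nat \<bar>x\<bar> * b n" for n
      proof -
        have "int m' dvd \<bar>x * int (b n)\<bar>" using that[of n] by simp
        also have "\<bar>x * int (b n)\<bar> = int (nat \<bar>x\<bar> * b n)" by (simp add: abs_mult)
        finally show ?thesis by (simp only: int_dvd_int_iff)
      qed
      then have "m' dvd Gcd ((*) (nat \<bar>x\<bar>) ` range b)" by (intro Gcd_greatest) auto
      then have "m' dvd nat \<bar>x\<bar> * Gcd (range b)" by (simp add: Gcd_mult)
      then have "m' dvd nat \<bar>x\<bar>"
        using assms(5) by (simp add: coprime_dvd_mult_left_iff coprime_iff_gcd_eq_1)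
      then have "int m' dvd int (nat \<bar>x\<bar>)" by (simp only: int_dvd_int_iff)
      then show ?thesis by simp
    qed
    show "int (b (u * q ^ (a + p) + v * q ^ p + w)) + int (b v)
        = int (b (u * q ^ a + v)) + int (b (v * q ^ p + w))" if "v < q ^ a" "w < q ^ p" for u v w p
      using b(3)[OF that] by (simp flip: of_nat_add)
    show "1 \<le> m'" by (rule assms(3))
  qed (simp_all add: assms(1) b(1,2))
  show ?thesis
    unfolding normal_sequence_def
  proof (intro conjI allI impI)
    fix n show "b (n ^ 2) mod m' < m'" using assms(3) by simp
  next
    fix k :: nat and c :: "nat \<Rightarrow> nat"
    assume "\<forall>l<k. c l < m'"
    then have "(\<lambda>N. real (card {i. i < N \<and> (\<forall>l<k. int (b ((i + l)\<^sup>2)) mod int m' = int (c l))}) / real N)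
        \<longlonglongrightarrow> 1 / real m' ^ k"
      by (intro normal_along_squares) auto
    moreover have "int (b x) mod int m' = int y \<longleftrightarrow> b x mod m' = y" for x y
      by (simp only: zmod_int[symmetric] of_nat_eq_iff)
    ultimately show "(\<lambda>N. real (card {i. i < N \<and> (\<forall>l<k. b ((i + l) ^ 2) mod m' = c l)}) / real N)
        \<longlonglongrightarrow> 1 / real m' ^ k"
      by simp
  qed
qed

end
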